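(* Let $Q$ be the $q$-matrix on $\mathbf Z_+^n$ described in the context (resurrection rates equal to immigration rates), assumed conservative, with $\mathbf Z_+^n$ communicating, $G(1,\dots,1)$ positively regular, $\{B_i(u_1,\dots,u_n);1\le i\le n\}$ nonsingular, $B_{ij}(1,\dots,1)<\infty$ for all $i,j$, and $B_1(0,\dots,0)>0$. Let $P(t)=(p_{\mathbf{ij}}(t))$ be the Feller minimal $Q$-function and $\lambda_Z$ the decay parameter of $\mathbf Z_+^n$. Then there exists a quasi-stationary distribution for $P(t)$ on $\mathbf Z_+^n$ if and only if $\rho(1,\dots,1)\le0$ and $$\int_0^1\frac{\lambda_Z+A(u,u_2(u),\dots,u_n(u))}{B_1(u,u_2(u),\dots,u_n(u))}\,du>-\infty .$$ Moreover, if these conditions hold, then the generating function $M(u_1,\dots,u_n)=\sum_{\mathbf i}m_{\mathbf i}u_1^{i_1}\cdots u_n^{i_n}$ of the quasi-stationary distribution $(m_{\mathbf i};\mathbf i\in\mathbf Z_+^n)$ satisfies, on $[0,1)^n$, $$\sum_{i=1}^nB_i(u_1,\dots,u_n)\frac{\partial M}{\partial u_i}(u_1,\dots,u_n)+(\lambda_Z+A(u_1,\dots,u_n))M(u_1,\dots,u_n)=0 .$$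
   Context: Fix $n\ge1$; $\mathbf e_k$ is the $k$-th unit vector and $\chi$ the indicator function of $\mathbf Z_+^n$. The (conservative) $q$-matrix is $$q_{\mathbf{ij}}=\sum_{k=1}^n i_k b^{(k)}_{\mathbf j-\mathbf i+\mathbf e_k}\chi(\mathbf j-\mathbf i+\mathbf e_k)+a_{\mathbf j-\mathbf i}\chi(\mathbf j-\mathbf i),\qquad \mathbf i,\mathbf j\in\mathbf Z_+^n,$$ with $a_{\mathbf j}\ge0$ $(\mathbf j\ne\mathbf 0)$, $0<\sum_{\mathbf j\ne\mathbf 0}a_{\mathbf j}=-a_{\mathbf 0}<\infty$, and for each $k$: $b^{(k)}_{\mathbf j}\ge0$ $(\mathbf j\ne\mathbf e_k)$, $0<\sum_{\mathbf j\ne\mathbf e_k}b^{(k)}_{\mathbf j}=-b^{(k)}_{\mathbf e_k}<\infty$. On $[0,1]^n$: $A(u)=\sum_{\mathbf j}a_{\mathbf j}u_1^{j_1}\cdots u_n^{j_n}$, $B_k(u)=\sum_{\mathbf j}b^{(k)}_{\mathbf j}u_1^{j_1}\cdots u_n^{j_n}$, $B_{ij}=\partial B_i/\partial u_j$, $g_{ij}=\delta_{ij}-B_{ij}/b^{(i)}_{\mathbf e_i}$, $G=(g_{ij})$; $\rho(u)$ is the maximal eigenvalue of $(B_{ij}(u))$. $\{B_i\}$ is nonsingular if there is no $n\times n$ matrix $M$ with $(B_1(u),\dots,B_n(u))^{T}=M(u_1,\dots,u_n)^{T}$ for all $u$. A nonnegative matrix is positively regular if some power has all entries strictly positive. When $\rho(1,\dots,1)\le0$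 the smallest nonnegative solution in $[0,1]^n$ of $B_1=\dots=B_n=0$ is $(1,\dots,1)$, and $(u_2(u),\dots,u_n(u))$, $u\in[0,1]$, is the unique solution of $u_k'(u)=B_k(u,u_2,\dots,u_n)/B_1(u,u_2,\dots,u_n)$, $u_k(0)=0$ ($2\le k\le n$), extended continuously with $u_k(1)=1$. The integral is considered only in this case. Decay parameter $\lambda_Z\ge0$: the number with $\frac1t\log p_{\mathbf{ij}}(t)\to-\lambda_Z$ as $t\to\infty$ for all $\mathbf i,\mathbf j$. A probability distribution $(m_{\mathbf i};\mathbf i\in\mathbf Z_+^n)$ is a quasi-stationary distribution for $P(t)$ on $\mathbf Z_+^n$ if, with $p_{\mathbf j}(t)=\sum_{\mathbf i}m_{\mathbf i}p_{\mathbf{ij}}(t)$, one has $p_{\mathbf j}(t)/\sum_{\mathbf i}p_{\mathbf i}(t)=m_{\mathbf j}$ for all $\mathbf j\in\mathbf Z_+^n$ and $t>0$. *)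

theory Defs
  imports "HOL-Analysis.Analysis"
begin

text \<open>
  The state space is the type \<^typ>\<open>nat ^ 'n\<close>, with \<open>n = CARD('n)\<close>; the order and the
  (truncated) subtraction on it are componentwise, and \<^term>\<open>axis k 1 :: nat ^ 'n\<close> is the
  unit vector in direction \<open>k\<close>.
\<close>

subsection \<open>The rates\<close>

text \<open>
  The guards are the indicator of \<open>i \<le> j + axis k 1\<close> resp.\ \<open>i \<le> j\<close>, i.e. they say that
  the integer vectors \<open>j - i + axis k 1\<close> resp.\ \<open>j - i\<close> have no negative entry; under them the
  truncated subtraction is exact.
\<close>
definition q_matrix ::
    "(nat ^ 'n \<Rightarrow> real) \<Rightarrow> ('n::finite \<Rightarrow> nat ^ 'n \<Rightarrow> real) \<Rightarrow> nat ^ 'n \<Rightarrow> nat ^ 'n \<Rightarrow> real" where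
  "q_matrix a b i j =
     (\<Sum>k\<in>UNIV. real (i $ k) *
        (if i \<le> j + axis k 1 then b k (j + axis k 1 - i) else 0))
     + (if i \<le> j then a (j - i) else 0)"

definition conservative :: "('s \<Rightarrow> 's \<Rightarrow> real) \<Rightarrow> bool" where
  "conservative Q \<longleftrightarrow> (\<forall>i. (Q i has_sum 0) UNIV)"


subsection \<open>Generating functions\<close>

definition gen_fun :: "(nat ^ 'n \<Rightarrow> real) \<Rightarrow> real ^ 'n::finite \<Rightarrow> real" where
  "gen_fun c u = (\<Sum>\<^sub>\<infinity>j. c j * (\<Prod>k\<in>UNIV. u $ k ^ (j $ k)))"

definition along :: "(real ^ 'n \<Rightarrow> real) \<Rightarrow> 'n::finite \<Rightarrow> real ^ 'n \<Rightarrow> real \<Rightarrow> real" where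
  "along f j u x = f (\<chi> k. if k = j then x else u $ k)"

text \<open>
  The functions live on \<open>[0,1]^n\<close>, so partial derivatives are one-sided on the boundary.
  A power series with coefficients that are nonnegative up to finitely many terms has a left
  derivative at \<open>1\<close> in \<open>[-\<infinity>,\<infinity>]\<close>; it is finite iff \<open>partially_differentiable\<close> holds there.
\<close>
definition partially_differentiable :: "(real ^ 'n \<Rightarrow> real) \<Rightarrow> 'n::finite \<Rightarrow> real ^ 'n \<Rightarrow> bool" where
  "partially_differentiable f j u \<longleftrightarrow> along f j u differentiable (at (u $ j) within {0..1})"

definition partial_deriv :: "(real ^ 'n \<Rightarrow> real) \<Rightarrow> 'n::finite \<Rightarrow> real ^ 'n \<Rightarrow> real" where
  "partial_deriv f j u = vector_derivative (along f j u) (at (u $ j) within {0..1})"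

definition B_matrix :: "('n::finite \<Rightarrow> nat ^ 'n \<Rightarrow> real) \<Rightarrow> real ^ 'n \<Rightarrow> real ^ 'n ^ 'n" where
  "B_matrix b u = (\<chi> i j. partial_deriv (gen_fun (b i)) j u)"

definition G_matrix :: "('n::finite \<Rightarrow> nat ^ 'n \<Rightarrow> real) \<Rightarrow> real ^ 'n \<Rightarrow> real ^ 'n ^ 'n" where
  "G_matrix b u = (\<chi> i j. (if i = j then 1 else 0) - B_matrix b u $ i $ j / b i (axis i 1))"

text \<open>
  The matrices \<^term>\<open>B_matrix b u\<close> have nonnegative off-diagonal entries, so (Perron--Frobenius)
  real eigenvalues exist and the largest one dominates the real parts of all eigenvalues.
\<close>
definition maximal_eigenvalue :: "real ^ 'n ^ 'n::finite \<Rightarrow> real" where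
  "maximal_eigenvalue M = Max {x. \<exists>v. v \<noteq> 0 \<and> M *v v = x *\<^sub>R v}"

definition rho :: "('n::finite \<Rightarrow> nat ^ 'n \<Rightarrow> real) \<Rightarrow> real ^ 'n \<Rightarrow> real" where
  "rho b u = maximal_eigenvalue (B_matrix b u)"

text \<open>\<open>^\<close> on \<^typ>\<open>real ^ 'n ^ 'n\<close> is the entrywise power, hence the explicit iteration.\<close>
definition positively_regular :: "real ^ 'n ^ 'n::finite \<Rightarrow> bool" where
  "positively_regular M \<longleftrightarrow>
     (\<forall>i j. 0 \<le> M $ i $ j) \<and> (\<exists>m\<ge>1. \<forall>i j. 0 < (((**) M) ^^ m) (mat 1) $ i $ j)"

definition nonsingular_family :: "('n::finite \<Rightarrow> nat ^ 'n \<Rightarrow> real) \<Rightarrow> bool" where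
  "nonsingular_family b \<longleftrightarrow>
     \<not> (\<exists>M :: real ^ 'n ^ 'n. \<forall>u. (\<forall>k. u $ k \<in> {0..1}) \<longrightarrow> (\<chi> i. gen_fun (b i) u) = M *v u)"


subsection \<open>The Feller minimal transition function\<close>

text \<open>
  Feller's iteration for the backward integral equation
  \[ p_{ij}(t) = \delta_{ij} e^{q_{ii} t}
       + \int_0^t e^{q_{ii} s} \sum_{k \neq i} q_{ik}\, p_{kj}(t-s)\, ds . \]
  The iterates increase to its minimal nonnegative solution; the \<open>m\<close>-th one accounts for the paths
  with fewer than \<open>m\<close> jumps.
\<close>
primrec feller_iter :: "('s \<Rightarrow> 's \<Rightarrow> real) \<Rightarrow> nat \<Rightarrow> real \<Rightarrow> 's \<Rightarrow> 's \<Rightarrow> ennreal" where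
  "feller_iter Q 0 = (\<lambda>t i j. 0)"
| "feller_iter Q (Suc m) = (\<lambda>t i j.
     (if i = j then ennreal (exp (Q i i * t)) else 0)
     + (\<integral>\<^sup>+ s\<in>{0..t}. ennreal (exp (Q i i * s)) *
          (\<integral>\<^sup>+ k\<in>- {i}. ennreal (Q i k) * feller_iter Q m (t - s) k j \<partial>count_space UNIV)
        \<partial>lborel))"

definition feller_minimal :: "('s \<Rightarrow> 's \<Rightarrow> real) \<Rightarrow> real \<Rightarrow> 's \<Rightarrow> 's \<Rightarrow> real" where
  "feller_minimal Q t i j = enn2real (SUP m. feller_iter Q m t i j)"

definition communicating :: "(real \<Rightarrow> 's \<Rightarrow> 's \<Rightarrow> real) \<Rightarrow> bool" where
  "communicating P \<longleftrightarrow> (\<forall>i j. \<exists>t\<ge>0. 0 < P t i j)"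

definition is_decay_parameter :: "(real \<Rightarrow> 's \<Rightarrow> 's \<Rightarrow> real) \<Rightarrow> real \<Rightarrow> bool" where
  "is_decay_parameter P lam \<longleftrightarrow>
     0 \<le> lam \<and> (\<forall>i j. ((\<lambda>t. 1 / t * ln (P t i j)) \<longlongrightarrow> - lam) at_top)"

definition quasi_stationary :: "(real \<Rightarrow> 's \<Rightarrow> 's \<Rightarrow> real) \<Rightarrow> ('s \<Rightarrow> real) \<Rightarrow> bool" where
  "quasi_stationary P m \<longleftrightarrow>
     (\<forall>i. 0 \<le> m i) \<and> (m has_sum 1) UNIV \<and>
     (\<forall>t>0. let p = (\<lambda>j. \<Sum>\<^sub>\<infinity>i. m i * P t i j) in \<forall>j. p j / (\<Sum>\<^sub>\<infinity>i. p i) = m j)"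


subsection \<open>The integral criterion\<close>

text \<open>
  The curve \<open>u \<mapsto> (u, u\<^sub>2(u), \<dots>, u\<^sub>n(u))\<close> in \<open>[0,1]^n\<close>, where \<open>i1\<close> is the coordinate
  numbered \<open>1\<close>.  Only its values on \<open>[0,1]\<close> matter.
\<close>
definition characteristic_curve ::
    "'n \<Rightarrow> ('n::finite \<Rightarrow> nat ^ 'n \<Rightarrow> real) \<Rightarrow> (real \<Rightarrow> real ^ 'n) \<Rightarrow> bool" where
  "characteristic_curve i1 b w \<longleftrightarrow>
     continuous_on {0..1} w \<and>
     (\<forall>u\<in>{0..1}. w u $ i1 = u \<and> (\<forall>k. w u $ k \<in> {0..1})) \<and>
     (\<forall>k. k \<noteq> i1 \<longrightarrow> w 0 $ k = 0 \<and> w 1 $ k = 1 \<and>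
        (\<forall>u\<in>{0..<1}. ((\<lambda>v. w v $ k) has_real_derivative
            gen_fun (b k) (w u) / gen_fun (b i1) (w u)) (at u within {0..1})))"

text \<open>
  Lebesgue integral with values in \<open>[-\<infinity>,\<infinity>]\<close>.  Since \<open>\<infinity> - \<infinity> = \<infinity>\<close> in \<^typ>\<open>ereal\<close>, the case of
  an infinite negative part is set to \<open>-\<infinity>\<close> explicitly.
\<close>
definition extended_integral :: "'a measure \<Rightarrow> ('a \<Rightarrow> real) \<Rightarrow> ereal" where
  "extended_integral M f =
     (let pos = (\<integral>\<^sup>+ x. ennreal (f x) \<partial>M); neg = (\<integral>\<^sup>+ x. ennreal (- f x) \<partial>M)
      in if neg = \<infinity> then - \<infinity> else enn2ereal pos - enn2ereal neg)"

end

theory Submission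
  imports Defs
begin

text \<open>
  The process is an honest multitype branching process with immigration, so a quasi-stationary
  distribution is just a stationary one and forces \<open>\<lambda>\<^sub>Z = 0\<close>. Everything is read off from the
  trajectories \<open>F(t,u)\<close> of \<open>x' = B(x)\<close>, \<open>x(0) = u\<close>, in the cube through
  \[ \sum_j p_{ij}(t) u^j = F(t,u)^i \exp \int_0^t A(F(s,u))\,ds . \]
  The right-hand side solves the backward equation and, for \<open>u < 1\<close>, vanishes as \<open>i \<rightarrow> \<infinity>\<close>; bounded
  solutions with this property are unique, hence equal to the minimal one, and \<open>u \<rightarrow> 1\<close> gives honesty.

  If \<open>m\<close> is stationary, \<open>m_0 \<le> exp \<integral>\<^sub>0\<^sup>t A(F(s,0)) ds\<close> for all \<open>t\<close>. So \<open>F(s,0)\<close>, which increases,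
  converges to a common zero of \<open>A\<close> and \<open>B\<close>; by irreducibility this is \<open>(1,\<dots>,1)\<close>, and then
  \<open>\<rho>(1,\<dots>,1) \<le> 0\<close>, as otherwise the Perron left eigenvector would push \<open>F\<close> away from \<open>(1,\<dots>,1)\<close>.
  Conversely \<open>\<rho>(1,\<dots>,1) \<le> 0\<close> forces \<open>F(s,0) \<rightarrow> (1,\<dots>,1)\<close>. The characteristic curve is \<open>s \<mapsto> F(s,0)\<close>
  parametrised by its first coordinate, so the integral in the criterion is
  \<open>\<integral>\<^sub>0\<^sup>\<infinity> A(F(s,0)) ds\<close>; when it is finite, \<open>u \<mapsto> exp \<integral>\<^sub>0\<^sup>\<infinity> A(F(s,u)) ds\<close> is the generating function of
  a stationary distribution. The differential equation is the derivative at \<open>t = 0\<close> of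
  \<open>M(u) = M(F(t,u)) exp \<integral>\<^sub>0\<^sup>t A(F(s,u)) ds\<close>.
\<close>

section \<open>Power series on the unit cube\<close>

text \<open>The rates are unbounded, with \<open>q i i\<close> growing linearly in \<open>i\<close>,
  so uniqueness for the backward equation cannot come from a bounded generator. Its substitute is
  quantitative: a trajectory starting strictly below the corner \<open>1\<close> keeps a distance
  from \<open>1\<close> on every compact time interval, so that monomials evaluated along it decay
  with the degree.

  Finite first derivatives at the corner serve twice. They are first moments of the offspring rates,
  which makes \<open>B\<close> Lipschitz on the whole closed cube, corner included; and they provide
  the linearisation at \<open>1\<close>, whose left Perron vector reduces questions about the vector
  field to a single scalar inequality.

  The value \<open>lam = 0\<close> becomes available only after the trajectory from \<open>0\<close>
  is known to converge to \<open>1\<close>. Both directions therefore establish this convergence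
  before the integral is touched. From then on the integrand is nonpositive, since
  \<open>A <= 0\<close> on the cube and \<open>B_1 > 0\<close> along the curve, and the criterion
  says that a monotone limit is finite.\<close>

definition monomial :: "nat ^ 'n \<Rightarrow> real ^ 'n::finite \<Rightarrow> real" where
  "monomial j u = (\<Prod>k\<in>UNIV. u $ k ^ (j $ k))"

definition cube :: "(real ^ 'n::finite) set" where
  "cube = {u. \<forall>k. 0 \<le> u $ k \<and> u $ k \<le> 1}"

text \<open>The termwise derivative in direction \<open>k\<close>. Where \<open>j $ k = 0\<close>
  the subtraction truncates, but then the factor \<open>real (j $ k)\<close> removes the
  term.\<close>

definition gen_partial :: "(nat ^ 'n \<Rightarrow> real) \<Rightarrow> 'n::finite \<Rightarrow> real ^ 'n \<Rightarrow> real" where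
  "gen_partial c k u = (\<Sum>\<^sub>\<infinity>j. c j * (real (j $ k) * monomial (j - axis k 1) u))"

lemma cube_eq_cbox: "cube = cbox 0 1"
  by (auto simp: cube_def mem_box_cart)

lemma compact_cube: "compact cube" and convex_cube: "convex cube" and closed_cube: "closed cube"
  by (auto simp: cube_eq_cbox)

lemma cubeD: "u \<in> cube \<Longrightarrow> 0 \<le> u $ k" "u \<in> cube \<Longrightarrow> u $ k \<le> 1"
  by (auto simp: cube_def)

lemma zero_in_cube [simp]: "0 \<in> cube" and one_in_cube [simp]: "1 \<in> cube"
  by (auto simp: cube_def)

lemma gen_fun_eq: "gen_fun c u = (\<Sum>\<^sub>\<infinity>j. c j * monomial j u)"
  by (simp add: gen_fun_def monomial_def)

lemma monomial_nonneg: "u \<in> cube \<Longrightarrow> 0 \<le> monomial j u"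
  by (auto simp: monomial_def cube_def intro!: prod_nonneg)

lemma monomial_le_1: "u \<in> cube \<Longrightarrow> monomial j u \<le> 1"
  by (auto simp: monomial_def cube_def intro!: prod_le_1 power_le_one)

lemma monomial_abs_le_1: "u \<in> cube \<Longrightarrow> \<bar>monomial j u\<bar> \<le> 1"
  using monomial_nonneg monomial_le_1 by fastforce

lemma monomial_mono: "0 \<le> u \<Longrightarrow> u \<le> v \<Longrightarrow> monomial j u \<le> monomial j v"
  by (auto simp: monomial_def less_eq_vec_def intro!: prod_mono power_mono)

lemma monomial_add: "monomial (i + j) u = monomial i u * monomial j u"
  by (simp add: monomial_def power_add prod.distrib)

lemma monomial_0 [simp]: "monomial 0 u = 1"
  by (simp add: monomial_def)

lemma monomial_one [simp]: "monomial j 1 = 1"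
  by (simp add: monomial_def)

lemma monomial_zero: "monomial j 0 = (if j = 0 then 1 else 0)"
  by (auto simp: monomial_def vec_eq_iff)

lemma monomial_axis: "monomial (axis k 1) u = u $ k"
proof -
  have "monomial (axis k 1) u = (\<Prod>l\<in>UNIV. if l = k then u $ k else 1)"
    unfolding monomial_def by (rule prod.cong) (auto simp: axis_def)
  then show ?thesis by simp
qed

lemma monomial_axis_Suc_0 [simp]: "monomial (axis k (Suc 0)) u = u $ k"
  using monomial_axis by simp

lemma continuous_on_monomial [continuous_intros]: "continuous_on S (monomial j)"
  unfolding monomial_def by (intro continuous_intros)

text \<open>Products of numbers in \<open>[0,1]\<close> differ by at most the sum of the differences
  of their factors, and \<open>x ^ n\<close> is \<open>n\<close>-Lipschitz on
  \<open>[0,1]\<close>.\<close>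

lemma monomial_diff_le:
  assumes "u \<in> cube" "v \<in> cube"
  shows "\<bar>monomial j u - monomial j v\<bar> \<le> (\<Sum>k\<in>UNIV. real (j $ k) * \<bar>u $ k - v $ k\<bar>)"
proof -
  have "\<bar>monomial j u - monomial j v\<bar> \<le> (\<Sum>k\<in>UNIV. \<bar>u $ k ^ (j $ k) - v $ k ^ (j $ k)\<bar>)"
    unfolding monomial_def real_norm_def[symmetric] using assms
    by (intro norm_prod_diff) (auto simp: cube_def norm_power intro!: power_le_one)
  also have "\<dots> \<le> (\<Sum>k\<in>UNIV. real (j $ k) * \<bar>u $ k - v $ k\<bar>)"
    unfolding real_norm_def[symmetric] using assms
    by (intro sum_mono norm_power_diff) (auto simp: cube_def)
  finally show ?thesis .
qed

section \<open>Tools for unordered sums\<close>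

lemma abs_summable_real:
  fixes f :: "'a \<Rightarrow> real"
  shows "f summable_on A \<Longrightarrow> (\<lambda>x. norm (f x)) summable_on A"
  by (rule iffD1[OF summable_on_iff_abs_summable_on_real])

lemma abs_summable_times_bounded:
  fixes c :: "'a \<Rightarrow> real"
  assumes "c summable_on UNIV" "\<And>j. \<bar>f j\<bar> \<le> 1"
  shows "(\<lambda>j. c j * f j) summable_on UNIV"
proof -
  have "(\<lambda>j. norm (c j)) summable_on UNIV"
    using assms(1) summable_on_iff_abs_summable_on_real by blast
  then have "(\<lambda>j. norm (c j * f j)) summable_on UNIV"
    by (rule summable_on_comparison_test)
       (auto simp: abs_mult intro!: mult_left_le assms)
  then show ?thesis using summable_on_iff_abs_summable_on_real by blast
qed

lemma has_sum_sum:
  fixes f :: "'k \<Rightarrow> 'a \<Rightarrow> real"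
  assumes "finite S" "\<And>k. k \<in> S \<Longrightarrow> (f k has_sum s k) A"
  shows "((\<lambda>j. \<Sum>k\<in>S. f k j) has_sum (\<Sum>k\<in>S. s k)) A"
  using assms by (induction S rule: finite_induct) (auto intro!: has_sum_add)

lemma has_sum_diff_real:
  fixes f g :: "'a \<Rightarrow> real"
  assumes "(f has_sum x) A" "(g has_sum y) A"
  shows "((\<lambda>j. f j - g j) has_sum (x - y)) A"
proof -
  have "((\<lambda>j. f j + (-1) * g j) has_sum (x + (-1) * y)) A"
    by (intro has_sum_add has_sum_cmult_right assms)
  then show ?thesis by simp
qed

text \<open>Each mechanism has a single coefficient of possibly negative sign. In applications
  \<open>S\<close> contains that index, or a single term to be isolated from a nonnegative
  series.\<close>

lemma has_sum_nonneg_le: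
  fixes f :: "'a \<Rightarrow> real"
  assumes "(f has_sum s) UNIV" "finite S" "\<And>x. x \<notin> S \<Longrightarrow> 0 \<le> f x"
  shows "sum f S \<le> s"
proof -
  have "(f has_sum (s - sum f S)) (UNIV - S)"
    by (intro has_sum_Diff assms) (use assms(2) in auto)
  then have "0 \<le> s - sum f S" by (rule has_sum_nonneg) (use assms(3) in auto)
  then show ?thesis by simp
qed

lemma summable_sum_abs:
  fixes f :: "'k::finite \<Rightarrow> 'a \<Rightarrow> real"
  assumes "\<And>k. f k summable_on A"
  shows "(\<lambda>j. \<Sum>k\<in>UNIV. \<bar>f k j\<bar>) summable_on A"
proof -
  have "\<exists>s. ((\<lambda>j. \<bar>f k j\<bar>) has_sum s) A" for k
    using assms[of k] summable_on_iff_abs_summable_on_real[of "f k" A]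
    by (auto simp: summable_on_def)
  then obtain s where "\<And>k. ((\<lambda>j. \<bar>f k j\<bar>) has_sum s k) A" by metis
  then have "((\<lambda>j. \<Sum>k\<in>UNIV. \<bar>f k j\<bar>) has_sum (\<Sum>k\<in>UNIV. s k)) A"
    by (intro has_sum_sum) auto
  then show ?thesis by (rule has_sum_imp_summable)
qed

lemma gen_fun_has_sum:
  assumes "c summable_on UNIV" "u \<in> cube"
  shows "((\<lambda>j. c j * monomial j u) has_sum gen_fun c u) UNIV"
  unfolding gen_fun_eq
  using abs_summable_times_bounded[OF assms(1), of "\<lambda>j. monomial j u"] monomial_abs_le_1[OF assms(2)]
  by (intro has_sum_infsum) simp

lemma continuous_on_gen_fun:
  assumes "c summable_on UNIV"
  shows "continuous_on cube (gen_fun c)"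
proof (rule uniform_limit_theorem)
  show "uniform_limit cube (\<lambda>X u. \<Sum>j\<in>X. c j * monomial j u) (gen_fun c) (finite_subsets_at_top UNIV)"
    unfolding gen_fun_eq[abs_def]
  proof (rule Weierstrass_m_test_general)
    show "(\<lambda>j. norm (c j)) summable_on UNIV"
      by (rule abs_summable_real[OF assms])
    show "norm (c j * monomial j u) \<le> norm (c j)" if "u \<in> cube" for j u
      using mult_left_le[OF monomial_abs_le_1[OF that], of "\<bar>c j\<bar>" j] by (simp add: abs_mult)
  qed
  have "continuous_on cube (\<lambda>u. \<Sum>j\<in>X. c j * monomial j u)" for X
    by (intro continuous_on_sum continuous_on_mult continuous_on_const continuous_on_monomial)
  then show "\<forall>\<^sub>F X in finite_subsets_at_top UNIV. continuous_on cube (\<lambda>u. \<Sum>j\<in>X. c j * monomial j u)"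
    by (intro always_eventually allI)
qed simp

section \<open>Differentiability and Lipschitz bounds up to the boundary of the cube\<close>

lemma has_derivative_monomial:
  "(monomial j has_derivative (\<lambda>h. \<Sum>k\<in>UNIV. h $ k * (real (j $ k) * monomial (j - axis k 1) u)))
     (at u within S)"
proof -
  have "((\<lambda>u. \<Prod>k\<in>UNIV. u $ k ^ (j $ k)) has_derivative
     (\<lambda>h. \<Sum>k\<in>UNIV. (real (j $ k) * (h $ k) * u $ k ^ (j $ k - 1)) * (\<Prod>l\<in>UNIV-{k}. u $ l ^ (j $ l))))
     (at u within S)"
    by (rule has_derivative_prod)
       (auto intro!: derivative_eq_intros bounded_linear_imp_has_derivative bounded_linear_vec_nth)
  moreover have "u $ k ^ (j $ k - 1) * (\<Prod>l\<in>UNIV-{k}. u $ l ^ (j $ l)) = monomial (j - axis k 1) u" for k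
  proof -
    have "monomial (j - axis k 1) u = u $ k ^ (j $ k - 1) * (\<Prod>l\<in>UNIV-{k}. u $ l ^ ((j - axis k 1) $ l))"
      unfolding monomial_def by (subst prod.remove[of _ k]) (auto simp: axis_def)
    also have "(\<Prod>l\<in>UNIV-{k}. u $ l ^ ((j - axis k 1) $ l)) = (\<Prod>l\<in>UNIV-{k}. u $ l ^ (j $ l))"
      by (rule prod.cong) (auto simp: axis_def)
    finally show ?thesis by simp
  qed
  ultimately show ?thesis
    by (simp add: monomial_def[symmetric] mult_ac)
qed

text \<open>First moments dominate all difference quotients uniformly on the cube. The tail of the
  series is therefore uniformly small, and a polynomial remains; nothing beyond the closed cube is
  needed.\<close>

lemma gen_fun_has_derivative:
  fixes c :: "nat ^ 'n::finite \<Rightarrow> real"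
  assumes c: "c summable_on UNIV"
    and ck: "\<And>k. (\<lambda>j. c j * real (j $ k)) summable_on UNIV"
    and u: "u \<in> cube"
  shows "(gen_fun c has_derivative (\<lambda>h. \<Sum>k\<in>UNIV. h $ k * gen_partial c k u)) (at u within cube)"
  unfolding has_derivative_within_alt
proof (intro conjI allI impI)
  show "bounded_linear (\<lambda>h. \<Sum>k\<in>UNIV. h $ k * gen_partial c k u)"
    by (intro bounded_linear_sum bounded_linear_mult_const bounded_linear_vec_nth)
next
  fix e :: real assume e: "0 < e"
  define K where "K j = (\<Sum>k\<in>UNIV. \<bar>c j * real (j $ k)\<bar>)" for j
  define D where "D j h = (\<Sum>k\<in>UNIV. h $ k * (real (j $ k) * monomial (j - axis k 1) u))" for j and h :: "real^'n"
  have K_sum: "K summable_on UNIV"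
    unfolding K_def by (rule summable_sum_abs[OF ck])
  have K0: "K j \<ge> 0" for j by (simp add: K_def sum_nonneg)
  \<comment> \<open>The tail is charged twice, once for the increment and once for its linear part,
    so \<open>e / 4\<close> leaves \<open>e / 2\<close> for the polynomial.\<close>
  obtain N where N: "finite N" "(\<Sum>\<^sub>\<infinity>j\<in>-N. K j) < e / 4"
  proof -
    have "(K has_sum infsum K UNIV) UNIV" using K_sum by auto
    then have "\<forall>\<^sub>F X in finite_subsets_at_top UNIV. dist (sum K X) (infsum K UNIV) < e/4"
      using e by (intro tendstoD) (auto simp: has_sum_def)
    then obtain N where N: "finite N" "dist (sum K N) (infsum K UNIV) < e/4"
      unfolding eventually_finite_subsets_at_top by auto
    have "infsum K UNIV = infsum K N + infsum K (-N)"
      using infsum_Un_disjoint[OF summable_on_subset_banach[OF K_sum subset_UNIV]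
          summable_on_subset_banach[OF K_sum subset_UNIV], of N "-N"] by simp
    with N that[of N] show ?thesis by (auto simp: dist_real_def)
  qed
  have mono_le: "\<bar>c j * (monomial j v - monomial j u)\<bar> \<le> K j * norm (v - u)" if "v \<in> cube" for j v
  proof -
    have "\<bar>c j * (monomial j v - monomial j u)\<bar> \<le> \<bar>c j\<bar> * (\<Sum>k\<in>UNIV. real (j $ k) * \<bar>v $ k - u $ k\<bar>)"
      unfolding abs_mult using monomial_diff_le[OF that u] by (intro mult_left_mono) auto
    also have "\<dots> = (\<Sum>k\<in>UNIV. \<bar>c j * real (j $ k)\<bar> * \<bar>(v - u) $ k\<bar>)"
      by (simp add: sum_distrib_left abs_mult mult_ac)
    also have "\<dots> \<le> (\<Sum>k\<in>UNIV. \<bar>c j * real (j $ k)\<bar> * norm (v - u))"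
      by (intro sum_mono mult_left_mono component_le_norm_cart) auto
    finally show ?thesis by (simp add: K_def sum_distrib_right)
  qed
  have D_le: "\<bar>c j * D j (v - u)\<bar> \<le> K j * norm (v - u)" for j v
  proof -
    have "\<bar>c j * D j (v - u)\<bar> = \<bar>\<Sum>k\<in>UNIV. c j * ((v - u) $ k * (real (j $ k) * monomial (j - axis k 1) u))\<bar>"
      by (simp add: D_def sum_distrib_left)
    also have "\<dots> \<le> (\<Sum>k\<in>UNIV. \<bar>c j * ((v - u) $ k * (real (j $ k) * monomial (j - axis k 1) u))\<bar>)"
      by (rule sum_abs)
    also have "\<dots> \<le> (\<Sum>k\<in>UNIV. \<bar>c j * real (j $ k)\<bar> * norm (v - u))"
    proof (rule sum_mono)
      fix k
      have "\<bar>c j * ((v - u) $ k * (real (j $ k) * monomial (j - axis k 1) u))\<bar>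
        = \<bar>c j * real (j $ k)\<bar> * (\<bar>(v - u) $ k\<bar> * \<bar>monomial (j - axis k 1) u\<bar>)"
        by (simp add: abs_mult mult_ac)
      also have "\<dots> \<le> \<bar>c j * real (j $ k)\<bar> * (norm (v - u) * 1)"
        by (intro mult_left_mono mult_mono component_le_norm_cart monomial_abs_le_1 u) auto
      finally show "\<bar>c j * ((v - u) $ k * (real (j $ k) * monomial (j - axis k 1) u))\<bar>
        \<le> \<bar>c j * real (j $ k)\<bar> * norm (v - u)" by simp
    qed
    finally show ?thesis by (simp add: K_def sum_distrib_right)
  qed
  have der: "((\<lambda>v. \<Sum>j\<in>N. c j * monomial j v) has_derivative (\<lambda>h. \<Sum>j\<in>N. c j * D j h)) (at u within cube)"
    unfolding D_def by (intro has_derivative_sum has_derivative_mult_right has_derivative_monomial)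
  obtain d where d: "d > 0" "\<And>v. v \<in> cube \<Longrightarrow> norm (v - u) < d \<Longrightarrow>
      norm ((\<Sum>j\<in>N. c j * monomial j v) - (\<Sum>j\<in>N. c j * monomial j u) - (\<Sum>j\<in>N. c j * D j (v - u)))
        \<le> e/2 * norm (v - u)"
  proof -
    have "0 < e/2" using e by simp
    then obtain d where "d > 0" "\<forall>v\<in>cube. norm (v - u) < d \<longrightarrow>
      norm ((\<Sum>j\<in>N. c j * monomial j v) - (\<Sum>j\<in>N. c j * monomial j u) - (\<Sum>j\<in>N. c j * D j (v - u)))
        \<le> e/2 * norm (v - u)"
      using der unfolding has_derivative_within_alt by meson
    then show ?thesis using that by simp
  qed
  show "\<exists>d>0. \<forall>v\<in>cube. norm (v - u) < d \<longrightarrow>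
      norm (gen_fun c v - gen_fun c u - (\<Sum>k\<in>UNIV. (v - u) $ k * gen_partial c k u)) \<le> e * norm (v - u)"
  proof (intro exI[of _ d] conjI ballI impI d(1))
    fix v assume v: "v \<in> cube" "norm (v - u) < d"
    define r where "r j = c j * monomial j v - c j * monomial j u - c j * D j (v - u)" for j
    have Dsum: "((\<lambda>j. c j * D j (v - u)) has_sum (\<Sum>k\<in>UNIV. (v - u) $ k * gen_partial c k u)) UNIV"
    proof -
      have "((\<lambda>j. \<Sum>k\<in>UNIV. (v - u) $ k * (c j * (real (j $ k) * monomial (j - axis k 1) u)))
         has_sum (\<Sum>k\<in>UNIV. (v - u) $ k * gen_partial c k u)) UNIV"
        unfolding gen_partial_def
      proof (intro has_sum_sum has_sum_cmult_right has_sum_infsum)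
        fix k
        have "(\<lambda>j. (c j * real (j $ k)) * monomial (j - axis k 1) u) summable_on UNIV"
          using abs_summable_times_bounded[OF ck[of k], of "\<lambda>j. monomial (j - axis k 1) u"]
            monomial_abs_le_1[OF u] by simp
        then show "(\<lambda>j. c j * (real (j $ k) * monomial (j - axis k 1) u)) summable_on UNIV"
          by (simp only: mult.assoc)
      qed simp
      moreover have "(\<lambda>j. \<Sum>k\<in>UNIV. (v - u) $ k * (c j * (real (j $ k) * monomial (j - axis k 1) u)))
         = (\<lambda>j. c j * D j (v - u))"
        unfolding D_def sum_distrib_left by (simp only: mult.left_commute)
      ultimately show ?thesis by simp
    qed
    have r_sum: "(r has_sum (gen_fun c v - gen_fun c u - (\<Sum>k\<in>UNIV. (v - u) $ k * gen_partial c k u))) UNIV"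
      unfolding r_def
      by (intro has_sum_diff_real gen_fun_has_sum c v u Dsum)
    have r_le: "\<bar>r j\<bar> \<le> 2 * K j * norm (v - u)" for j
      using mono_le[OF v(1), of j] D_le[of j v] unfolding r_def by (simp add: algebra_simps)
    have rs: "r summable_on UNIV" using r_sum by (rule has_sum_imp_summable)
    have rN: "r summable_on N" "r summable_on -N" "K summable_on -N"
      by (rule summable_on_subset_banach[OF rs subset_UNIV] summable_on_subset_banach[OF K_sum subset_UNIV])+
    have "gen_fun c v - gen_fun c u - (\<Sum>k\<in>UNIV. (v - u) $ k * gen_partial c k u) = infsum r UNIV"
      using r_sum by (simp add: infsumI)
    also have "\<dots> = sum r N + infsum r (-N)"
      using infsum_Un_disjoint[OF rN(1) rN(2)] N(1) by simp
    finally have eq: "gen_fun c v - gen_fun c u - (\<Sum>k\<in>UNIV. (v - u) $ k * gen_partial c k u)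
       = sum r N + infsum r (-N)" .
    have "\<bar>sum r N\<bar> \<le> e/2 * norm (v - u)"
      using d(2)[OF v] by (simp add: r_def sum_subtractf)
    moreover have "\<bar>infsum r (-N)\<bar> \<le> (\<Sum>\<^sub>\<infinity>j\<in>-N. K j * (2 * norm (v - u)))"
    proof -
      have ab: "(\<lambda>j. norm (r j)) summable_on -N" by (rule abs_summable_real[OF rN(2)])
      have "norm (infsum r (-N)) \<le> (\<Sum>\<^sub>\<infinity>j\<in>-N. norm (r j))"
        by (rule norm_infsum_bound[OF ab])
      also have "\<dots> \<le> (\<Sum>\<^sub>\<infinity>j\<in>-N. K j * (2 * norm (v - u)))"
        using r_le by (intro infsum_mono ab summable_on_cmult_left rN) (auto simp: mult_ac)
      finally show ?thesis by simp
    qed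
    moreover have "\<dots> = infsum K (-N) * (2 * norm (v - u))"
      by (rule infsum_cmult_left) (use rN in auto)
    moreover have "\<dots> \<le> e/4 * (2 * norm (v - u))"
      using N(2) by (intro mult_right_mono) auto
    ultimately show "norm (gen_fun c v - gen_fun c u - (\<Sum>k\<in>UNIV. (v - u) $ k * gen_partial c k u))
        \<le> e * norm (v - u)" unfolding eq by simp
  qed
qed

lemma gen_fun_lipschitz:
  fixes c :: "nat ^ 'n::finite \<Rightarrow> real"
  assumes c: "c summable_on UNIV"
    and ck: "\<And>k. (\<lambda>j. c j * real (j $ k)) summable_on UNIV"
  obtains L where "L \<ge> 0" "\<And>u v. u \<in> cube \<Longrightarrow> v \<in> cube \<Longrightarrow> \<bar>gen_fun c u - gen_fun c v\<bar> \<le> L * norm (u - v)"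
proof
  define K where "K j = (\<Sum>k\<in>UNIV. \<bar>c j * real (j $ k)\<bar>)" for j
  have K_sum: "K summable_on UNIV"
    unfolding K_def by (rule summable_sum_abs[OF ck])
  show "infsum K UNIV \<ge> 0" by (intro infsum_nonneg) (simp add: K_def sum_nonneg)
  fix u v :: "real ^ 'n" assume uv: "u \<in> cube" "v \<in> cube"
  define r where "r j = c j * monomial j u - c j * monomial j v" for j
  have r: "(r has_sum (gen_fun c u - gen_fun c v)) UNIV"
    unfolding r_def by (intro has_sum_diff_real gen_fun_has_sum c uv)
  have r_le: "\<bar>r j\<bar> \<le> K j * norm (u - v)" for j
  proof -
    have "\<bar>r j\<bar> \<le> \<bar>c j\<bar> * (\<Sum>k\<in>UNIV. real (j $ k) * \<bar>u $ k - v $ k\<bar>)"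
      unfolding r_def right_diff_distrib[symmetric] abs_mult
      using monomial_diff_le[OF uv] by (intro mult_left_mono) auto
    also have "\<dots> = (\<Sum>k\<in>UNIV. \<bar>c j * real (j $ k)\<bar> * \<bar>(u - v) $ k\<bar>)"
      by (simp add: sum_distrib_left abs_mult mult_ac)
    also have "\<dots> \<le> (\<Sum>k\<in>UNIV. \<bar>c j * real (j $ k)\<bar> * norm (u - v))"
      by (intro sum_mono mult_left_mono component_le_norm_cart) auto
    finally show ?thesis by (simp add: K_def sum_distrib_right)
  qed
  have ab: "(\<lambda>j. norm (r j)) summable_on UNIV"
    by (rule abs_summable_real[OF has_sum_imp_summable[OF r]])
  have "norm (infsum r UNIV) \<le> (\<Sum>\<^sub>\<infinity>j. norm (r j))"
    by (rule norm_infsum_bound[OF ab])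
  also have "\<dots> \<le> (\<Sum>\<^sub>\<infinity>j. K j * norm (u - v))"
    using r_le by (intro infsum_mono ab summable_on_cmult_left K_sum) auto
  also have "\<dots> = infsum K UNIV * norm (u - v)"
    by (rule infsum_cmult_left) (use K_sum in auto)
  finally show "\<bar>gen_fun c u - gen_fun c v\<bar> \<le> infsum K UNIV * norm (u - v)"
    using r by (simp add: infsumI)
qed

section \<open>The flow of a cooperative vector field on the cube\<close>

text \<open>The weighted squared distance \<open>g\<close> is nonincreasing. Squaring keeps it
  differentiable where the two curves meet.\<close>

lemma gronwall_difference:
  fixes y z :: "real \<Rightarrow> 'a::real_inner"
  assumes y: "\<And>t. t \<in> {a..b} \<Longrightarrow> (y has_vector_derivative y' t) (at t within {a..b})"
    and z: "\<And>t. t \<in> {a..b} \<Longrightarrow> (z has_vector_derivative z' t) (at t within {a..b})"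
    and le: "\<And>t. t \<in> {a..b} \<Longrightarrow> norm (y' t - z' t) \<le> L * norm (y t - z t)"
    and ab: "a \<le> b"
  shows "norm (y b - z b) \<le> exp (L * (b - a)) * norm (y a - z a)"
proof -
  define w where "w t = y t - z t" for t
  define w' where "w' t = y' t - z' t" for t
  define g where "g t = exp (- 2 * L * (t - a)) * (w t \<bullet> w t)" for t
  have w: "(w has_vector_derivative w' t) (at t within {a..b})" if "t \<in> {a..b}" for t
    unfolding w_def w'_def using y[OF that] z[OF that] by (intro has_vector_derivative_diff)
  have g': "(g has_real_derivative exp (- 2 * L * (t - a)) * (2 * (w t \<bullet> w' t) - 2 * L * (w t \<bullet> w t)))
      (at t within {a..b})" if "t \<in> {a..b}" for t
  proof -
    have "((\<lambda>t. w t \<bullet> w t) has_vector_derivative (w t \<bullet> w' t + w' t \<bullet> w t)) (at t within {a..b})"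
      by (rule bounded_bilinear.has_vector_derivative[OF bounded_bilinear_inner w[OF that] w[OF that]])
    then have "((\<lambda>t. w t \<bullet> w t) has_real_derivative 2 * (w t \<bullet> w' t)) (at t within {a..b})"
      by (simp add: has_real_derivative_iff_has_vector_derivative inner_commute[of "w' t" "w t"])
    moreover have "((\<lambda>t. exp (- 2 * L * (t - a))) has_real_derivative - 2 * L * exp (- 2 * L * (t - a)))
        (at t within {a..b})"
      by (auto intro!: derivative_eq_intros)
    ultimately show ?thesis
      unfolding g_def by (auto intro: DERIV_cong[OF DERIV_mult] simp: algebra_simps)
  qed
  have "g b \<le> g a"
  proof (rule DERIV_nonpos_imp_decreasing_open[OF ab])
    show "continuous_on {a..b} g"
      by (rule DERIV_continuous_on[OF g'])
    fix t assume t: "a < t" "t < b"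
    have "w t \<bullet> w' t \<le> norm (w t) * norm (w' t)" by (rule norm_cauchy_schwarz)
    also have "\<dots> \<le> norm (w t) * (L * norm (w t))"
      using le[of t] t by (intro mult_left_mono) (auto simp: w_def w'_def)
    also have "\<dots> = L * (w t \<bullet> w t)" by (simp add: power2_norm_eq_inner[symmetric] power2_eq_square)
    finally have "exp (- 2 * L * (t - a)) * (2 * (w t \<bullet> w' t) - 2 * L * (w t \<bullet> w t)) \<le> 0"
      by (intro mult_nonneg_nonpos) auto
    moreover have "at t within {a..b} = at t" using t by (simp add: at_within_Icc_at)
    ultimately show "\<exists>d. (g has_real_derivative d) (at t) \<and> d \<le> 0" using g'[of t] t by auto
  qed
  then have "exp (2 * (L * (b - a))) * (exp (- (2 * (L * (b - a)))) * (norm (w b))\<^sup>2)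
      \<le> exp (2 * (L * (b - a))) * (norm (w a))\<^sup>2"
    by (intro mult_left_mono) (simp_all add: g_def power2_norm_eq_inner mult.assoc)
  also have "exp (2 * (L * (b - a))) * (exp (- (2 * (L * (b - a)))) * (norm (w b))\<^sup>2) = (norm (w b))\<^sup>2"
    by (simp add: exp_minus)
  also have "exp (2 * (L * (b - a))) * (norm (w a))\<^sup>2 = (exp (L * (b - a)) * norm (w a))\<^sup>2"
    by (simp add: power_mult_distrib exp_double)
  finally have "(norm (w b))\<^sup>2 \<le> (exp (L * (b - a)) * norm (w a))\<^sup>2" .
  then show ?thesis unfolding w_def by (rule power2_le_imp_le) auto
qed

lemma at_within_Icc_eq_Ici:
  fixes t :: real
  assumes "a \<le> t" "t < b"
  shows "at t within {a..b} = at t within {a..}"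
  by (rule at_within_nhd[of t "{..<b}"]) (use assms in auto)

lemma integral_has_vector_derivative_Ici:
  fixes g :: "real \<Rightarrow> 'a::banach"
  assumes g: "continuous_on {a..} g" and t: "a \<le> t"
  shows "((\<lambda>t. integral {a..t} g) has_vector_derivative g t) (at t within {a..})"
proof -
  have "((\<lambda>t. integral {a..t} g) has_vector_derivative g t) (at t within {a..t+1})"
    by (rule integral_has_vector_derivative) (use t in \<open>auto intro: continuous_on_subset[OF g]\<close>)
  then show ?thesis using at_within_Icc_eq_Ici[of a t "t + 1"] t by simp
qed

lemma integral_exp:
  fixes c t :: real
  assumes "0 \<le> t"
  shows "((\<lambda>s. exp (c * s) * c) has_integral (exp (c * t) - 1)) {0..t}"
proof -
  have "((\<lambda>s. exp (c * s) * c) has_integral (exp (c * t) - exp (c * 0))) {0..t}"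
    using assms by (intro fundamental_theorem_of_calculus)
      (auto intro!: derivative_eq_intros simp flip: has_real_derivative_iff_has_vector_derivative)
  then show ?thesis by simp
qed

text \<open>
  The autonomous system \<open>x' = B x\<close> on the cube. After adding a multiple of the identity, \<open>B\<close> is
  monotone and nonnegative, so Picard iteration for
  \<open>x t = e^{-ct} (u + \<integral>\<^sub>0\<^sup>t e^{cs} (B (x s) + c x s) ds)\<close> increases and stays in the cube.
\<close>
locale cube_flow =
  fixes B :: "real ^ 'n::finite \<Rightarrow> real ^ 'n" and L c :: real
  assumes lip: "u \<in> cube \<Longrightarrow> v \<in> cube \<Longrightarrow> norm (B u - B v) \<le> L * norm (u - v)"
    and mono: "u \<in> cube \<Longrightarrow> v \<in> cube \<Longrightarrow> u \<le> v \<Longrightarrow> B u + c *\<^sub>R u \<le> B v + c *\<^sub>R v"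
    and B0: "0 \<le> B 0" and B1: "B 1 = 0" and c: "0 < c"
begin

definition "C u = B u + c *\<^sub>R u"

primrec picard :: "real ^ 'n \<Rightarrow> nat \<Rightarrow> real \<Rightarrow> real ^ 'n" where
  "picard u 0 = (\<lambda>t. 0)"
| "picard u (Suc m) = (\<lambda>t. exp (- c * t) *\<^sub>R (u + integral {0..t} (\<lambda>s. exp (c * s) *\<^sub>R C (picard u m s))))"

definition flow :: "real ^ 'n \<Rightarrow> real \<Rightarrow> real ^ 'n" where
  "flow u t = (\<chi> k. lim (\<lambda>m. picard u m t $ k))"

lemma continuous_on_B: "continuous_on cube B"
proof (rule lipschitz_on_continuous_on)
  show "\<bar>L\<bar>-lipschitz_on cube B"
  proof (rule lipschitz_onI)
    fix u v :: "real^'n" assume uv: "u \<in> cube" "v \<in> cube"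
    have "norm (B u - B v) \<le> L * norm (u - v)" using lip[OF uv] .
    also have "\<dots> \<le> \<bar>L\<bar> * norm (u - v)" by (intro mult_right_mono) auto
    finally show "dist (B u) (B v) \<le> \<bar>L\<bar> * dist u v" by (simp add: dist_norm)
  qed simp
qed

lemma continuous_on_C: "continuous_on cube C"
  unfolding C_def by (intro continuous_intros continuous_on_B)

lemma C_mono: "u \<in> cube \<Longrightarrow> v \<in> cube \<Longrightarrow> u \<le> v \<Longrightarrow> C u \<le> C v"
  unfolding C_def by (rule mono)

lemma C_bounds: assumes "u \<in> cube" shows "0 \<le> C u $ k" "C u $ k \<le> c"
proof -
  have "C 0 \<le> C u"
    by (rule C_mono[OF zero_in_cube assms]) (use cubeD[OF assms] in \<open>auto simp: less_eq_vec_def\<close>)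
  moreover have "C u \<le> C 1"
    by (rule C_mono[OF assms one_in_cube]) (use cubeD[OF assms] in \<open>auto simp: less_eq_vec_def\<close>)
  ultimately show "0 \<le> C u $ k" "C u $ k \<le> c"
    using B0 B1 unfolding C_def less_eq_vec_def by (force intro: order_trans)+
qed

text \<open>Since \<open>C <= c\<close>, the integral is at most \<open>exp (c * t) - 1\<close>. The
  third bound keeps more than membership in the cube: the gap to \<open>1\<close> shrinks at most by
  the factor \<open>exp (- c * t)\<close>.\<close>

lemma picard_step_bounds:
  assumes g: "continuous_on {0..} f" "\<And>t. t \<ge> 0 \<Longrightarrow> f t \<in> cube" and u: "u \<in> cube" and t: "t \<ge> 0"
  defines "g \<equiv> \<lambda>s. exp (c * s) *\<^sub>R C (f s)"
  shows "continuous_on {0..} g"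
    "exp (- c * t) *\<^sub>R (u + integral {0..t} g) \<in> cube"
    "exp (- c * t) * (1 - u $ k) \<le> 1 - (exp (- c * t) *\<^sub>R (u + integral {0..t} g)) $ k"
proof -
  show g': "continuous_on {0..} g"
    unfolding g_def using g by (intro continuous_intros continuous_on_compose2[OF continuous_on_C]) auto
  have int: "g integrable_on {0..t}"
    by (rule integrable_continuous_interval) (auto intro: continuous_on_subset[OF g'])
  then have intk: "(\<lambda>s. g s $ k) integrable_on {0..t}" for k
    using integrable_linear[OF int bounded_linear_vec_nth] by (simp add: o_def)
  have lo: "0 \<le> integral {0..t} g $ k" for k
    unfolding integral_component_eq_cart[OF int, symmetric]
    using C_bounds g(2) by (intro integral_nonneg intk) (auto simp: g_def)
  have hi: "integral {0..t} g $ k \<le> exp (c * t) - 1" for k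
  proof -
    have "integral {0..t} (\<lambda>s. g s $ k) \<le> integral {0..t} (\<lambda>s. exp (c * s) * c)"
      using C_bounds g(2) integral_exp[OF t, of c]
      by (intro integral_le intk) (auto simp: g_def has_integral_integrable)
    also have "\<dots> = exp (c * t) - 1" by (rule integral_unique[OF integral_exp[OF t]])
    finally show ?thesis by (simp add: int)
  qed
  have key: "exp (- c * t) * (1 - u $ k) \<le> 1 - (exp (- c * t) *\<^sub>R (u + integral {0..t} g)) $ k" for k
  proof -
    have "exp (- c * t) * (u $ k + integral {0..t} g $ k) \<le> exp (- c * t) * (u $ k + (exp (c * t) - 1))"
      by (intro mult_left_mono add_left_mono hi) auto
    also have "\<dots> = 1 - exp (- c * t) * (1 - u $ k)" by (simp add: exp_minus field_simps)
    finally show ?thesis by simp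
  qed
  show "exp (- c * t) * (1 - u $ k) \<le> 1 - (exp (- c * t) *\<^sub>R (u + integral {0..t} g)) $ k" by (rule key)
  have "0 \<le> exp (- c * t) * (1 - u $ k)" for k using cubeD(2)[OF u] by simp
  then have "(exp (- c * t) *\<^sub>R (u + integral {0..t} g)) $ k \<le> 1" for k
    using key[of k] by (meson diff_ge_0_iff_ge order_trans)
  then show "exp (- c * t) *\<^sub>R (u + integral {0..t} g) \<in> cube"
    using lo cubeD(1)[OF u] by (auto simp: cube_def)
qed

lemma picard_props:
  assumes u: "u \<in> cube"
  shows "continuous_on {0..} (picard u m) \<and> (\<forall>t\<ge>0. picard u m t \<in> cube)"
proof (induction m)
  case (Suc m)
  define g where "g = (\<lambda>s. exp (c * s) *\<^sub>R C (picard u m s))"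
  have g: "continuous_on {0..} g"
    unfolding g_def by (rule picard_step_bounds[where t=0]) (use Suc u in auto)
  have "continuous_on {0..} (\<lambda>t. integral {0..t} g)"
    unfolding continuous_on_eq_continuous_within
    using has_vector_derivative_continuous[OF integral_has_vector_derivative_Ici[OF g]] by auto
  then have "continuous_on {0..} (picard u (Suc m))"
    unfolding picard.simps g_def[symmetric] by (intro continuous_intros)
  moreover have "picard u (Suc m) t \<in> cube" if "t \<ge> 0" for t
    unfolding picard.simps by (rule picard_step_bounds) (use Suc u that in auto)
  ultimately show ?case by blast
qed simp

lemma picard_cont: "u \<in> cube \<Longrightarrow> continuous_on {0..} (picard u m)"
  and picard_cube: "u \<in> cube \<Longrightarrow> t \<ge> 0 \<Longrightarrow> picard u m t \<in> cube"
  using picard_props by auto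

lemma picard_mono_step:
  assumes "continuous_on {0..} f" "\<And>t. t \<ge> 0 \<Longrightarrow> f t \<in> cube"
    and "continuous_on {0..} h" "\<And>t. t \<ge> 0 \<Longrightarrow> h t \<in> cube"
    and le: "\<And>t. t \<ge> 0 \<Longrightarrow> f t \<le> h t" and uv: "u \<in> cube" "v \<in> cube" "u \<le> v" and t: "t \<ge> 0"
  shows "exp (- c * t) *\<^sub>R (u + integral {0..t} (\<lambda>s. exp (c * s) *\<^sub>R C (f s)))
    \<le> exp (- c * t) *\<^sub>R (v + integral {0..t} (\<lambda>s. exp (c * s) *\<^sub>R C (h s)))"
proof -
  define g1 where "g1 = (\<lambda>s. exp (c * s) *\<^sub>R C (f s))"
  define g2 where "g2 = (\<lambda>s. exp (c * s) *\<^sub>R C (h s))"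
  have c1: "continuous_on {0..} g1" unfolding g1_def by (rule picard_step_bounds[where t=0]) (use assms in auto)
  have c2: "continuous_on {0..} g2" unfolding g2_def by (rule picard_step_bounds[where t=0]) (use assms in auto)
  have int: "g1 integrable_on {0..t}" "g2 integrable_on {0..t}"
    by (rule integrable_continuous_interval; auto intro: continuous_on_subset[OF c1] continuous_on_subset[OF c2])+
  have intk: "(\<lambda>s. g1 s $ k) integrable_on {0..t}" "(\<lambda>s. g2 s $ k) integrable_on {0..t}" for k
    using integrable_linear[OF int(1) bounded_linear_vec_nth] integrable_linear[OF int(2) bounded_linear_vec_nth]
    by (simp_all add: o_def)
  have "integral {0..t} g1 $ k \<le> integral {0..t} g2 $ k" for k
    unfolding integral_component_eq_cart[OF int(1), symmetric] integral_component_eq_cart[OF int(2), symmetric]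
  proof (rule integral_le[OF intk])
    fix s assume "s \<in> {0..t}"
    then have "C (f s) \<le> C (h s)" using assms by (intro C_mono) auto
    then show "g1 s $ k \<le> g2 s $ k" by (auto simp: g1_def g2_def less_eq_vec_def)
  qed
  then show ?thesis
    using uv(3) unfolding g1_def[symmetric] g2_def[symmetric]
    by (auto simp: less_eq_vec_def intro!: mult_left_mono add_mono)
qed

lemma picard_incr: "u \<in> cube \<Longrightarrow> t \<ge> 0 \<Longrightarrow> picard u m t \<le> picard u (Suc m) t"
proof (induction m arbitrary: t)
  case 0
  then show ?case using picard_cube[of u t "Suc 0"] by (simp add: cube_def less_eq_vec_def del: picard.simps) simp
next
  case (Suc m)
  have "exp (- c * t) *\<^sub>R (u + integral {0..t} (\<lambda>s. exp (c * s) *\<^sub>R C (picard u m s)))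
    \<le> exp (- c * t) *\<^sub>R (u + integral {0..t} (\<lambda>s. exp (c * s) *\<^sub>R C (picard u (Suc m) s)))"
    by (rule picard_mono_step) (use Suc picard_cont picard_cube in \<open>auto simp del: picard.simps\<close>)
  then show ?case by simp
qed

lemma picard_mono_initial:
  "u \<in> cube \<Longrightarrow> v \<in> cube \<Longrightarrow> u \<le> v \<Longrightarrow> t \<ge> 0 \<Longrightarrow> picard u m t \<le> picard v m t"
proof (induction m arbitrary: t)
  case (Suc m)
  show ?case unfolding picard.simps
    by (rule picard_mono_step) (use Suc picard_cont picard_cube in \<open>auto simp del: picard.simps\<close>)
qed simp

section \<open>The limit of the iterates and its differential equation\<close>

lemma picard_tendsto:
  assumes u: "u \<in> cube" and t: "t \<ge> 0"
  shows "(\<lambda>m. picard u m t) \<longlonglongrightarrow> flow u t"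
proof (rule vec_tendstoI)
  fix k
  have "incseq (\<lambda>m. picard u m t $ k)"
    using picard_incr[OF u t] by (intro incseq_SucI) (auto simp: less_eq_vec_def)
  moreover have "picard u m t $ k \<le> 1" for m using cubeD(2)[OF picard_cube[OF u t]] .
  ultimately have "convergent (\<lambda>m. picard u m t $ k)"
    by (metis incseq_convergent convergent_def)
  then show "(\<lambda>m. picard u m t $ k) \<longlonglongrightarrow> flow u t $ k"
    by (simp add: flow_def convergent_LIMSEQ_iff)
qed

lemma flow_in_cube: "u \<in> cube \<Longrightarrow> t \<ge> 0 \<Longrightarrow> flow u t \<in> cube"
  using closed_sequentially[OF closed_cube] picard_cube picard_tendsto by metis

lemma flow_mono:
  assumes "u \<in> cube" "v \<in> cube" "u \<le> v" "t \<ge> 0"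
  shows "flow u t \<le> flow v t"
  unfolding less_eq_vec_def
proof
  fix k
  show "flow u t $ k \<le> flow v t $ k"
    using picard_mono_initial[OF assms]
    by (intro LIMSEQ_le[OF tendsto_vec_nth[OF picard_tendsto] tendsto_vec_nth[OF picard_tendsto]])
       (auto simp: assms less_eq_vec_def)
qed

lemma flow_integral_eq:
  assumes u: "u \<in> cube" and t: "t \<ge> 0"
  shows "(\<lambda>s. exp (c * s) *\<^sub>R C (flow u s)) integrable_on {0..t}"
    "flow u t = exp (- c * t) *\<^sub>R (u + integral {0..t} (\<lambda>s. exp (c * s) *\<^sub>R C (flow u s)))"
proof -
  define g where "g m = (\<lambda>s. exp (c * s) *\<^sub>R C (picard u m s))" for m
  define G where "G = (\<lambda>s. exp (c * s) *\<^sub>R C (flow u s))"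
  have gc: "continuous_on {0..} (g m)" for m
    unfolding g_def by (rule picard_step_bounds[where t=0]) (use picard_cont picard_cube u in auto)
  have int: "g m integrable_on {0..t}" for m
    by (rule integrable_continuous_interval) (auto intro: continuous_on_subset[OF gc])
  have lim: "(\<lambda>m. g m s) \<longlonglongrightarrow> G s" if "s \<in> {0..t}" for s
    unfolding g_def G_def using that
    by (intro tendsto_scaleR tendsto_const continuous_on_tendsto_compose[OF continuous_on_C] picard_tendsto)
       (auto simp: u picard_cube flow_in_cube)
  have "norm (g m s) \<le> exp (c * t) * (real CARD('n) * c)" if s: "s \<in> {0..t}" for m s
  proof -
    have "norm (C (picard u m s)) \<le> (\<Sum>k\<in>UNIV. \<bar>C (picard u m s) $ k\<bar>)" by (rule norm_le_l1_cart)
    also have "\<dots> \<le> (\<Sum>k\<in>(UNIV::'n set). c)"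
      using C_bounds[OF picard_cube[OF u]] s by (intro sum_mono) (auto simp: abs_le_iff intro: order_trans)
    finally have "norm (C (picard u m s)) \<le> real CARD('n) * c" by simp
    then show ?thesis unfolding g_def using s c by (auto intro!: mult_mono)
  qed
  then have dc: "G integrable_on {0..t}" "(\<lambda>m. integral {0..t} (g m)) \<longlonglongrightarrow> integral {0..t} G"
    using dominated_convergence[of g "{0..t}" "\<lambda>_. exp (c * t) * (real CARD('n) * c)" G] int lim by auto
  then show "(\<lambda>s. exp (c * s) *\<^sub>R C (flow u s)) integrable_on {0..t}" by (simp add: G_def)
  have "(\<lambda>m. picard u (Suc m) t) \<longlonglongrightarrow> exp (- c * t) *\<^sub>R (u + integral {0..t} G)"
    unfolding picard.simps g_def[symmetric] by (intro tendsto_intros dc)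
  moreover have "(\<lambda>m. picard u (Suc m) t) \<longlonglongrightarrow> flow u t"
    by (rule LIMSEQ_Suc[OF picard_tendsto[OF u t]])
  ultimately show "flow u t = exp (- c * t) *\<^sub>R (u + integral {0..t} (\<lambda>s. exp (c * s) *\<^sub>R C (flow u s)))"
    unfolding G_def by (rule LIMSEQ_unique[symmetric])
qed

lemma flow_0 [simp]: "u \<in> cube \<Longrightarrow> flow u 0 = u"
  using flow_integral_eq(2)[of u 0] by simp

text \<open>Regularity is bootstrapped: the fixed point equation has an integrable integrand, so its
  indefinite integral is continuous. This makes the integrand continuous, as differentiating the
  equation will require.\<close>

lemma continuous_on_flow:
  assumes u: "u \<in> cube"
  shows "continuous_on {0..} (flow u)"
proof -
  define G where "G = (\<lambda>s. exp (c * s) *\<^sub>R C (flow u s))"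
  have "continuous (at t within {0..}) (flow u)" if t: "t \<ge> 0" for t
  proof -
    have "continuous_on {0..t+1} (\<lambda>t. integral {0..t} G)"
      unfolding G_def using t u by (intro indefinite_integral_continuous_1 flow_integral_eq) auto
    then have "continuous_on {0..t+1} (\<lambda>t. exp (- c * t) *\<^sub>R (u + integral {0..t} G))"
      by (intro continuous_intros)
    then have "continuous_on {0..t+1} (flow u)"
      by (rule continuous_on_eq) (use flow_integral_eq(2)[OF u] in \<open>auto simp: G_def\<close>)
    then have "continuous (at t within {0..t+1}) (flow u)"
      using t unfolding continuous_on_eq_continuous_within by auto
    then show ?thesis using at_within_Icc_eq_Ici[of 0 t "t + 1"] t by simp
  qed
  then show ?thesis by (auto simp: continuous_on_eq_continuous_within)
qed

lemma flow_deriv: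
  assumes u: "u \<in> cube" and t: "t \<ge> 0"
  shows "(flow u has_vector_derivative B (flow u t)) (at t within {0..})"
proof -
  define G where "G = (\<lambda>s. exp (c * s) *\<^sub>R C (flow u s))"
  have "continuous_on {0..} G"
    unfolding G_def by (rule picard_step_bounds[where t=0]) (use continuous_on_flow flow_in_cube u in auto)
  then have I: "((\<lambda>t. integral {0..t} G) has_vector_derivative G t) (at t within {0..})"
    by (rule integral_has_vector_derivative_Ici[OF _ t])
  have e: "((\<lambda>t. exp (- c * t)) has_vector_derivative - c * exp (- c * t)) (at t within {0..})"
    unfolding has_real_derivative_iff_has_vector_derivative[symmetric]
    by (auto intro!: derivative_eq_intros)
  have "((\<lambda>t. exp (- c * t) *\<^sub>R (u + integral {0..t} G)) has_vector_derivative
      (exp (- c * t) *\<^sub>R (0 + G t) + (- c * exp (- c * t)) *\<^sub>R (u + integral {0..t} G))) (at t within {0..})"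
    by (intro has_vector_derivative_scaleR has_vector_derivative_add has_vector_derivative_const I)
       (use e in \<open>simp add: has_real_derivative_iff_has_vector_derivative\<close>)
  moreover have "exp (- c * t) *\<^sub>R (0 + G t) + (- c * exp (- c * t)) *\<^sub>R (u + integral {0..t} G) = B (flow u t)"
  proof -
    have "exp (- c * t) *\<^sub>R G t = C (flow u t)" by (simp add: G_def exp_minus)
    moreover have "(- c * exp (- c * t)) *\<^sub>R (u + integral {0..t} G) = (- c) *\<^sub>R flow u t"
      using flow_integral_eq(2)[OF u t] by (simp add: G_def)
    ultimately show ?thesis by (simp add: C_def)
  qed
  ultimately have "((\<lambda>t. exp (- c * t) *\<^sub>R (u + integral {0..t} G)) has_vector_derivative B (flow u t)) (at t within {0..})"
    by simp
  then show ?thesis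
    by (rule has_vector_derivative_transform[rotated 2]) (use t flow_integral_eq(2)[OF u] in \<open>auto simp: G_def\<close>)
qed

lemma flow_lipschitz:
  assumes "u \<in> cube" "v \<in> cube" "t \<ge> 0"
  shows "norm (flow u t - flow v t) \<le> exp (L * t) * norm (u - v)"
proof -
  have "norm (flow u t - flow v t) \<le> exp (L * (t - 0)) * norm (flow u 0 - flow v 0)"
    by (rule gronwall_difference[where y' = "\<lambda>t. B (flow u t)" and z' = "\<lambda>t. B (flow v t)"])
       (auto simp: assms flow_in_cube lip intro!: has_vector_derivative_within_subset[OF flow_deriv])
  then show ?thesis using assms by simp
qed

lemma flow_unique:
  assumes u: "u \<in> cube"
    and y: "\<And>t. t \<ge> 0 \<Longrightarrow> (y has_vector_derivative B (y t)) (at t within {0..})"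
    and yc: "\<And>t. t \<ge> 0 \<Longrightarrow> y t \<in> cube" and y0: "y 0 = u" and t: "t \<ge> 0"
  shows "y t = flow u t"
proof -
  have "norm (y t - flow u t) \<le> exp (L * (t - 0)) * norm (y 0 - flow u 0)"
    by (rule gronwall_difference[where y' = "\<lambda>t. B (y t)" and z' = "\<lambda>t. B (flow u t)"])
       (auto simp: u t yc flow_in_cube lip intro!: has_vector_derivative_within_subset[OF flow_deriv]
         has_vector_derivative_within_subset[OF y])
  then show ?thesis using u y0 by simp
qed

lemma flow_add:
  assumes u: "u \<in> cube" and s: "s \<ge> 0" and t: "t \<ge> 0"
  shows "flow u (s + t) = flow (flow u s) t"
proof -
  have "((\<lambda>t. flow u (s + t)) has_vector_derivative B (flow u (s + t))) (at t within {0..})" if "t \<ge> 0" for t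
  proof -
    have "((\<lambda>t. s + t) has_vector_derivative 1) (at t within {0..})"
      unfolding has_real_derivative_iff_has_vector_derivative[symmetric] by (auto intro!: derivative_eq_intros)
    moreover have "(flow u has_vector_derivative B (flow u (s + t))) (at (s + t) within (\<lambda>t. s + t) ` {0..})"
      by (rule has_vector_derivative_within_subset[OF flow_deriv]) (use u s that in auto)
    ultimately show ?thesis using vector_diff_chain_within by (fastforce simp: o_def)
  qed
  then show ?thesis
    by (rule flow_unique[rotated]) (use u s t flow_in_cube in auto)
qed

text \<open>The equilibrium \<open>1\<close> is not reached in finite time, at a rate uniform in the
  starting point. This is the source of the decay in the degree.\<close>

lemma flow_le_1:
  assumes u: "u \<in> cube" and t: "t \<ge> 0"
  shows "exp (- c * t) * (1 - u $ k) \<le> 1 - flow u t $ k"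
  unfolding flow_integral_eq(2)[OF u t]
  by (rule picard_step_bounds) (use continuous_on_flow flow_in_cube u t in auto)

section \<open>The trajectory from the origin\<close>

lemma flow_zero_mono:
  assumes "0 \<le> s" "s \<le> t"
  shows "flow 0 s \<le> flow 0 t"
proof -
  have "flow 0 s \<le> flow (flow 0 (t - s)) s"
    using flow_in_cube[OF zero_in_cube, of "t - s"] assms
    by (intro flow_mono) (auto simp: cube_def less_eq_vec_def)
  also have "\<dots> = flow 0 t" using flow_add[of 0 "t - s" s] assms by simp
  finally show ?thesis .
qed

text \<open>Here \<open>C (flow 0 s)\<close> increases in \<open>s\<close>, so replacing it by its
  value at \<open>t\<close> in the integral equation bounds \<open>c * flow 0 t $ k\<close> by
  \<open>(1 - exp (- c * t)) * C (flow 0 t) $ k\<close>. What is left of \<open>B = C - c x\<close>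
  is at least \<open>exp (- c * t) * C (flow 0 t) $ k\<close>. A positive component at time
  \<open>0\<close> thus stays positive, which later makes that coordinate usable as a
  parameter.\<close>

lemma B_flow_zero_ge:
  assumes t: "t \<ge> 0"
  shows "exp (- c * t) * B 0 $ k \<le> B (flow 0 t) $ k"
proof -
  define G where "G = (\<lambda>s. exp (c * s) *\<^sub>R C (flow 0 s))"
  have int: "G integrable_on {0..t}" unfolding G_def by (rule flow_integral_eq) (use t in auto)
  have intk: "(\<lambda>s. G s $ k) integrable_on {0..t}"
    using integrable_linear[OF int bounded_linear_vec_nth] by (simp add: o_def)
  let ?C = "C (flow 0 t) $ k"
  have I: "((\<lambda>s. exp (c * s) * c * (?C / c)) has_integral ((exp (c * t) - 1) * (?C / c))) {0..t}"
    by (rule has_integral_mult_left[OF integral_exp[OF t]])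
  have "integral {0..t} (\<lambda>s. G s $ k) \<le> integral {0..t} (\<lambda>s. exp (c * s) * c * (?C / c))"
  proof (rule integral_le[OF intk])
    fix s assume s: "s \<in> {0..t}"
    have "C (flow 0 s) $ k \<le> ?C"
      using C_mono[of "flow 0 s" "flow 0 t"] flow_in_cube[of 0] flow_zero_mono[of s t] s
      by (auto simp: less_eq_vec_def)
    then show "G s $ k \<le> exp (c * s) * c * (?C / c)" using c by (simp add: G_def)
  qed (use I in auto)
  then have "integral {0..t} G $ k \<le> (exp (c * t) - 1) * (?C / c)"
    using I int by (simp add: integral_unique)
  then have "exp (- c * t) * integral {0..t} G $ k \<le> exp (- c * t) * ((exp (c * t) - 1) * (?C / c))"
    by (intro mult_left_mono) auto
  moreover have "flow 0 t $ k = exp (- c * t) * integral {0..t} G $ k"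
    using flow_integral_eq(2)[OF zero_in_cube t] by (simp add: G_def)
  ultimately have "c * flow 0 t $ k \<le> ?C - exp (- c * t) * ?C"
    using c by (simp add: exp_minus field_simps)
  then have "exp (- c * t) * ?C \<le> B (flow 0 t) $ k" by (simp add: C_def)
  moreover have "exp (- c * t) * C 0 $ k \<le> exp (- c * t) * ?C"
    using C_mono[of 0 "flow 0 t"] flow_in_cube[of 0 t] t
    by (intro mult_left_mono) (auto simp: less_eq_vec_def cube_def)
  ultimately have "exp (- c * t) * C 0 $ k \<le> B (flow 0 t) $ k" by (rule order_trans[rotated])
  then show ?thesis by (simp add: C_def)
qed

lemma flow_zero_limit:
  obtains q where "q \<in> cube" "(flow 0 \<longlongrightarrow> q) at_top" "B q = 0"
proof -
  define q where "q = (\<chi> k. SUP t\<in>{0..}. flow 0 t $ k)"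
  have bdd: "bdd_above ((\<lambda>t. flow 0 t $ k) ` {0..})" for k
    using cubeD(2)[OF flow_in_cube] by (intro bdd_aboveI[of _ 1]) auto
  have lim: "(flow 0 \<longlongrightarrow> q) at_top"
  proof (rule vec_tendstoI, rule increasing_tendsto)
    fix k
    show "\<forall>\<^sub>F t in at_top. flow 0 t $ k \<le> q $ k"
      using eventually_ge_at_top[of 0]
      by eventually_elim (auto simp: q_def intro: cSUP_upper bdd)
    fix x assume "x < q $ k"
    then obtain s where s: "s \<ge> 0" "x < flow 0 s $ k"
      using bdd[of k] by (auto simp: q_def less_cSUP_iff)
    show "\<forall>\<^sub>F t in at_top. x < flow 0 t $ k"
      using eventually_ge_at_top[of s]
      by eventually_elim (use s flow_zero_mono in \<open>auto simp: less_eq_vec_def intro: less_le_trans\<close>)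
  qed
  have q: "q \<in> cube"
  proof (rule Lim_in_closed_set[OF closed_cube _ _ lim])
    show "\<forall>\<^sub>F t in at_top. flow 0 t \<in> cube"
      using eventually_ge_at_top[of 0] by eventually_elim (simp add: flow_in_cube)
  qed simp
  \<comment> \<open>Both \<open>flow (flow 0 s) t\<close> and \<open>flow 0 (s + t)\<close> converge
    as \<open>s\<close> grows: the former to \<open>flow q t\<close> by Lipschitz dependence on the
    starting point, the latter to \<open>q\<close>.\<close>
  have const: "flow q t = q" if t: "t \<ge> 0" for t
  proof -
    have "((\<lambda>s. flow (flow 0 s) t - flow q t) \<longlongrightarrow> 0) at_top"
    proof (rule Lim_null_comparison)
      show "\<forall>\<^sub>F s in at_top. norm (flow (flow 0 s) t - flow q t) \<le> exp (L * t) * norm (flow 0 s - q)"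
        using eventually_ge_at_top[of 0]
        by eventually_elim (use flow_lipschitz q t flow_in_cube in auto)
      have "((\<lambda>s. exp (L * t) * norm (flow 0 s - q)) \<longlongrightarrow> exp (L * t) * norm (q - q)) at_top"
        by (intro tendsto_intros lim)
      then show "((\<lambda>s. exp (L * t) * norm (flow 0 s - q)) \<longlongrightarrow> 0) at_top" by simp
    qed
    then have "((\<lambda>s. flow (flow 0 s) t) \<longlongrightarrow> flow q t) at_top" by (rule LIM_zero_cancel)
    moreover have "((\<lambda>s. flow 0 (t + s)) \<longlongrightarrow> q) at_top"
      by (rule filterlim_compose[OF lim filterlim_tendsto_add_at_top[OF tendsto_const filterlim_ident]])
    then have "((\<lambda>s. flow (flow 0 s) t) \<longlongrightarrow> q) at_top"
    proof (rule Lim_transform_eventually)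
      show "\<forall>\<^sub>F s in at_top. flow 0 (t + s) = flow (flow 0 s) t"
        using eventually_ge_at_top[of 0] by eventually_elim (use t flow_add in \<open>auto simp: add.commute\<close>)
    qed
    ultimately show ?thesis using tendsto_unique trivial_limit_at_top_linorder by blast
  qed
  \<comment> \<open>A stationary trajectory has derivative \<open>B q\<close> and, being constant,
    derivative \<open>0\<close>.\<close>
  have "((\<lambda>t. q) has_vector_derivative B q) (at 0 within {0..})"
    using flow_deriv[OF q, of 0] const q by (auto intro: has_vector_derivative_transform[rotated 2])
  then have "((\<lambda>t. q) has_vector_derivative B q) (at 0 within {0..1})"
    by (rule has_vector_derivative_within_subset) auto
  moreover have "at (0::real) within {0..1} \<noteq> bot" by (simp add: at_within_Icc_at_right)
  ultimately have "B q = 0"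
    using vector_derivative_unique_within has_vector_derivative_const by blast
  with q lim that show ?thesis by blast
qed

end

section \<open>Perron vectors of irreducible Metzler matrices\<close>

definition metzler :: "real ^ 'n ^ 'n::finite \<Rightarrow> bool" where
  "metzler M \<longleftrightarrow> (\<forall>i j. i \<noteq> j \<longrightarrow> 0 \<le> M $ i $ j)"

text \<open>No proper nonempty set of indices is closed under \<open>i -> l\<close> whenever
  \<open>M $ i $ l\<close> is nonzero. Only off-diagonal zero patterns matter; there the
  first-moment matrix and \<open>G_matrix\<close> agree up to nonzero row factors.\<close>

definition irreducible_matrix :: "real ^ 'n ^ 'n::finite \<Rightarrow> bool" where
  "irreducible_matrix M \<longleftrightarrow> (\<forall>Z. (\<forall>i\<in>Z. \<forall>l. l \<notin> Z \<longrightarrow> M $ i $ l = 0) \<longrightarrow> Z = {} \<or> Z = UNIV)"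

lemma metzler_transpose: "metzler M \<Longrightarrow> metzler (transpose M)"
  by (auto simp: metzler_def transpose_def)

lemma irreducible_transpose:
  assumes "irreducible_matrix M"
  shows "irreducible_matrix (transpose M)"
  unfolding irreducible_matrix_def
proof (intro allI impI)
  fix Z assume "\<forall>i\<in>Z. \<forall>l. l \<notin> Z \<longrightarrow> transpose M $ i $ l = 0"
  then have "\<forall>i\<in>-Z. \<forall>l. l \<notin> -Z \<longrightarrow> M $ i $ l = 0" by (auto simp: transpose_def)
  then have "- Z = {} \<or> - Z = UNIV" using assms unfolding irreducible_matrix_def by blast
  then show "Z = {} \<or> Z = UNIV" by auto
qed

text \<open>In a row where \<open>x\<close> vanishes, the eigenvalue equation is a vanishing sum of
  nonnegative terms. The zero set of \<open>x\<close> is therefore closed, hence empty.\<close>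

lemma irreducible_null_vector_pos:
  fixes M :: "real ^ 'n ^ 'n::finite"
  assumes M: "metzler M" "irreducible_matrix M"
    and x: "\<And>i. 0 \<le> x $ i" "x \<noteq> 0" "M *v x = r *\<^sub>R x"
  shows "0 < x $ i"
proof -
  define Z where "Z = {i. x $ i = 0}"
  have "M $ i $ l = 0" if i: "i \<in> Z" and l: "l \<notin> Z" for i l
  proof -
    have "(\<Sum>l\<in>UNIV. M $ i $ l * x $ l) = 0"
      using x(3) i by (simp add: vec_eq_iff matrix_vector_mult_def Z_def)
    moreover have "0 \<le> M $ i $ l * x $ l" for l
      using M(1) x(1) i by (cases "i = l") (auto simp: metzler_def Z_def)
    ultimately have "M $ i $ l * x $ l = 0"
      by (subst (asm) sum_nonneg_eq_0_iff) auto
    then show ?thesis using l by (auto simp: Z_def)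
  qed
  then have "Z = {} \<or> Z = UNIV" using M(2) unfolding irreducible_matrix_def by blast
  moreover have "Z \<noteq> UNIV" using x(2) by (auto simp: Z_def vec_eq_iff)
  ultimately show ?thesis using x(1)[of i] by (auto simp: Z_def less_le)
qed

text \<open>Brouwer's theorem on the standard simplex yields a nonnegative eigenvector of the
  shifted matrix; irreducibility then makes it strictly positive.\<close>

lemma perron_vector:
  fixes M :: "real ^ 'n ^ 'n::finite"
  assumes M: "metzler M" "irreducible_matrix M"
  obtains r v where "\<And>i. 0 < v $ i" "M *v v = r *\<^sub>R v"
proof -
  \<comment> \<open>The shift makes every diagonal entry at least \<open>1\<close>. Hence
    \<open>K x >= x\<close> on nonnegative vectors, and the normalisation never divides by
    zero.\<close>
  define c where "c = 1 + (\<Sum>i\<in>UNIV. \<bar>M $ i $ i\<bar>)"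
  define K where "K x = M *v x + c *\<^sub>R x" for x
  define \<sigma> where "\<sigma> x = (\<Sum>i\<in>UNIV. x $ i)" for x :: "real ^ 'n"
  define S where "S = cube \<inter> {x :: real ^ 'n. \<sigma> x = 1}"
  have Kge: "x $ i \<le> K x $ i" if x: "\<And>i. 0 \<le> x $ i" for x i
  proof -
    have "M $ i $ i * x $ i \<le> (\<Sum>l\<in>UNIV. M $ i $ l * x $ l)"
      using x M(1) by (subst sum.remove[of _ i]) (auto simp: metzler_def intro!: sum_nonneg mult_nonneg_nonneg)
    moreover have "\<bar>M $ i $ i\<bar> \<le> (\<Sum>i\<in>UNIV. \<bar>M $ i $ i\<bar>)"
      by (rule member_le_sum) auto
    then have "1 * x $ i \<le> (M $ i $ i + c) * x $ i"
      using x by (intro mult_right_mono) (auto simp: c_def)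
    ultimately show ?thesis by (simp add: K_def matrix_vector_mult_def algebra_simps)
  qed
  have \<sigma>K: "1 \<le> \<sigma> (K x)" if "x \<in> S" for x
  proof -
    have "\<sigma> x \<le> \<sigma> (K x)" unfolding \<sigma>_def by (rule sum_mono[OF Kge]) (use that in \<open>auto simp: S_def cube_def\<close>)
    then show ?thesis using that by (simp add: S_def)
  qed
  have cont\<sigma>: "continuous_on A \<sigma>" for A unfolding \<sigma>_def by (intro continuous_intros)
  have "compact S"
    unfolding S_def by (intro compact_Int_closed compact_cube closed_Collect_eq cont\<sigma> continuous_intros)
  moreover have "convex S"
    unfolding S_def
  proof (intro convex_Int convex_cube convexI)
    fix x y :: "real ^ 'n" and u v :: real
    assume "x \<in> {x. \<sigma> x = 1}" "y \<in> {x. \<sigma> x = 1}" "0 \<le> u" "0 \<le> v" "u + v = 1"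
    then show "u *\<^sub>R x + v *\<^sub>R y \<in> {x. \<sigma> x = 1}"
      by (simp add: \<sigma>_def sum.distrib sum_distrib_left[symmetric])
  qed
  moreover have "axis undefined 1 \<in> S"
    by (auto simp: S_def cube_def \<sigma>_def axis_def)
  then have "S \<noteq> {}" by blast
  moreover have "continuous_on S (\<lambda>x. (1 / \<sigma> (K x)) *\<^sub>R K x)"
  proof -
    have cK: "continuous_on S K" unfolding K_def by (intro continuous_intros)
    have "continuous_on S (\<lambda>x. \<sigma> (K x))" by (rule continuous_on_compose2[OF cont\<sigma> cK]) auto
    moreover have "\<forall>x\<in>S. \<sigma> (K x) \<noteq> 0" using \<sigma>K by fastforce
    ultimately show ?thesis by (intro continuous_on_scaleR continuous_on_divide continuous_on_const cK)
  qed
  moreover have "(\<lambda>x. (1 / \<sigma> (K x)) *\<^sub>R K x) \<in> S \<rightarrow> S"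
  proof
    fix x assume x: "x \<in> S"
    have pos: "0 \<le> K x $ i" for i
    proof -
      have x0: "\<And>i. 0 \<le> x $ i" using x by (auto simp: S_def cube_def)
      show ?thesis using Kge[OF x0, of i] x0[of i] by linarith
    qed
    have "K x $ i \<le> \<sigma> (K x)" for i
      unfolding \<sigma>_def by (rule member_le_sum) (use pos in auto)
    moreover have "\<sigma> ((1 / \<sigma> (K x)) *\<^sub>R K x) = 1"
      using \<sigma>K[OF x] by (simp add: \<sigma>_def sum_divide_distrib[symmetric])
    ultimately show "(1 / \<sigma> (K x)) *\<^sub>R K x \<in> S"
      using pos \<sigma>K[OF x] by (auto simp: S_def cube_def)
  qed
  ultimately obtain x where x: "x \<in> S" "(1 / \<sigma> (K x)) *\<^sub>R K x = x" using brouwer by blast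
  have "K x = \<sigma> (K x) *\<^sub>R ((1 / \<sigma> (K x)) *\<^sub>R K x)" using \<sigma>K[OF x(1)] by simp
  then have "K x = \<sigma> (K x) *\<^sub>R x" using x(2) by simp
  then have "M *v x = (\<sigma> (K x) - c) *\<^sub>R x" by (simp add: K_def algebra_simps)
  moreover have "x \<noteq> 0" using x(1) by (auto simp: S_def \<sigma>_def)
  moreover have "0 \<le> x $ i" for i using x(1) by (simp add: S_def cube_def)
  ultimately show ?thesis using that irreducible_null_vector_pos[OF M] by metis
qed

section \<open>The largest real eigenvalue\<close>

lemma eigenvectors_independent:
  fixes M :: "real ^ 'n ^ 'n::finite"
  assumes "finite F" "\<And>x. x \<in> F \<Longrightarrow> y x \<noteq> 0 \<and> M *v y x = x *\<^sub>R y x"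
  shows "inj_on y F \<and> independent (y ` F)"
  using assms
proof (induction F rule: finite_induct)
  case (insert a F)
  then have IH: "inj_on y F" "independent (y ` F)" by auto
  have "y a \<notin> span (y ` F)"
  proof
    assume "y a \<in> span (y ` F)"
    then obtain k where k: "y a = (\<Sum>v\<in>y ` F. k v *\<^sub>R v)"
      using insert.hyps by (auto simp: span_finite)
    then have k': "y a = (\<Sum>x\<in>F. k (y x) *\<^sub>R y x)" using IH(1) by (simp add: sum.reindex)
    have "M *v y a = (\<Sum>x\<in>F. (k (y x) * x) *\<^sub>R y x)"
      unfolding k' using insert.prems
      by (simp add: linear_sum[OF matrix_vector_mul_linear] matrix_vector_mult_scaleR mult.commute)
    moreover have "M *v y a = a *\<^sub>R y a" using insert.prems by auto
    then have "M *v y a = (\<Sum>x\<in>F. (k (y x) * a) *\<^sub>R y x)"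
      by (simp add: k' scaleR_sum_right mult.commute)
    ultimately have "(\<Sum>x\<in>F. (k (y x) * (x - a)) *\<^sub>R y x) = 0"
      by (simp add: right_diff_distrib scaleR_diff_left sum_subtractf)
    \<comment> \<open>The relation is re-indexed by vectors, the form in which independence applies;
      \<open>inv_into F y v\<close> recovers the eigenvalue belonging to \<open>v\<close>.\<close>
    moreover have "(\<Sum>v\<in>y ` F. (k v * (inv_into F y v - a)) *\<^sub>R v) = (\<Sum>x\<in>F. (k (y x) * (x - a)) *\<^sub>R y x)"
      using IH(1) by (simp add: sum.reindex)
    ultimately have "k v * (inv_into F y v - a) = 0" if "v \<in> y ` F" for v
      using independentD[OF IH(2), of "y ` F" "\<lambda>v. k v * (inv_into F y v - a)" v] insert.hyps that by auto
    then have "k (y x) = 0" if "x \<in> F" for x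
      using IH(1) that insert.hyps by (metis eq_iff_diff_eq_0 imageI inv_into_f_f mult_eq_0_iff)
    then have "y a = 0" using k' by simp
    then show False using insert.prems by auto
  qed
  moreover have "y a \<notin> y ` F" using calculation span_base[of "y a" "y ` F"] by blast
  ultimately show ?case using IH insert.hyps by (simp add: independent_insert)
qed (simp add: independent_empty)

text \<open>\<open>maximal_eigenvalue\<close> is a \<open>Max\<close> and says something only about
  a finite nonempty set.\<close>

lemma finite_eigenvalues:
  fixes M :: "real ^ 'n ^ 'n::finite"
  shows "finite {x. \<exists>v. v \<noteq> 0 \<and> M *v v = x *\<^sub>R v}" (is "finite ?E")
proof (rule ccontr)
  assume "infinite ?E"
  then obtain F where F: "F \<subseteq> ?E" "finite F" "card F = CARD('n) + 1"
    using infinite_arbitrarily_large by blast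
  then have "\<forall>x\<in>F. \<exists>v. v \<noteq> 0 \<and> M *v v = x *\<^sub>R v" by auto
  then obtain y where "\<And>x. x \<in> F \<Longrightarrow> y x \<noteq> 0 \<and> M *v y x = x *\<^sub>R y x" by metis
  then have y: "inj_on y F" "independent (y ` F)"
    using eigenvectors_independent[OF F(2)] by auto
  have "card (y ` F) \<le> DIM(real^'n)" using independent_bound[OF y(2)] by simp
  then show False using F(3) card_image[OF y(1)] by simp
qed

text \<open>For an eigenvector \<open>z\<close> with real eigenvalue \<open>x\<close>, the vector of
  absolute values satisfies \<open>x |z| <= M |z|\<close>. Pairing with the positive left
  eigenvector gives \<open>x <= r\<close>.\<close>

lemma perron_left_vector:
  fixes M :: "real ^ 'n ^ 'n::finite"
  assumes M: "metzler M" "irreducible_matrix M"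
  obtains v where "\<And>i. 0 < v $ i" "v v* M = maximal_eigenvalue M *\<^sub>R v"
proof -
  obtain r y where y: "\<And>i. 0 < y $ i" "M *v y = r *\<^sub>R y" using perron_vector[OF M] by blast
  obtain r' v where v: "\<And>i. 0 < v $ i" "transpose M *v v = r' *\<^sub>R v"
    using perron_vector[OF metzler_transpose[OF M(1)] irreducible_transpose[OF M(2)]] by blast
  have vM: "v v* M = r' *\<^sub>R v" using v(2) vector_transpose_matrix[of v "transpose M"] by simp
  \<comment> \<open>Evaluating \<open>v \<bullet> (M *v y)\<close> from either side shows that the
    left and the right Perron vector share their eigenvalue.\<close>
  have "0 < v \<bullet> y" unfolding inner_vec_def using v y by (intro sum_pos) auto
  moreover have "r * (v \<bullet> y) = r' * (v \<bullet> y)"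
    using dot_lmul_matrix[of v M y] by (auto simp: vM y(2))
  ultimately have [simp]: "r' = r" by auto
  let ?E = "{x. \<exists>v. v \<noteq> 0 \<and> M *v v = x *\<^sub>R v}"
  have "y \<noteq> 0" using y(1) by (metis less_irrefl zero_index)
  then have "r \<in> ?E" using y by blast
  moreover have "x \<le> r" if x: "x \<in> ?E" for x
  proof -
    obtain z where z: "z \<noteq> 0" "M *v z = x *\<^sub>R z" using x by blast
    \<comment> \<open>Adding \<open>c\<close> to the diagonal makes all entries nonnegative, so the
      triangle inequality respects them; the shift cancels at the end.\<close>
    define c where "c = (\<Sum>i\<in>UNIV. \<bar>M $ i $ i\<bar>)"
    define w where "w = (\<chi> i. \<bar>z $ i\<bar>)"
    have "(x + c) * w $ i \<le> (M *v w + c *\<^sub>R w) $ i" for i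
    proof -
      have cge: "0 \<le> M $ i $ i + c"
      proof -
        have "\<bar>M $ i $ i\<bar> \<le> c" unfolding c_def by (rule member_le_sum) auto
        then show ?thesis by linarith
      qed
      have "(x + c) * z $ i = (M *v z) $ i + c * z $ i" by (simp add: z(2) algebra_simps)
      also have "\<dots> = (M $ i $ i + c) * z $ i + (\<Sum>l\<in>UNIV-{i}. M $ i $ l * z $ l)"
        by (simp add: matrix_vector_mult_def sum.remove[of UNIV i] algebra_simps)
      finally have "\<bar>x + c\<bar> * w $ i = \<bar>(M $ i $ i + c) * z $ i + (\<Sum>l\<in>UNIV-{i}. M $ i $ l * z $ l)\<bar>"
        by (simp add: w_def abs_mult[symmetric])
      also have "\<dots> \<le> \<bar>(M $ i $ i + c) * z $ i\<bar> + (\<Sum>l\<in>UNIV-{i}. \<bar>M $ i $ l * z $ l\<bar>)"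
        by (intro order_trans[OF abs_triangle_ineq] add_left_mono sum_abs)
      also have "\<dots> = (M $ i $ i + c) * w $ i + (\<Sum>l\<in>UNIV-{i}. M $ i $ l * w $ l)"
        using cge M(1) by (auto simp: abs_mult w_def metzler_def intro!: sum.cong)
      also have "\<dots> = (M *v w + c *\<^sub>R w) $ i"
        by (simp add: matrix_vector_mult_def sum.remove[of UNIV i] algebra_simps)
      finally have "\<bar>x + c\<bar> * w $ i \<le> (M *v w + c *\<^sub>R w) $ i" .
      moreover have "(x + c) * w $ i \<le> \<bar>x + c\<bar> * w $ i"
        by (intro mult_right_mono) (auto simp: w_def)
      ultimately show ?thesis by linarith
    qed
    then have "(\<Sum>i\<in>UNIV. v $ i * ((x + c) * w $ i)) \<le> (\<Sum>i\<in>UNIV. v $ i * (M *v w + c *\<^sub>R w) $ i)"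
      using v(1) by (intro sum_mono mult_left_mono) (auto intro: less_imp_le)
    then have "(x + c) * (v \<bullet> w) \<le> v \<bullet> (M *v w) + c * (v \<bullet> w)"
      by (simp add: inner_vec_def sum_distrib_left sum.distrib algebra_simps)
    also have "v \<bullet> (M *v w) = r * (v \<bullet> w)"
      using dot_lmul_matrix[of v M w] by (simp add: vM)
    finally have "x * (v \<bullet> w) \<le> r * (v \<bullet> w)" by (simp add: algebra_simps)
    moreover have "0 < v \<bullet> w"
    proof -
      obtain i where "z $ i \<noteq> 0" using z(1) by (auto simp: vec_eq_iff)
      moreover have "0 \<le> v $ i" for i using v(1)[of i] by simp
      ultimately show ?thesis unfolding inner_vec_def using v(1)
        by (intro sum_pos2[of _ i]) (auto simp: w_def)
    qed
    ultimately show ?thesis by simp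
  qed
  ultimately have "maximal_eigenvalue M = r"
    unfolding maximal_eigenvalue_def by (intro Max_eqI finite_eigenvalues) auto
  then show ?thesis using that[OF v(1)] vM by simp
qed

text \<open>A block of zeros that leaves a closed index set invariant survives in every power of the
  matrix.\<close>

lemma positively_regular_irreducible:
  assumes "positively_regular G"
  shows "irreducible_matrix G"
  unfolding irreducible_matrix_def
proof (intro allI impI)
  fix Z assume Z: "\<forall>i\<in>Z. \<forall>l. l \<notin> Z \<longrightarrow> G $ i $ l = 0"
  obtain m where m: "m \<ge> 1" "\<And>i j. 0 < (((**) G) ^^ m) (mat 1) $ i $ j"
    using assms by (auto simp: positively_regular_def)
  have "(((**) G) ^^ m) (mat 1) $ i $ l = 0" if "i \<in> Z" "l \<notin> Z" for i l m
    using that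
  proof (induction m arbitrary: i)
    case (Suc m)
    define X where "X = (((**) G) ^^ m) (mat 1)"
    have "G $ i $ k * X $ k $ l = 0" for k
      using Z Suc unfolding X_def by (cases "k \<in> Z") auto
    then have "(\<Sum>k\<in>UNIV. G $ i $ k * X $ k $ l) = 0" by (intro sum.neutral ballI)
    then have "(G ** X) $ i $ l = 0" by (simp add: matrix_matrix_mult_def)
    then show ?case by (simp add: X_def)
  qed (auto simp: mat_def)
  then show "Z = {} \<or> Z = UNIV" using m(2) by (metis UNIV_eq_I all_not_in_conv less_irrefl)
qed

section \<open>The generator\<close>

locale immigration_branching =
  fixes a :: "nat ^ 'n::finite \<Rightarrow> real" and b :: "'n \<Rightarrow> nat ^ 'n \<Rightarrow> real"
  assumes a_nonneg: "j \<noteq> 0 \<Longrightarrow> 0 \<le> a j"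
    and a_sum: "(a has_sum (- a 0)) (- {0})" and a_pos: "0 < - a 0"
    and b_nonneg: "j \<noteq> axis k 1 \<Longrightarrow> 0 \<le> b k j"
    and b_sum: "(b k has_sum (- b k (axis k 1))) (- {axis k 1})"
    and b_pos: "0 < - b k (axis k 1)"
    and finite_deriv: "partially_differentiable (gen_fun (b i)) l (vec 1)"
begin

abbreviation A :: "real ^ 'n \<Rightarrow> real" where "A \<equiv> gen_fun a"

definition B :: "real ^ 'n \<Rightarrow> real ^ 'n" where "B u = (\<chi> k. gen_fun (b k) u)"

lemma B_nth [simp]: "B u $ k = gen_fun (b k) u"
  by (simp add: B_def)

lemma a_has_sum: "(a has_sum 0) UNIV"
proof -
  have "(a has_sum (a 0 + - a 0)) ({0} \<union> - {0})"
    by (intro has_sum_Un_disjoint a_sum) (auto simp: has_sum_finite_iff)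
  then show ?thesis by simp
qed

lemma b_has_sum: "(b k has_sum 0) UNIV"
proof -
  have "(b k has_sum (b k (axis k 1) + - b k (axis k 1))) ({axis k 1} \<union> - {axis k 1})"
    by (intro has_sum_Un_disjoint b_sum) (auto simp: has_sum_finite_iff)
  then show ?thesis by simp
qed

lemma a_summable: "a summable_on UNIV" and b_summable: "b k summable_on UNIV"
  using a_has_sum b_has_sum by (auto intro: has_sum_imp_summable)

lemma A_one: "A 1 = 0"
  using has_sum_unique[OF _ a_has_sum] gen_fun_has_sum[OF a_summable one_in_cube] by simp

lemma gen_fun_b_one: "gen_fun (b k) 1 = 0"
  using has_sum_unique[OF _ b_has_sum[of k]] gen_fun_has_sum[OF b_summable[of k] one_in_cube] by simp

lemma B_one: "B 1 = 0"
  by (simp add: vec_eq_iff gen_fun_b_one)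

text \<open>Converse of termwise differentiation. After the terms in \<open>S\<close> are removed,
  the rest of the series is largest at \<open>1\<close>, so its left derivative there is
  nonnegative; finite sums of first moments are thus bounded by the derivative \<open>D\<close> of
  the whole series.\<close>

lemma b_first_moment: "(\<lambda>j. b i j * real (j $ k)) summable_on UNIV"
proof -
  define f where "f = along (gen_fun (b i)) k 1"
  obtain D where D: "(f has_real_derivative D) (at 1 within {0..1})"
    using finite_deriv[of i k] unfolding partially_differentiable_def f_def
    by (auto simp: real_differentiable_def)
  define pt :: "real \<Rightarrow> real ^ 'n" where "pt x = (\<chi> l. if l = k then x else 1)" for x
  have pt: "pt x \<in> cube" if "x \<in> {0..1}" for x using that by (auto simp: pt_def cube_def)
  have f_eq: "f x = gen_fun (b i) (pt x)" for x
    unfolding f_def along_def pt_def by (rule arg_cong[of _ _ "gen_fun (b i)"]) (auto simp: vec_eq_iff)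
  have mon: "monomial j (pt x) = x ^ (j $ k)" for j x
  proof -
    have "monomial j (pt x) = (\<Prod>l\<in>UNIV. if l = k then x ^ (j $ k) else 1)"
      unfolding monomial_def pt_def by (rule prod.cong) auto
    then show ?thesis by simp
  qed
  have hs: "((\<lambda>j. b i j * x ^ (j $ k)) has_sum f x) UNIV" if "x \<in> {0..1}" for x
    using gen_fun_has_sum[OF b_summable pt[OF that]] by (simp add: mon f_eq)
  \<comment> \<open>\<open>S\<close> must contain \<open>axis i 1\<close>, so that only nonnegative
    coefficients remain outside.\<close>
  have bound: "(\<Sum>j\<in>S. b i j * real (j $ k)) \<le> D" if S: "finite S" "axis i 1 \<in> S" for S
  proof -
    define h where "h x = f x - (\<Sum>j\<in>S. b i j * x ^ (j $ k))" for x
    have h_mono: "h x \<le> h 1" if "x \<in> {0..1}" for x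
    proof -
      have "((\<lambda>j. b i j * 1 ^ (j $ k) - b i j * x ^ (j $ k)) has_sum (f 1 - f x)) UNIV"
        using hs[of 1] hs[OF that] by (intro has_sum_diff_real) auto
      then have "(\<Sum>j\<in>S. b i j * 1 ^ (j $ k) - b i j * x ^ (j $ k)) \<le> f 1 - f x"
      proof (rule has_sum_nonneg_le[OF _ S(1)])
        fix j assume "j \<notin> S"
        then have "0 \<le> b i j" using S(2) by (intro b_nonneg) auto
        moreover have "x ^ (j $ k) \<le> 1" using that by (intro power_le_one) auto
        ultimately show "0 \<le> b i j * 1 ^ (j $ k) - b i j * x ^ (j $ k)"
          by (simp add: mult_left_le)
      qed
      then show ?thesis by (simp add: h_def sum_subtractf)
    qed
    have "(h has_real_derivative (D - (\<Sum>j\<in>S. b i j * (real (j $ k) * 1 ^ (j $ k - Suc 0))))) (at 1 within {0..1})"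
      unfolding h_def
      by (intro DERIV_diff D DERIV_sum DERIV_cmult) (auto intro!: derivative_eq_intros)
    then have lim: "((\<lambda>x. (h x - h 1) / (x - 1)) \<longlongrightarrow> D - (\<Sum>j\<in>S. b i j * real (j $ k))) (at 1 within {0..1})"
      by (simp add: has_field_derivative_iff)
    have "0 \<le> D - (\<Sum>j\<in>S. b i j * real (j $ k))"
    proof (rule tendsto_lowerbound[OF lim])
      show "\<forall>\<^sub>F x in at 1 within {0..1}. 0 \<le> (h x - h 1) / (x - 1)"
        unfolding eventually_at_filter using h_mono
        by (intro always_eventually) (auto intro!: divide_nonpos_nonpos)
      show "at (1::real) within {0..1} \<noteq> bot" by (simp add: at_within_Icc_at_left)
    qed
    then show ?thesis by simp
  qed
  have "(\<lambda>j. b i j * real (j $ k)) summable_on - {axis i 1}"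
  proof (rule nonneg_bdd_above_summable_on)
    show "bdd_above (sum (\<lambda>j. b i j * real (j $ k)) ` {F. F \<subseteq> - {axis i 1} \<and> finite F})"
    proof (intro bdd_aboveI2)
      fix F :: "(nat ^ 'n) set" assume "F \<in> {F. F \<subseteq> - {axis i 1} \<and> finite F}"
      then show "(\<Sum>j\<in>F. b i j * real (j $ k)) \<le> D - b i (axis i 1) * real (axis i 1 $ k)"
        using bound[of "insert (axis i 1) F"] by (auto simp: subset_eq sum.insert_if)
    qed
  qed (use b_nonneg in auto)
  then have "(\<lambda>j. b i j * real (j $ k)) summable_on ({axis i 1} \<union> - {axis i 1})"
    by (intro summable_on_Un_disjoint) auto
  then show ?thesis by simp
qed

text \<open>The shift constant of the flow: it dominates every \<open>- b k (axis k 1)\<close>, so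
  \<open>B u + rate *\<^sub>R u\<close> is monotone.\<close>

definition rate :: real where "rate = 1 + (\<Sum>k\<in>UNIV. - b k (axis k 1))"

lemma rate_ge: "- b k (axis k 1) \<le> rate" and rate_pos: "0 < rate"
proof -
  have "- b k (axis k 1) \<le> (\<Sum>k\<in>UNIV. - b k (axis k 1))"
    by (rule member_le_sum[OF UNIV_I less_imp_le[OF b_pos] finite])
  moreover have "0 < - b k (axis k 1)" by (rule b_pos)
  ultimately show "- b k (axis k 1) \<le> rate" "0 < rate"
    unfolding rate_def by linarith+
qed

lemma B_lipschitz: "\<exists>L\<ge>0. \<forall>u\<in>cube. \<forall>v\<in>cube. norm (B u - B v) \<le> L * norm (u - v)"
proof -
  have "\<exists>L\<ge>0. \<forall>u\<in>cube. \<forall>v\<in>cube. \<bar>gen_fun (b k) u - gen_fun (b k) v\<bar> \<le> L * norm (u - v)" for k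
    using gen_fun_lipschitz[OF b_summable[of k] b_first_moment[of k]] by metis
  then obtain L where L: "\<And>k. L k \<ge> 0"
    "\<And>k u v. u \<in> cube \<Longrightarrow> v \<in> cube \<Longrightarrow> \<bar>gen_fun (b k) u - gen_fun (b k) v\<bar> \<le> L k * norm (u - v)"
    by metis
  show ?thesis
  proof (intro exI conjI ballI)
    show "0 \<le> (\<Sum>k\<in>UNIV. L k)" using L by (simp add: sum_nonneg)
    fix u v :: "real^'n" assume uv: "u \<in> cube" "v \<in> cube"
    have "norm (B u - B v) \<le> (\<Sum>k\<in>UNIV. \<bar>(B u - B v) $ k\<bar>)" by (rule norm_le_l1_cart)
    also have "\<dots> \<le> (\<Sum>k\<in>UNIV. L k * norm (u - v))"
      using L(2)[OF uv] by (intro sum_mono) auto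
    finally show "norm (B u - B v) \<le> (\<Sum>k\<in>UNIV. L k) * norm (u - v)" by (simp add: sum_distrib_right)
  qed
qed

definition "Lip = (SOME L. L \<ge> 0 \<and> (\<forall>u\<in>cube. \<forall>v\<in>cube. norm (B u - B v) \<le> L * norm (u - v)))"

lemma Lip: "Lip \<ge> 0" "u \<in> cube \<Longrightarrow> v \<in> cube \<Longrightarrow> norm (B u - B v) \<le> Lip * norm (u - v)"
  using someI_ex[OF B_lipschitz] unfolding Lip_def by blast+

text \<open>Every term of the difference is nonnegative except the one of the linear monomial
  \<open>u $ k\<close>, which is kept explicitly.\<close>

lemma B_diff_ge:
  assumes uv: "u \<in> cube" "v \<in> cube" "u \<le> v"
  shows "b k (axis k 1) * (v $ k - u $ k) \<le> gen_fun (b k) v - gen_fun (b k) u"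
proof -
  have "((\<lambda>j. b k j * monomial j v - b k j * monomial j u) has_sum (gen_fun (b k) v - gen_fun (b k) u)) UNIV"
    by (intro has_sum_diff_real gen_fun_has_sum b_summable uv)
  then have "(\<Sum>j\<in>{axis k 1}. b k j * monomial j v - b k j * monomial j u) \<le> gen_fun (b k) v - gen_fun (b k) u"
  proof (rule has_sum_nonneg_le)
    fix j :: "nat ^ 'n" assume "j \<notin> {axis k 1}"
    then have "0 \<le> b k j" by (intro b_nonneg) auto
    moreover have "monomial j u \<le> monomial j v"
      using uv by (intro monomial_mono) (auto simp: less_eq_vec_def cube_def)
    ultimately show "0 \<le> b k j * monomial j v - b k j * monomial j u" by (simp add: mult_left_mono)
  qed simp
  then show ?thesis by (simp add: algebra_simps)
qed

lemma A_mono: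
  assumes uv: "u \<in> cube" "v \<in> cube" "u \<le> v"
  shows "A u \<le> A v"
proof -
  have "((\<lambda>j. a j * monomial j v - a j * monomial j u) has_sum (A v - A u)) UNIV"
    by (intro has_sum_diff_real gen_fun_has_sum a_summable uv)
  then have "(\<Sum>j\<in>{0}. a j * monomial j v - a j * monomial j u) \<le> A v - A u"
  proof (rule has_sum_nonneg_le)
    fix j :: "nat ^ 'n" assume "j \<notin> {0}"
    then have "0 \<le> a j" by (intro a_nonneg) auto
    moreover have "monomial j u \<le> monomial j v"
      using uv by (intro monomial_mono) (auto simp: less_eq_vec_def cube_def)
    ultimately show "0 \<le> a j * monomial j v - a j * monomial j u" by (simp add: mult_left_mono)
  qed simp
  then show ?thesis by simp
qed

lemma A_nonpos: "u \<in> cube \<Longrightarrow> A u \<le> 0"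
  using A_mono[OF _ one_in_cube] A_one by (auto simp: cube_def less_eq_vec_def)

lemma B_zero_nonneg: "0 \<le> gen_fun (b k) 0"
proof -
  have "((\<lambda>j. b k j * monomial j 0) has_sum gen_fun (b k) 0) UNIV"
    by (intro gen_fun_has_sum b_summable) simp
  moreover have "0 \<le> b k j * monomial j 0" for j
  proof (cases "j = 0")
    case True
    have "(0 :: nat ^ 'n) \<noteq> axis k 1" by (metis axis_nth one_neq_zero zero_index)
    then show ?thesis using b_nonneg[of 0 k] True by simp
  qed (simp add: monomial_zero)
  ultimately show ?thesis by (rule has_sum_nonneg)
qed

lemma cube_flow_B: "cube_flow B Lip rate"
proof
  fix u v :: "real ^ 'n" assume uv: "u \<in> cube" "v \<in> cube"
  show "norm (B u - B v) \<le> Lip * norm (u - v)" by (rule Lip(2)[OF uv])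
  assume le: "u \<le> v"
  have "gen_fun (b k) u + rate * u $ k \<le> gen_fun (b k) v + rate * v $ k" for k
  proof -
    have "- rate * (v $ k - u $ k) \<le> b k (axis k 1) * (v $ k - u $ k)"
      using le rate_ge[of k] by (intro mult_right_mono) (auto simp: less_eq_vec_def)
    then show ?thesis using B_diff_ge[OF uv le, of k] by (simp add: algebra_simps)
  qed
  then show "B u + rate *\<^sub>R u \<le> B v + rate *\<^sub>R v" by (simp add: less_eq_vec_def)
qed (auto simp: B_zero_nonneg less_eq_vec_def B_one rate_pos)

sublocale cube_flow B Lip rate by (rule cube_flow_B)

section \<open>The rates acting on monomials\<close>

abbreviation "q \<equiv> q_matrix a b"

lemma q_nonneg:
  assumes "i \<noteq> j"
  shows "0 \<le> q i j"
  unfolding q_matrix_def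
proof (intro add_nonneg_nonneg sum_nonneg mult_nonneg_nonneg)
  have ne: "j - i \<noteq> 0" if "i \<le> j"
  proof
    assume "j - i = 0"
    then have "j $ k = i $ k" for k using that
      by (auto simp: vec_eq_iff less_eq_vec_def) (metis le_antisym)
    then show False using assms by (simp add: vec_eq_iff)
  qed
  then show "0 \<le> (if i \<le> j then a (j - i) else 0)" using a_nonneg by auto
  fix k
  have "j + axis k 1 - i \<noteq> axis k 1" if "i \<le> j + axis k 1"
  proof
    assume e: "j + axis k 1 - i = axis k 1"
    have "j $ l = i $ l" for l
      using that e unfolding vec_eq_iff less_eq_vec_def
      by (metis (no_types, opaque_lifting) add_diff_cancel_right' le_add_diff_inverse vector_add_component vector_minus_component add.commute)
    then show False using assms by (simp add: vec_eq_iff)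
  qed
  then show "0 \<le> (if i \<le> j + axis k 1 then b k (j + axis k 1 - i) else 0)" using b_nonneg by auto
qed auto

text \<open>On monomials the rates act as the first-order operator
  \<open>\<Sum>k. B_k \<partial>_k + A\<close>. This is why its characteristics
  \<open>x' = B x\<close> describe the transition probabilities.\<close>

lemma q_gen_fun:
  assumes u: "u \<in> cube"
  shows "((\<lambda>j. q i j * monomial j u) has_sum
    ((\<Sum>k\<in>UNIV. real (i $ k) * (monomial (i - axis k 1) u * gen_fun (b k) u)) + monomial i u * A u)) UNIV"
proof -
  have branch: "((\<lambda>j. real (i $ k) * ((if i \<le> j + axis k 1 then b k (j + axis k 1 - i) else 0) * monomial j u))
      has_sum (real (i $ k) * (monomial (i - axis k 1) u * gen_fun (b k) u))) UNIV" for k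
  proof (cases "i $ k = 0")
    case False
    then have k: "axis k 1 $ l \<le> i $ l" for l by (auto simp: axis_def)
    \<comment> \<open>The shift \<open>h\<close> maps the offspring vector \<open>l\<close> to the
      target state; its range is exactly the set where the guard in \<open>q_matrix\<close> holds.
      The case \<open>i $ k = 0\<close>, where \<open>i - axis k 1\<close> truncates, carries weight
      zero.\<close>
    define h where "h l = l + (i - axis k 1)" for l
    have inj: "inj h" by (auto simp: h_def inj_def)
    have hk: "h l + axis k 1 - i = l" for l
    proof -
      have "(h l + axis k 1 - i) $ m = l $ m" for m
        using k[of m] unfolding h_def by (simp del: One_nat_def)
      then show ?thesis by (simp add: vec_eq_iff)
    qed
    have hle: "i \<le> h l + axis k 1" for l
      unfolding h_def less_eq_vec_def using k by (auto simp: add.assoc)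
    have im: "j \<in> range h" if "i \<le> j + axis k 1" for j
    proof -
      have "j $ l = (j $ l + axis k 1 $ l - i $ l) + (i $ l - axis k 1 $ l)" for l
        using that k[of l] by (auto simp: less_eq_vec_def dest: spec[of _ l])
      then have "j = h (j + axis k 1 - i)" by (simp add: h_def vec_eq_iff)
      then show ?thesis by blast
    qed
    have "((\<lambda>l. monomial (i - axis k 1) u * (b k l * monomial l u)) has_sum
        (monomial (i - axis k 1) u * gen_fun (b k) u)) UNIV"
      by (intro has_sum_cmult_right gen_fun_has_sum b_summable u)
    also have "(\<lambda>l. monomial (i - axis k 1) u * (b k l * monomial l u))
       = (\<lambda>j. b k (j + axis k 1 - i) * monomial j u) \<circ> h"
      unfolding comp_def hk by (simp add: h_def monomial_add mult_ac)
    finally have "((\<lambda>j. b k (j + axis k 1 - i) * monomial j u) has_sum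
        (monomial (i - axis k 1) u * gen_fun (b k) u)) (range h)"
      using has_sum_reindex[OF inj] by blast
    also have "?this \<longleftrightarrow> ((\<lambda>j. (if i \<le> j + axis k 1 then b k (j + axis k 1 - i) else 0) * monomial j u) has_sum
        (monomial (i - axis k 1) u * gen_fun (b k) u)) UNIV"
      by (rule has_sum_cong_neutral) (use im hle in auto)
    finally show ?thesis by (rule has_sum_cmult_right)
  qed simp
  have immigr: "((\<lambda>j. (if i \<le> j then a (j - i) else 0) * monomial j u) has_sum (monomial i u * A u)) UNIV"
  proof -
    have inj: "inj (\<lambda>l. l + i)" by (auto simp: inj_def)
    have im: "j \<in> range (\<lambda>l. l + i)" if "i \<le> j" for j
    proof -
      have "j = (j - i) + i" using that by (auto simp: vec_eq_iff less_eq_vec_def)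
      then show ?thesis by blast
    qed
    have "((\<lambda>l. monomial i u * (a l * monomial l u)) has_sum (monomial i u * A u)) UNIV"
      by (intro has_sum_cmult_right gen_fun_has_sum a_summable u)
    also have "(\<lambda>l. monomial i u * (a l * monomial l u)) = (\<lambda>j. a (j - i) * monomial j u) \<circ> (\<lambda>l. l + i)"
      by (auto simp: fun_eq_iff monomial_add)
    finally have "((\<lambda>j. a (j - i) * monomial j u) has_sum (monomial i u * A u)) (range (\<lambda>l. l + i))"
      using has_sum_reindex[OF inj] by blast
    also have "?this \<longleftrightarrow> ((\<lambda>j. (if i \<le> j then a (j - i) else 0) * monomial j u) has_sum (monomial i u * A u)) UNIV"
      by (rule has_sum_cong_neutral) (use im in \<open>auto simp: less_eq_vec_def\<close>)
    finally show ?thesis .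
  qed
  have "((\<lambda>j. (\<Sum>k\<in>UNIV. real (i $ k) * ((if i \<le> j + axis k 1 then b k (j + axis k 1 - i) else 0) * monomial j u))
     + (if i \<le> j then a (j - i) else 0) * monomial j u) has_sum
     ((\<Sum>k\<in>UNIV. real (i $ k) * (monomial (i - axis k 1) u * gen_fun (b k) u)) + monomial i u * A u)) UNIV"
    by (intro has_sum_add has_sum_sum branch immigr) simp
  then show ?thesis by (simp add: q_matrix_def distrib_right sum_distrib_right mult.assoc)
qed

lemma q_has_sum: "(q i has_sum 0) UNIV"
  using q_gen_fun[OF one_in_cube, of i] A_one B_one by (simp add: gen_fun_b_one)

end

section \<open>Minimal transition functions of conservative rates\<close>

lemma borel_measurable_nn_integral_count:
  fixes f :: "'j::countable \<Rightarrow> 'a \<Rightarrow> ennreal"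
  assumes "\<And>j. f j \<in> borel_measurable M"
  shows "(\<lambda>x. \<integral>\<^sup>+ j. f j x \<partial>count_space UNIV) \<in> borel_measurable M"
proof (rule sigma_finite_measure.borel_measurable_nn_integral)
  show "sigma_finite_measure (count_space (UNIV :: 'j set))"
    by (rule sigma_finite_measure_count_space_countable) simp
  have "(\<lambda>z. f (fst z) (snd z)) \<in> borel_measurable (count_space UNIV \<Otimes>\<^sub>M M)"
    by (rule measurable_pair_measure_countable1) (use assms in auto)
  from measurable_compose[OF measurable_pair_swap' this]
  show "(\<lambda>(x, j). f j x) \<in> borel_measurable (M \<Otimes>\<^sub>M count_space UNIV)"
    by (simp add: case_prod_beta')
qed

lemma nn_integral_count_swap:
  fixes f :: "'j::countable \<Rightarrow> 'a \<Rightarrow> ennreal"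
  assumes "sigma_finite_measure M" "\<And>j. f j \<in> borel_measurable M"
  shows "(\<integral>\<^sup>+ j. (\<integral>\<^sup>+ x. f j x \<partial>M) \<partial>count_space UNIV) = (\<integral>\<^sup>+ x. (\<integral>\<^sup>+ j. f j x \<partial>count_space UNIV) \<partial>M)"
proof -
  interpret pair_sigma_finite "count_space (UNIV :: 'j set)" M
    using assms(1) sigma_finite_measure_count_space_countable[of "UNIV :: 'j set"]
    by (simp add: pair_sigma_finite_def)
  show ?thesis
  proof (rule Fubini'[symmetric])
    have "(\<lambda>z. f (fst z) (snd z)) \<in> borel_measurable (count_space UNIV \<Otimes>\<^sub>M M)"
      by (rule measurable_pair_measure_countable1) (use assms in auto)
    then show "(\<lambda>(x, y). f x y) \<in> borel_measurable (count_space UNIV \<Otimes>\<^sub>M M)"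
      by (simp add: case_prod_beta')
  qed
qed

lemma nn_integral_count_has_sum:
  fixes f :: "'a \<Rightarrow> real"
  assumes "(f has_sum s) A" "\<And>x. x \<in> A \<Longrightarrow> 0 \<le> f x"
  shows "(\<integral>\<^sup>+ x\<in>A. ennreal (f x) \<partial>count_space UNIV) = ennreal s"
proof -
  have "Infinite_Set_Sum.abs_summable_on f A"
    using abs_summable_real[OF has_sum_imp_summable[OF assms(1)]]
    by (simp add: abs_summable_equivalent[symmetric])
  then have "(\<integral>\<^sup>+ x. ennreal (f x) \<partial>count_space A) = ennreal s"
    using assms by (simp add: nn_integral_conv_infsetsum infsetsum_infsum infsumI)
  then show ?thesis by (simp add: nn_integral_count_space_indicator)
qed

text \<open>The way back from extended nonnegative sums: nonnegative terms with a finite integral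
  are summable to the expected real value.\<close>

lemma has_sum_nn_integral_count:
  fixes f :: "'a \<Rightarrow> real"
  assumes "(\<integral>\<^sup>+ x. ennreal (f x) \<partial>count_space UNIV) = ennreal s" "0 \<le> s" "\<And>x. 0 \<le> f x"
  shows "(f has_sum s) UNIV"
proof -
  have "integrable (count_space UNIV) f"
    using assms by (intro integrableI_nonneg) auto
  then have "Infinite_Set_Sum.abs_summable_on f UNIV" by (simp add: abs_summable_on_def)
  then have "f summable_on UNIV"
    unfolding abs_summable_equivalent[symmetric] by (rule iffD2[OF summable_on_iff_abs_summable_on_real])
  then obtain s' where s': "(f has_sum s') UNIV" by (auto simp: summable_on_def)
  then have "ennreal s' = ennreal s" using nn_integral_count_has_sum[OF s'] assms by simp
  moreover have "0 \<le> s'" by (rule has_sum_nonneg[OF s']) (use assms in auto)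
  ultimately show ?thesis using s' assms(2) by simp
qed

locale conservative_rates =
  fixes Q :: "'s::countable \<Rightarrow> 's \<Rightarrow> real"
  assumes Q_nonneg: "i \<noteq> j \<Longrightarrow> 0 \<le> Q i j"
    and Q_sum: "(Q i has_sum 0) UNIV"
begin

lemma Q_off_diagonal: "(Q i has_sum (- Q i i)) (- {i})"
proof -
  have "(Q i has_sum (0 - Q i i)) (UNIV - {i})"
    by (rule has_sum_Diff[OF Q_sum]) (auto simp: has_sum_finite_iff)
  then show ?thesis by (simp add: Compl_eq_Diff_UNIV)
qed

lemma Q_diag: "Q i i \<le> 0"
proof -
  have "0 \<le> - Q i i" by (rule has_sum_nonneg[OF Q_off_diagonal]) (use Q_nonneg in auto)
  then show ?thesis by simp
qed

text \<open>The contribution of paths that jump at least once: \<open>s\<close> is the holding time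
  in \<open>i\<close>, \<open>k\<close> the state entered, and \<open>f\<close> is run for the
  remaining time.\<close>

definition jump :: "(real \<Rightarrow> 's \<Rightarrow> ennreal) \<Rightarrow> real \<Rightarrow> 's \<Rightarrow> ennreal" where
  "jump f t i = (\<integral>\<^sup>+ s\<in>{0..t}. ennreal (exp (Q i i * s)) *
     (\<integral>\<^sup>+ k\<in>- {i}. ennreal (Q i k) * f (t - s) k \<partial>count_space UNIV) \<partial>lborel)"

lemma feller_iter_Suc:
  "feller_iter Q (Suc m) t i j = (if i = j then ennreal (exp (Q i i * t)) else 0)
     + jump (\<lambda>t k. feller_iter Q m t k j) t i"
  by (simp add: jump_def)

lemma jump_mono:
  assumes "\<And>s k. 0 \<le> s \<Longrightarrow> s \<le> t \<Longrightarrow> f s k \<le> g s k"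
  shows "jump f t i \<le> jump g t i"
  unfolding jump_def
proof (rule nn_integral_mono)
  fix s
  show "ennreal (exp (Q i i * s)) * (\<integral>\<^sup>+ k\<in>- {i}. ennreal (Q i k) * f (t - s) k \<partial>count_space UNIV) * indicator {0..t} s
    \<le> ennreal (exp (Q i i * s)) * (\<integral>\<^sup>+ k\<in>- {i}. ennreal (Q i k) * g (t - s) k \<partial>count_space UNIV) * indicator {0..t} s"
  proof (cases "s \<in> {0..t}")
    case True
    then have "f (t - s) k \<le> g (t - s) k" for k by (intro assms) auto
    then show ?thesis by (intro mult_right_mono mult_left_mono nn_integral_mono) auto
  qed simp
qed

lemma borel_measurable_jump_inner [measurable]:
  assumes "\<And>k. (\<lambda>t. f t k) \<in> borel_measurable borel"
  shows "(\<lambda>t. \<integral>\<^sup>+ k\<in>- {i}. ennreal (Q i k) * f t k \<partial>count_space UNIV) \<in> borel_measurable borel"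
proof -
  note [measurable] = assms
  show ?thesis by (rule borel_measurable_nn_integral_count) measurable
qed

lemma borel_measurable_jump:
  assumes "\<And>k. (\<lambda>t. f t k) \<in> borel_measurable borel"
  shows "(\<lambda>t. jump f t i) \<in> borel_measurable borel"
proof -
  define R where "R t = (\<integral>\<^sup>+ k\<in>- {i}. ennreal (Q i k) * f t k \<partial>count_space UNIV)" for t
  have [measurable]: "R \<in> borel_measurable borel"
    unfolding R_def by (rule borel_measurable_jump_inner[OF assms])
  have "(\<lambda>(t, s). ennreal (exp (Q i i * s)) * R (t - s) * (if 0 \<le> s \<and> s \<le> t then 1 else 0))
    \<in> borel_measurable (borel \<Otimes>\<^sub>M lborel)" by measurable
  then have "(\<lambda>t. \<integral>\<^sup>+ s. ennreal (exp (Q i i * s)) * R (t - s) * (if 0 \<le> s \<and> s \<le> t then 1 else 0) \<partial>lborel)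
    \<in> borel_measurable borel"
    using lborel.borel_measurable_nn_integral by (simp add: case_prod_beta')
  also have "(\<lambda>t. \<integral>\<^sup>+ s. ennreal (exp (Q i i * s)) * R (t - s) * (if 0 \<le> s \<and> s \<le> t then 1 else 0) \<partial>lborel)
    = (\<lambda>t. jump f t i)"
    unfolding jump_def R_def by (intro ext nn_integral_cong) (auto simp: indicator_def)
  finally show ?thesis .
qed

lemma borel_measurable_feller_iter [measurable]:
  "(\<lambda>t. feller_iter Q m t i j) \<in> borel_measurable borel"
proof (induction m arbitrary: i)
  case (Suc m)
  note [measurable] = borel_measurable_jump[OF Suc]
  show ?case unfolding feller_iter_Suc by measurable
qed simp

lemma feller_iter_mono: "feller_iter Q m t i j \<le> feller_iter Q (Suc m) t i j"
proof (induction m arbitrary: t i)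
  case (Suc m)
  have "jump (\<lambda>t k. feller_iter Q m t k j) t i \<le> jump (\<lambda>t k. feller_iter Q (Suc m) t k j) t i"
    by (rule jump_mono) (rule Suc)
  then show ?case
    unfolding feller_iter_Suc[of "Suc m" t i j] feller_iter_Suc[of m t i j] by (rule add_left_mono)
qed simp

section \<open>Feller's iterates summed against a weight\<close>

definition weighted_iter :: "('s \<Rightarrow> ennreal) \<Rightarrow> nat \<Rightarrow> real \<Rightarrow> 's \<Rightarrow> ennreal" where
  "weighted_iter h m t i = (\<integral>\<^sup>+ j. feller_iter Q m t i j * h j \<partial>count_space UNIV)"

text \<open>The expectation of \<open>h\<close> at time \<open>t\<close> from state
  \<open>i\<close>, taken in \<open>ennreal\<close> so that it exists before the probabilities are
  known to be finite. \<open>h = 1\<close> gives the total mass, a monomial the generating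
  function.\<close>

definition weighted_minimal :: "('s \<Rightarrow> ennreal) \<Rightarrow> real \<Rightarrow> 's \<Rightarrow> ennreal" where
  "weighted_minimal h t i = (\<integral>\<^sup>+ j. (SUP m. feller_iter Q m t i j) * h j \<partial>count_space UNIV)"

lemma borel_measurable_weighted_iter [measurable]:
  "(\<lambda>t. weighted_iter h m t i) \<in> borel_measurable borel"
  unfolding weighted_iter_def by (rule borel_measurable_nn_integral_count) measurable

lemma weighted_iter_mono: "weighted_iter h m t i \<le> weighted_iter h (Suc m) t i"
  unfolding weighted_iter_def by (intro nn_integral_mono mult_right_mono feller_iter_mono) simp

lemma weighted_minimal_SUP: "weighted_minimal h t i = (SUP m. weighted_iter h m t i)"
proof -
  have "weighted_minimal h t i = (\<integral>\<^sup>+ j. (SUP m. feller_iter Q m t i j * h j) \<partial>count_space UNIV)"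
    unfolding weighted_minimal_def by (simp add: SUP_mult_right_ennreal)
  also have "\<dots> = (SUP m. weighted_iter h m t i)"
    unfolding weighted_iter_def
    by (intro nn_integral_monotone_convergence_SUP incseq_SucI le_funI mult_right_mono feller_iter_mono) auto
  finally show ?thesis .
qed

lemma borel_measurable_weighted_minimal [measurable]:
  "(\<lambda>t. weighted_minimal h t i) \<in> borel_measurable borel"
  unfolding weighted_minimal_SUP by measurable

text \<open>The sum over final states \<open>j\<close> is moved inside the time integral and the sum
  over \<open>k\<close>, by Tonelli for each.\<close>

lemma jump_weighted:
  assumes [measurable]: "\<And>k j. (\<lambda>t. f j t k) \<in> borel_measurable borel"
  shows "(\<integral>\<^sup>+ j. jump (f j) t i * h j \<partial>count_space UNIV)
    = jump (\<lambda>t k. \<integral>\<^sup>+ j. f j t k * h j \<partial>count_space (UNIV :: 's set)) t i"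
proof -
  let ?C = "count_space (UNIV :: 's set)"
  define g where "g j s k = ennreal (Q i k) * f j (t - s) k * indicator (- {i}) k" for j s k
  define e where "e s = ennreal (exp (Q i i * s)) * indicator {0..t} s" for s
  have [measurable]: "(\<lambda>s. g j s k) \<in> borel_measurable borel" for j k
  proof -
    have [measurable]: "(\<lambda>s. f j (t - s) k) \<in> borel_measurable borel"
      by (rule measurable_compose[OF _ assms]) measurable
    show ?thesis unfolding g_def by measurable
  qed
  have [measurable]: "e \<in> borel_measurable borel" unfolding e_def by measurable
  have [measurable]: "(\<lambda>s. \<integral>\<^sup>+ k. g j s k \<partial>?C) \<in> borel_measurable borel" for j
    by (rule borel_measurable_nn_integral_count) measurable
  have jump_eq: "jump (f j) t i = (\<integral>\<^sup>+ s. e s * (\<integral>\<^sup>+ k. g j s k \<partial>?C) \<partial>lborel)" for j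
    unfolding jump_def e_def g_def by (simp only: mult_ac)
  have "(\<integral>\<^sup>+ j. jump (f j) t i * h j \<partial>?C)
    = (\<integral>\<^sup>+ j. (\<integral>\<^sup>+ s. e s * (\<integral>\<^sup>+ k. g j s k \<partial>?C) * h j \<partial>lborel) \<partial>?C)"
    unfolding jump_eq by (subst nn_integral_multc[symmetric]) auto
  also have "\<dots> = (\<integral>\<^sup>+ s. (\<integral>\<^sup>+ j. e s * (\<integral>\<^sup>+ k. g j s k \<partial>?C) * h j \<partial>?C) \<partial>lborel)"
    by (intro nn_integral_count_swap lborel.sigma_finite_measure_axioms) measurable
  also have "\<dots> = (\<integral>\<^sup>+ s. e s * (\<integral>\<^sup>+ k. (\<integral>\<^sup>+ j. g j s k * h j \<partial>?C) \<partial>?C) \<partial>lborel)"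
  proof (rule nn_integral_cong)
    fix s
    have "(\<integral>\<^sup>+ j. e s * (\<integral>\<^sup>+ k. g j s k \<partial>?C) * h j \<partial>?C)
        = (\<integral>\<^sup>+ j. e s * (\<integral>\<^sup>+ k. g j s k * h j \<partial>?C) \<partial>?C)"
      by (subst nn_integral_multc) (simp_all only: mult.assoc, simp_all)
    also have "\<dots> = e s * (\<integral>\<^sup>+ j. (\<integral>\<^sup>+ k. g j s k * h j \<partial>?C) \<partial>?C)"
      by (rule nn_integral_cmult) simp
    also have "(\<integral>\<^sup>+ j. (\<integral>\<^sup>+ k. g j s k * h j \<partial>?C) \<partial>?C) = (\<integral>\<^sup>+ k. (\<integral>\<^sup>+ j. g j s k * h j \<partial>?C) \<partial>?C)"
      by (intro nn_integral_count_swap sigma_finite_measure_count_space_countable) auto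
    finally show "(\<integral>\<^sup>+ j. e s * (\<integral>\<^sup>+ k. g j s k \<partial>?C) * h j \<partial>?C)
        = e s * (\<integral>\<^sup>+ k. (\<integral>\<^sup>+ j. g j s k * h j \<partial>?C) \<partial>?C)" .
  qed
  also have "(\<lambda>s k. \<integral>\<^sup>+ j. g j s k * h j \<partial>?C)
    = (\<lambda>s k. ennreal (Q i k) * (\<integral>\<^sup>+ j. f j (t - s) k * h j \<partial>?C) * indicator (- {i}) k)"
  proof (intro ext)
    fix s k
    have "(\<integral>\<^sup>+ j. g j s k * h j \<partial>?C)
        = (\<integral>\<^sup>+ j. (ennreal (Q i k) * indicator (- {i}) k) * (f j (t - s) k * h j) \<partial>?C)"
      unfolding g_def by (simp only: mult_ac)
    also have "\<dots> = (ennreal (Q i k) * indicator (- {i}) k) * (\<integral>\<^sup>+ j. f j (t - s) k * h j \<partial>?C)"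
      by (rule nn_integral_cmult) simp
    finally show "(\<integral>\<^sup>+ j. g j s k * h j \<partial>?C)
        = ennreal (Q i k) * (\<integral>\<^sup>+ j. f j (t - s) k * h j \<partial>?C) * indicator (- {i}) k"
      by (simp only: mult_ac)
  qed
  finally show ?thesis unfolding jump_def e_def by (simp only: mult_ac)
qed

lemma weighted_iter_Suc:
  "weighted_iter h (Suc m) t i = ennreal (exp (Q i i * t)) * h i + jump (weighted_iter h m) t i"
proof -
  have "weighted_iter h (Suc m) t i =
     (\<integral>\<^sup>+ j. (if i = j then ennreal (exp (Q i i * t)) else 0) * h j
       + jump (\<lambda>t k. feller_iter Q m t k j) t i * h j \<partial>count_space UNIV)"
    unfolding weighted_iter_def feller_iter_Suc by (simp add: distrib_right)
  also have "\<dots> = (\<integral>\<^sup>+ j. (if i = j then ennreal (exp (Q i i * t)) else 0) * h j \<partial>count_space UNIV)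
      + (\<integral>\<^sup>+ j. jump (\<lambda>t k. feller_iter Q m t k j) t i * h j \<partial>count_space UNIV)"
    by (rule nn_integral_add) auto
  also have "(\<integral>\<^sup>+ j. (if i = j then ennreal (exp (Q i i * t)) else 0) * h j \<partial>count_space UNIV)
      = (\<integral>\<^sup>+ j. (ennreal (exp (Q i i * t)) * h i) * indicator {i} j \<partial>count_space UNIV)"
    by (intro nn_integral_cong) (auto simp: indicator_def)
  also have "\<dots> = ennreal (exp (Q i i * t)) * h i"
    by (simp add: nn_integral_cmult)
  also have "(\<integral>\<^sup>+ j. jump (\<lambda>t k. feller_iter Q m t k j) t i * h j \<partial>count_space UNIV)
      = jump (weighted_iter h m) t i"
    unfolding weighted_iter_def[abs_def] by (rule jump_weighted) simp
  finally show ?thesis .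
qed

lemma weighted_minimal_eq:
  "weighted_minimal h t i = ennreal (exp (Q i i * t)) * h i + jump (weighted_minimal h) t i"
proof -
  have [measurable]: "(\<lambda>s. weighted_iter h m (t - s) k) \<in> borel_measurable borel" for m k
    by (rule measurable_compose[OF _ borel_measurable_weighted_iter]) measurable
  have [measurable]: "(\<lambda>s. \<integral>\<^sup>+ k\<in>- {i}. ennreal (Q i k) * weighted_iter h m (t - s) k \<partial>count_space UNIV) \<in> borel_measurable borel" for m
    by (rule borel_measurable_nn_integral_count) measurable
  have inner: "(\<integral>\<^sup>+ k\<in>- {i}. ennreal (Q i k) * weighted_minimal h s k \<partial>count_space UNIV)
    = (SUP m. \<integral>\<^sup>+ k\<in>- {i}. ennreal (Q i k) * weighted_iter h m s k \<partial>count_space UNIV)" for s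
    unfolding weighted_minimal_SUP SUP_mult_left_ennreal SUP_mult_right_ennreal
    by (intro nn_integral_monotone_convergence_SUP incseq_SucI le_funI mult_right_mono mult_left_mono
        weighted_iter_mono) auto
  have "jump (weighted_minimal h) t i = (SUP m. jump (weighted_iter h m) t i)"
    unfolding jump_def inner SUP_mult_left_ennreal SUP_mult_right_ennreal
    by (intro nn_integral_monotone_convergence_SUP incseq_SucI le_funI mult_right_mono mult_left_mono
        nn_integral_mono weighted_iter_mono) auto
  moreover have "weighted_minimal h t i = (SUP m. weighted_iter h (Suc m) t i)"
    unfolding weighted_minimal_SUP
  proof (rule antisym)
    show "(SUP m. weighted_iter h m t i) \<le> (SUP m. weighted_iter h (Suc m) t i)"
      by (rule SUP_mono) (use weighted_iter_mono in blast)
    show "(SUP m. weighted_iter h (Suc m) t i) \<le> (SUP m. weighted_iter h m t i)"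
      by (rule SUP_mono) blast
  qed
  moreover have "(SUP m. ennreal (exp (Q i i * t)) * h i + jump (weighted_iter h m) t i)
      = ennreal (exp (Q i i * t)) * h i + (SUP m. jump (weighted_iter h m) t i)"
    by (rule ennreal_SUP_add_right[symmetric]) simp
  ultimately show ?thesis by (simp add: weighted_iter_Suc)
qed

text \<open>Minimality: each iterate stays below any nonnegative solution because
  \<open>jump\<close> is monotone.\<close>

lemma weighted_minimal_le:
  assumes "\<And>t i. t \<ge> 0 \<Longrightarrow> \<phi> t i = ennreal (exp (Q i i * t)) * h i + jump \<phi> t i" and t: "t \<ge> 0"
  shows "weighted_minimal h t i \<le> \<phi> t i"
proof -
  have "weighted_iter h m t i \<le> \<phi> t i" if "t \<ge> 0" for m t i
    using that
  proof (induction m arbitrary: t i)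
    case (Suc m)
    have "jump (weighted_iter h m) t i \<le> jump \<phi> t i" by (rule jump_mono) (use Suc in auto)
    then show ?case
      unfolding weighted_iter_Suc assms(1)[OF Suc.prems] by (rule add_left_mono)
  qed (simp add: weighted_iter_def)
  then show ?thesis using t unfolding weighted_minimal_SUP by (intro SUP_least)
qed

text \<open>Conservativity gives total jump rate \<open>- Q i i\<close>, so a constant
  \<open>S\<close> passes through \<open>jump\<close> as \<open>S\<close> times the probability of
  having left \<open>i\<close> by time \<open>t\<close>. This is strictly less than
  \<open>S\<close>.\<close>

lemma jump_add_const:
  assumes [measurable]: "\<And>k. (\<lambda>t. f t k) \<in> borel_measurable borel" and t: "t \<ge> 0" and S: "S \<ge> 0"
  shows "jump (\<lambda>t k. f t k + ennreal S) t i = jump f t i + ennreal (S * (1 - exp (Q i i * t)))"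
proof -
  have [measurable]: "(\<lambda>s. f (t - s) k) \<in> borel_measurable borel" for k
    by (rule measurable_compose[OF _ assms(1)]) measurable
  have [measurable]: "(\<lambda>s. \<integral>\<^sup>+ k\<in>- {i}. ennreal (Q i k) * f (t - s) k \<partial>count_space UNIV) \<in> borel_measurable borel"
    by (rule borel_measurable_nn_integral_count) measurable
  have inner: "(\<integral>\<^sup>+ k\<in>- {i}. ennreal (Q i k) * (f s k + ennreal S) \<partial>count_space UNIV)
    = (\<integral>\<^sup>+ k\<in>- {i}. ennreal (Q i k) * f s k \<partial>count_space UNIV) + ennreal (- Q i i * S)" for s
  proof -
    have "(\<integral>\<^sup>+ k\<in>- {i}. ennreal (Q i k) * (f s k + ennreal S) \<partial>count_space UNIV)
      = (\<integral>\<^sup>+ k. ennreal (Q i k) * f s k * indicator (- {i}) k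
           + ennreal (Q i k) * indicator (- {i}) k * ennreal S \<partial>count_space UNIV)"
      by (intro nn_integral_cong) (simp add: distrib_left distrib_right mult_ac)
    also have "\<dots> = (\<integral>\<^sup>+ k\<in>- {i}. ennreal (Q i k) * f s k \<partial>count_space UNIV)
        + (\<integral>\<^sup>+ k\<in>- {i}. ennreal (Q i k) \<partial>count_space UNIV) * ennreal S"
      by (simp add: nn_integral_add nn_integral_multc)
    also have "(\<integral>\<^sup>+ k\<in>- {i}. ennreal (Q i k) \<partial>count_space UNIV) = ennreal (- Q i i)"
      by (rule nn_integral_count_has_sum[OF Q_off_diagonal]) (use Q_nonneg in auto)
    finally show ?thesis using Q_diag[of i] S by (simp add: ennreal_mult[symmetric])
  qed
  have ex: "(\<integral>\<^sup>+ s. ennreal (exp (Q i i * s) * (- Q i i * S)) * indicator {0..t} s \<partial>lborel)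
      = ennreal (S * (1 - exp (Q i i * t)))"
  proof (rule nn_integral_has_integral_lebesgue')
    show "0 \<le> exp (Q i i * s) * (- Q i i * S)" for s
      using Q_diag[of i] S by (intro mult_nonneg_nonneg) auto
    have "((\<lambda>s. (exp (Q i i * s) * Q i i) * (- S)) has_integral ((exp (Q i i * t) - 1) * (- S))) {0..t}"
      by (rule has_integral_mult_left[OF integral_exp[OF t]])
    then show "((\<lambda>s. exp (Q i i * s) * (- Q i i * S)) has_integral (S * (1 - exp (Q i i * t)))) {0..t}"
      by (simp add: algebra_simps)
  qed
  have mult: "ennreal (exp (Q i i * s) * (- Q i i * S)) = ennreal (exp (Q i i * s)) * ennreal (- Q i i * S)" for s
    using Q_diag[of i] S by (intro ennreal_mult mult_nonneg_nonneg) auto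
  have "jump (\<lambda>t k. f t k + ennreal S) t i = (\<integral>\<^sup>+ s.
      ennreal (exp (Q i i * s)) * (\<integral>\<^sup>+ k\<in>- {i}. ennreal (Q i k) * f (t - s) k \<partial>count_space UNIV) * indicator {0..t} s
      + ennreal (exp (Q i i * s) * (- Q i i * S)) * indicator {0..t} s \<partial>lborel)"
    unfolding jump_def inner mult by (intro nn_integral_cong) (simp only: distrib_left distrib_right)
  also have "\<dots> = jump f t i + ennreal (S * (1 - exp (Q i i * t)))"
    unfolding jump_def ex[symmetric] by (rule nn_integral_add) auto
  finally show ?thesis .
qed

text \<open>
  Uniqueness among solutions vanishing at infinity: if \<open>S\<close> is the least constant with
  \<open>\<phi> \<le> f + S\<close>, then off a finite set of states \<open>\<phi> \<le> S/2\<close>, and on that set one step of the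
  equation gains a factor \<open>1 - exp (Q i i * T) < 1\<close>.
\<close>
lemma le_weighted_minimal:
  fixes \<phi> :: "real \<Rightarrow> 's \<Rightarrow> real"
  assumes eq: "\<And>t i. t \<in> {0..T} \<Longrightarrow>
      ennreal (\<phi> t i) = ennreal (exp (Q i i * t)) * h i + jump (\<lambda>t i. ennreal (\<phi> t i)) t i"
    and \<phi>1: "\<And>t i. t \<in> {0..T} \<Longrightarrow> \<phi> t i \<le> 1"
    and decay: "\<And>\<epsilon>. \<epsilon> > 0 \<Longrightarrow> finite {i. \<exists>t\<in>{0..T}. \<epsilon> < \<phi> t i}"
    and T: "T \<ge> 0"
  shows "ennreal (\<phi> T i) \<le> weighted_minimal h T i"
proof -
  let ?g = "weighted_minimal h"
  define X where "X = {S. 0 \<le> S \<and> (\<forall>t\<in>{0..T}. \<forall>i. ennreal (\<phi> t i) \<le> ?g t i + ennreal S)}"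
  define S where "S = Inf X"
  have "1 \<in> X"
  proof -
    have "ennreal (\<phi> t i) \<le> ?g t i + ennreal 1" if "t \<in> {0..T}" for t i
      by (intro add_increasing ennreal_leI \<phi>1 that) simp
    then show ?thesis unfolding X_def by (intro CollectI conjI ballI allI zero_le_one) simp
  qed
  then have Xne: "X \<noteq> {}" by blast
  have bdd: "bdd_below X" by (auto simp: X_def bdd_below_def)
  have S0: "0 \<le> S" unfolding S_def by (rule cInf_greatest[OF Xne]) (simp add: X_def)
  \<comment> \<open>The infimum is attained, since the defining inequalities are closed.\<close>
  have "S \<in> X"
    unfolding X_def
  proof (intro CollectI conjI ballI allI S0)
    fix t i assume t: "t \<in> {0..T}"
    show "ennreal (\<phi> t i) \<le> ?g t i + ennreal S"
    proof (rule ennreal_le_epsilon)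
      fix e :: real assume e: "0 < e"
      obtain S' where S': "S' \<in> X" "S' < S + e"
        using cInf_lessD[OF Xne, of "S + e"] e by (auto simp: S_def)
      have "ennreal (\<phi> t i) \<le> ?g t i + ennreal S'" using S' t by (auto simp: X_def)
      also have "\<dots> \<le> ?g t i + ennreal (S + e)" using S' by (intro add_left_mono ennreal_leI) auto
      finally show "ennreal (\<phi> t i) \<le> ?g t i + ennreal S + ennreal e"
        using S0 e by (simp add: add.assoc)
    qed
  qed
  have "S = 0"
  proof (rule ccontr)
    assume "S \<noteq> 0"
    then have Spos: "0 < S" using S0 by simp
    define F where "F = {i. \<exists>t\<in>{0..T}. S / 2 < \<phi> t i}"
    have F: "finite F" unfolding F_def using decay[of "S / 2"] Spos by simp
    \<comment> \<open>\<open>1/2\<close> serves the states outside \<open>F\<close>; finiteness of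
      \<open>F\<close> keeps the maximum below \<open>1\<close>.\<close>
    define \<theta> where "\<theta> = Max (insert (1/2) ((\<lambda>i. 1 - exp (Q i i * T)) ` F))"
    have fin: "finite (insert (1/2) ((\<lambda>i. 1 - exp (Q i i * T)) ` F))" using F by simp
    have \<theta>: "1/2 \<le> \<theta>" "\<theta> < 1" "\<And>i. i \<in> F \<Longrightarrow> 1 - exp (Q i i * T) \<le> \<theta>"
      unfolding \<theta>_def using Max_ge[OF fin] fin by (blast, simp, blast)
    have "S * \<theta> \<in> X"
      unfolding X_def
    proof (intro CollectI conjI ballI allI)
      show "0 \<le> S * \<theta>" using S0 \<theta> by simp
      fix t i assume t: "t \<in> {0..T}"
      show "ennreal (\<phi> t i) \<le> ?g t i + ennreal (S * \<theta>)"
      proof (cases "i \<in> F")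
        case False
        then have "\<phi> t i \<le> S * (1/2)" using t by (auto simp: F_def not_less)
        also have "\<dots> \<le> S * \<theta>" using S0 \<theta> by (intro mult_left_mono) auto
        finally show ?thesis by (intro add_increasing ennreal_leI) simp_all
      next
        case True
        have "ennreal (\<phi> t i) \<le> ennreal (exp (Q i i * t)) * h i + jump (\<lambda>t k. ?g t k + ennreal S) t i"
          unfolding eq[OF t] using \<open>S \<in> X\<close> t by (intro add_left_mono jump_mono) (auto simp: X_def)
        also have "\<dots> = ?g t i + ennreal (S * (1 - exp (Q i i * t)))"
          using t S0 by (subst jump_add_const) (auto simp: weighted_minimal_eq[of h t i] add.assoc)
        also have "\<dots> \<le> ?g t i + ennreal (S * \<theta>)"
        proof (intro add_left_mono ennreal_leI mult_left_mono S0)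
          have "Q i i * T \<le> Q i i * t" using Q_diag[of i] t by (intro mult_left_mono_neg) auto
          then show "1 - exp (Q i i * t) \<le> \<theta>" using \<theta>(3)[OF True] by (smt (verit) exp_le_cancel_iff)
        qed
        finally show ?thesis .
      qed
    qed
    then have "S \<le> S * \<theta>" unfolding S_def using bdd by (intro cInf_lower)
    then show False using Spos \<theta>(2) by simp
  qed
  then show ?thesis using \<open>S \<in> X\<close> T by (auto simp: X_def)
qed

end

section \<open>Generating functions of the transition probabilities\<close>

lemma finite_bounded_degree: "finite {i :: nat ^ 'n::finite. (\<Sum>k\<in>UNIV. i $ k) < N}"
proof (rule finite_imageD[of vec_nth])
  have "i $ k \<le> (\<Sum>k\<in>UNIV. i $ k)" for i :: "nat ^ 'n" and k
    by (rule member_le_sum) auto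
  then have "vec_nth ` {i :: nat ^ 'n. (\<Sum>k\<in>UNIV. i $ k) < N} \<subseteq> (PiE UNIV (\<lambda>_. {..<N}))"
    by (auto intro: le_less_trans)
  then show "finite (vec_nth ` {i :: nat ^ 'n. (\<Sum>k\<in>UNIV. i $ k) < N})"
    by (rule finite_subset) (auto intro: finite_PiE)
qed (auto intro!: inj_onI simp: vec_eq_iff)

lemma monomial_le_power:
  assumes "u \<in> cube" "\<And>k. u $ k \<le> r"
  shows "monomial j u \<le> r ^ (\<Sum>k\<in>UNIV. j $ k)"
  unfolding monomial_def power_sum
  using assms by (intro prod_mono) (auto simp: cube_def intro!: power_mono)

context immigration_branching
begin

sublocale rates: conservative_rates q
  by unfold_locales (auto intro: q_nonneg q_has_sum)

lemma A_ge: "u \<in> cube \<Longrightarrow> A 0 \<le> A u"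
  by (rule A_mono) (auto simp: cube_def less_eq_vec_def)

lemma continuous_on_A_flow: "u \<in> cube \<Longrightarrow> continuous_on {0..} (\<lambda>s. A (flow u s))"
  by (rule continuous_on_compose2[OF continuous_on_gen_fun[OF a_summable] continuous_on_flow])
     (auto simp: flow_in_cube)

lemma A_flow_integrable:
  assumes u: "u \<in> cube" and t: "0 \<le> s"
  shows "(\<lambda>s. A (flow u s)) integrable_on {s..t}"
  by (rule integrable_continuous_interval, rule continuous_on_subset[OF continuous_on_A_flow[OF u]])
     (use t in auto)

text \<open>The contribution of the immigrants and their descendants: it equals
  \<open>state_gf\<close> for the empty initial state.\<close>

definition immigration_factor :: "real ^ 'n \<Rightarrow> real \<Rightarrow> real" where
  "immigration_factor u t = exp (integral {0..t} (\<lambda>s. A (flow u s)))"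

definition state_gf :: "real ^ 'n \<Rightarrow> real \<Rightarrow> nat ^ 'n \<Rightarrow> real" where
  "state_gf u t i = monomial i (flow u t) * immigration_factor u t"

lemma immigration_factor_0 [simp]: "immigration_factor u 0 = 1"
  by (simp add: immigration_factor_def)

lemma immigration_factor_pos: "0 < immigration_factor u t"
  by (simp add: immigration_factor_def)

lemma immigration_factor_le_1:
  assumes "u \<in> cube"
  shows "immigration_factor u t \<le> 1"
proof -
  have "integral {0..t} (\<lambda>s. A (flow u s)) \<le> integral {0..t} (\<lambda>s. 0)"
    using assms by (intro integral_le A_flow_integrable) (auto intro: A_nonpos flow_in_cube)
  then show ?thesis by (simp add: immigration_factor_def)
qed

lemma immigration_factor_deriv:
  assumes u: "u \<in> cube" and t: "0 \<le> t"
  shows "(immigration_factor u has_real_derivative A (flow u t) * immigration_factor u t) (at t within {0..})"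
proof -
  have "((\<lambda>t. integral {0..t} (\<lambda>s. A (flow u s))) has_real_derivative A (flow u t)) (at t within {0..})"
    unfolding has_real_derivative_iff_has_vector_derivative
    by (rule integral_has_vector_derivative_Ici[OF continuous_on_A_flow[OF u] t])
  from DERIV_chain2[OF DERIV_exp this] show ?thesis
    unfolding immigration_factor_def[abs_def] by (simp add: mult.commute)
qed

lemma monomial_flow_deriv:
  assumes u: "u \<in> cube" and t: "0 \<le> t"
  shows "((\<lambda>t. monomial i (flow u t)) has_real_derivative
    (\<Sum>k\<in>UNIV. real (i $ k) * (monomial (i - axis k 1) (flow u t) * gen_fun (b k) (flow u t)))) (at t within {0..})"
  using vector_derivative_diff_chain_within[OF flow_deriv[OF u t] has_derivative_monomial, of i]
  unfolding has_real_derivative_iff_has_vector_derivative by (simp add: o_def mult_ac)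

text \<open>Written so that it is visibly both the time derivative of \<open>state_gf\<close> and
  the sum of \<open>q i j * state_gf u t j\<close> over \<open>j\<close>: together the backward
  differential equation.\<close>

definition state_gf_deriv :: "real ^ 'n \<Rightarrow> real \<Rightarrow> nat ^ 'n \<Rightarrow> real" where
  "state_gf_deriv u t i = ((\<Sum>k\<in>UNIV. real (i $ k) *
      (monomial (i - axis k 1) (flow u t) * gen_fun (b k) (flow u t))) + monomial i (flow u t) * A (flow u t))
     * immigration_factor u t"

lemma state_gf_has_derivative:
  assumes u: "u \<in> cube" and t: "0 \<le> t"
  shows "((\<lambda>t. state_gf u t i) has_real_derivative state_gf_deriv u t i) (at t within {0..})"
  using DERIV_mult[OF monomial_flow_deriv[OF u t] immigration_factor_deriv[OF u t], of i]
  by (simp add: state_gf_def state_gf_deriv_def algebra_simps)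

lemma q_state_gf_has_sum:
  assumes u: "u \<in> cube" and t: "0 \<le> t"
  shows "((\<lambda>j. q i j * state_gf u t j) has_sum state_gf_deriv u t i) UNIV"
  using has_sum_cmult_left[OF q_gen_fun[OF flow_in_cube[OF u t], of i], of "immigration_factor u t"]
  by (simp add: state_gf_def state_gf_deriv_def mult.assoc)

lemma state_gf_nonneg: "u \<in> cube \<Longrightarrow> 0 \<le> t \<Longrightarrow> 0 \<le> state_gf u t i"
  using monomial_nonneg[OF flow_in_cube] immigration_factor_pos[of u t]
  by (simp add: state_gf_def)

lemma state_gf_le_monomial: "u \<in> cube \<Longrightarrow> 0 \<le> t \<Longrightarrow> state_gf u t i \<le> monomial i (flow u t)"
  unfolding state_gf_def
  by (rule mult_left_le[OF immigration_factor_le_1 monomial_nonneg[OF flow_in_cube]])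

lemma state_gf_le_1: "u \<in> cube \<Longrightarrow> 0 \<le> t \<Longrightarrow> state_gf u t i \<le> 1"
  using state_gf_le_monomial monomial_le_1[OF flow_in_cube] by (meson order_trans)

lemma state_gf_0: "u \<in> cube \<Longrightarrow> state_gf u 0 i = monomial i u"
  by (simp add: state_gf_def)

text \<open>Variation of constants: \<open>- exp (q i i * s) * state_gf u (t - s) i\<close> has
  derivative \<open>exp (q i i * s) * r (t - s)\<close> in \<open>s\<close>, because the diagonal
  term of the backward equation cancels. Integrating from \<open>0\<close> to \<open>t\<close>
  leaves the two endpoint values.\<close>

lemma state_gf_backward:
  assumes u: "u \<in> cube" and t: "0 \<le> t"
  shows "ennreal (state_gf u t i) = ennreal (exp (q i i * t)) * ennreal (monomial i u)
    + rates.jump (\<lambda>t i. ennreal (state_gf u t i)) t i"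
proof -
  define r where "r s = state_gf_deriv u s i - q i i * state_gf u s i" for s
  have r_sum: "((\<lambda>k. q i k * state_gf u s k) has_sum r s) (- {i})" if "0 \<le> s" for s
  proof -
    have "((\<lambda>k. q i k * state_gf u s k) has_sum (state_gf_deriv u s i - q i i * state_gf u s i)) (UNIV - {i})"
      by (rule has_sum_Diff[OF q_state_gf_has_sum[OF u that]]) (auto simp: has_sum_finite_iff)
    then show ?thesis by (simp add: r_def Compl_eq_Diff_UNIV)
  qed
  have r0: "0 \<le> r s" if "0 \<le> s" for s
    by (rule has_sum_nonneg[OF r_sum[OF that]]) (use that q_nonneg state_gf_nonneg u in auto)
  have inner: "(\<integral>\<^sup>+ k\<in>- {i}. ennreal (q i k) * ennreal (state_gf u s k) \<partial>count_space UNIV) = ennreal (r s)"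
    if "0 \<le> s" for s
  proof -
    have "(\<integral>\<^sup>+ k\<in>- {i}. ennreal (q i k * state_gf u s k) \<partial>count_space UNIV) = ennreal (r s)"
      by (rule nn_integral_count_has_sum[OF r_sum[OF that]]) (use that q_nonneg state_gf_nonneg u in auto)
    moreover have "ennreal (q i k * state_gf u s k) * indicator (- {i}) k
        = ennreal (q i k) * ennreal (state_gf u s k) * indicator (- {i}) k" for k
      using q_nonneg[of i k] state_gf_nonneg[OF u that] by (cases "k = i") (auto simp: ennreal_mult)
    ultimately show ?thesis by simp
  qed
  have "((\<lambda>s. exp (q i i * s) * r (t - s)) has_integral
      - (exp (q i i * t) * state_gf u (t - t) i) - - (exp (q i i * 0) * state_gf u (t - 0) i)) {0..t}"
  proof (rule fundamental_theorem_of_calculus[OF t])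
    fix s assume s: "s \<in> {0..t}"
    have "(((\<lambda>t. state_gf u t i) \<circ> (\<lambda>s. t - s)) has_real_derivative state_gf_deriv u (t - s) i * (-1)) (at s within {0..t})"
    proof (rule DERIV_image_chain)
      show "((\<lambda>t. state_gf u t i) has_real_derivative state_gf_deriv u (t - s) i) (at (t - s) within (-) t ` {0..t})"
        by (rule DERIV_subset[OF state_gf_has_derivative[OF u]]) (use s in auto)
    qed (auto intro!: derivative_eq_intros)
    moreover have "((\<lambda>s. exp (q i i * s)) has_real_derivative exp (q i i * s) * q i i) (at s within {0..t})"
      by (auto intro!: derivative_eq_intros)
    ultimately have "((\<lambda>s. exp (q i i * s) * state_gf u (t - s) i) has_real_derivative
        exp (q i i * s) * q i i * state_gf u (t - s) i + state_gf_deriv u (t - s) i * (-1) * exp (q i i * s))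
        (at s within {0..t})"
      using DERIV_mult by (fastforce simp: o_def)
    from DERIV_minus[OF this]
    show "((\<lambda>s. - (exp (q i i * s) * state_gf u (t - s) i)) has_vector_derivative exp (q i i * s) * r (t - s))
        (at s within {0..t})"
      unfolding has_real_derivative_iff_has_vector_derivative[symmetric]
      by (rule DERIV_cong) (simp add: r_def algebra_simps)
  qed
  then have int: "((\<lambda>s. exp (q i i * s) * r (t - s)) has_integral
      (state_gf u t i - exp (q i i * t) * monomial i u)) {0..t}"
    by (simp add: state_gf_0[OF u])
  have "rates.jump (\<lambda>t i. ennreal (state_gf u t i)) t i
    = (\<integral>\<^sup>+ s. ennreal (exp (q i i * s) * r (t - s)) * indicator {0..t} s \<partial>lborel)"
    unfolding rates.jump_def
  proof (rule nn_integral_cong)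
    fix s
    show "ennreal (exp (q i i * s)) *
        (\<integral>\<^sup>+ k\<in>- {i}. ennreal (q i k) * ennreal (state_gf u (t - s) k) \<partial>count_space UNIV) * indicator {0..t} s
      = ennreal (exp (q i i * s) * r (t - s)) * indicator {0..t} s"
      using inner[of "t - s"] r0[of "t - s"] by (cases "s \<in> {0..t}") (auto simp: ennreal_mult)
  qed
  also have "\<dots> = ennreal (state_gf u t i - exp (q i i * t) * monomial i u)"
  proof (rule nn_integral_has_integral_lebesgue')
    show "0 \<le> exp (q i i * s) * r (t - s)" if "s \<in> {0..t}" for s
      using r0[of "t - s"] that by simp
  qed (rule int)
  finally have J: "rates.jump (\<lambda>t i. ennreal (state_gf u t i)) t i
      = ennreal (state_gf u t i - exp (q i i * t) * monomial i u)" .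
  have "0 \<le> state_gf u t i - exp (q i i * t) * monomial i u"
    by (rule has_integral_nonneg[OF int]) (use r0 in auto)
  then show ?thesis unfolding J using monomial_nonneg[OF u, of i]
    by (simp add: ennreal_mult[symmetric] ennreal_plus[symmetric] del: ennreal_plus)
qed

lemma state_gf_decay:
  assumes u: "u \<in> cube" and u1: "\<And>k. u $ k < 1" and \<epsilon>: "0 < \<epsilon>"
  shows "finite {i. \<exists>t\<in>{0..T}. \<epsilon> < state_gf u t i}"
proof -
  define \<mu> where "\<mu> = Max (range (\<lambda>k. u $ k))"
  have \<mu>: "u $ k \<le> \<mu>" "\<mu> < 1" for k using u1 by (auto simp: \<mu>_def)
  \<comment> \<open>A bound on all coordinates of the flow, uniform over the whole interval
    \<open>{0..T}\<close>.\<close>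
  define r where "r = 1 - exp (- rate * T) * (1 - \<mu>)"
  have r1: "r < 1" using \<mu> by (simp add: r_def)
  have flow_le: "flow u t $ k \<le> r" if "t \<in> {0..T}" for t k
  proof -
    have "exp (- rate * T) * (1 - \<mu>) \<le> exp (- rate * t) * (1 - u $ k)"
      using that rate_pos \<mu>(1)[of k] \<mu>(2) by (intro mult_mono) auto
    also have "\<dots> \<le> 1 - flow u t $ k" by (rule flow_le_1[OF u]) (use that in auto)
    finally show ?thesis by (simp add: r_def)
  qed
  show ?thesis
  proof (cases "T < 0")
    case False
    have r0: "0 \<le> r"
      by (rule order_trans[OF cubeD(1)[OF flow_in_cube[OF u order_refl]] flow_le[of 0]]) (use False in auto)
    obtain N where N: "r ^ N < \<epsilon>" using real_arch_pow_inv[OF \<epsilon> r1] by blast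
    have "{i. \<exists>t\<in>{0..T}. \<epsilon> < state_gf u t i} \<subseteq> {i. (\<Sum>k\<in>UNIV. i $ k) < N}"
    proof safe
      fix i t assume t: "t \<in> {0..T}" and less: "\<epsilon> < state_gf u t i"
      have "state_gf u t i \<le> monomial i (flow u t)" using u t by (intro state_gf_le_monomial) auto
      also have "\<dots> \<le> r ^ (\<Sum>k\<in>UNIV. i $ k)"
        using u t by (intro monomial_le_power flow_le flow_in_cube) auto
      finally have "r ^ N < r ^ (\<Sum>k\<in>UNIV. i $ k)" using less N by linarith
      then show "(\<Sum>k\<in>UNIV. i $ k) < N"
        using power_decreasing[of N "\<Sum>k\<in>UNIV. i $ k" r] r0 r1 by (meson not_le less_imp_le)
    qed
    then show ?thesis using finite_bounded_degree finite_subset by blast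
  qed auto
qed

section \<open>Identification with the minimal solution, and honesty\<close>

abbreviation "p \<equiv> feller_minimal q"

lemma weighted_minimal_state_gf:
  assumes u: "u \<in> cube" and u1: "\<And>k. u $ k < 1" and t: "0 \<le> t"
  shows "rates.weighted_minimal (\<lambda>j. ennreal (monomial j u)) t i = ennreal (state_gf u t i)"
proof (rule antisym)
  show "rates.weighted_minimal (\<lambda>j. ennreal (monomial j u)) t i \<le> ennreal (state_gf u t i)"
    by (rule rates.weighted_minimal_le[OF state_gf_backward[OF u] t])
  show "ennreal (state_gf u t i) \<le> rates.weighted_minimal (\<lambda>j. ennreal (monomial j u)) t i"
    by (rule rates.le_weighted_minimal)
       (use u t state_gf_backward state_gf_le_1 state_gf_decay[OF u u1] in auto)
qed

lemma flow_one: "0 \<le> t \<Longrightarrow> flow 1 t = 1"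
  by (rule flow_unique[symmetric]) (auto simp: B_one)

lemma flow_scaled_tendsto:
  assumes t: "0 \<le> t"
  shows "(\<lambda>m. flow ((1 - inverse (real (Suc m))) *\<^sub>R 1) t) \<longlonglongrightarrow> 1"
proof (rule LIM_zero_cancel, rule Lim_null_comparison)
  have cube: "(1 - inverse (real (Suc m))) *\<^sub>R (1 :: real ^ 'n) \<in> cube" for m
    by (auto simp: cube_def field_simps)
  show "\<forall>\<^sub>F m in sequentially. norm (flow ((1 - inverse (real (Suc m))) *\<^sub>R 1) t - 1)
      \<le> exp (Lip * t) * (inverse (real (Suc m)) * norm (1 :: real ^ 'n))"
  proof (rule always_eventually, rule allI)
    fix m
    have "norm (flow ((1 - inverse (real (Suc m))) *\<^sub>R 1) t - flow 1 t)
      \<le> exp (Lip * t) * norm ((1 - inverse (real (Suc m))) *\<^sub>R 1 - (1 :: real ^ 'n))"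
      by (rule flow_lipschitz[OF cube one_in_cube t])
    also have "(1 - inverse (real (Suc m))) *\<^sub>R 1 - (1 :: real ^ 'n) = - (inverse (real (Suc m)) *\<^sub>R 1)"
      by (simp add: scaleR_diff_left)
    finally show "norm (flow ((1 - inverse (real (Suc m))) *\<^sub>R 1) t - 1)
      \<le> exp (Lip * t) * (inverse (real (Suc m)) * norm (1 :: real ^ 'n))"
      by (simp add: flow_one[OF t])
  qed
  have "(\<lambda>m. exp (Lip * t) * (inverse (real (Suc m)) * norm (1 :: real ^ 'n)))
      \<longlonglongrightarrow> exp (Lip * t) * (0 * norm (1 :: real ^ 'n))"
    by (intro tendsto_intros LIMSEQ_inverse_real_of_nat)
  then show "(\<lambda>m. exp (Lip * t) * (inverse (real (Suc m)) * norm (1 :: real ^ 'n))) \<longlonglongrightarrow> 0" by simp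
qed

text \<open>At the corner itself there is no decay in \<open>i\<close>, so only the upper bound from
  minimality applies directly. The lower bound is the limit of the identity at points
  \<open>v m\<close> rising to \<open>1\<close> along the diagonal.\<close>

lemma total_mass:
  assumes t: "0 \<le> t"
  shows "rates.weighted_minimal (\<lambda>j. 1) t i = 1"
proof (rule antisym)
  have "rates.weighted_minimal (\<lambda>j. ennreal (monomial j 1)) t i \<le> ennreal (state_gf 1 t i)"
    by (rule rates.weighted_minimal_le[OF state_gf_backward[OF one_in_cube] t])
  also have "\<dots> \<le> ennreal 1" by (intro ennreal_leI state_gf_le_1 t) simp
  finally show "rates.weighted_minimal (\<lambda>j. 1) t i \<le> 1" by simp
  define v where "v m = (1 - inverse (real (Suc m))) *\<^sub>R (1 :: real ^ 'n)" for m
  have v: "v m \<in> cube" "v m $ k < 1" for m k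
    by (auto simp: v_def cube_def field_simps)
  have le: "ennreal (state_gf (v m) t i) \<le> rates.weighted_minimal (\<lambda>j. 1) t i" for m
  proof -
    have "rates.weighted_minimal (\<lambda>j. ennreal (monomial j (v m))) t i \<le> rates.weighted_minimal (\<lambda>j. 1) t i"
      unfolding rates.weighted_minimal_def
      using monomial_le_1[OF v(1)] by (intro nn_integral_mono mult_left_mono) (auto simp: ennreal_le_1)
    then show ?thesis using weighted_minimal_state_gf[OF v t] by simp
  qed
  have lim: "(\<lambda>m. state_gf (v m) t i) \<longlonglongrightarrow> monomial i 1 * exp (integral {0..t} (\<lambda>s. 0))"
    unfolding state_gf_def immigration_factor_def
  \<comment> \<open>The integrands \<open>A (flow (v m) s)\<close> lie between \<open>A 0\<close>
    and \<open>0\<close>, so \<open>- A 0\<close> dominates them.\<close>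
  proof (intro tendsto_mult tendsto_exp dominated_convergence(2)[where h = "\<lambda>_. - A 0"])
    have "isCont (monomial i) 1"
      using continuous_on_monomial[of UNIV i] by (simp add: continuous_on_eq_continuous_at)
    then show "(\<lambda>m. monomial i (flow (v m) t)) \<longlonglongrightarrow> monomial i 1"
      using flow_scaled_tendsto[OF t] unfolding v_def by (rule isCont_tendsto_compose)
    fix m s assume s: "s \<in> {0..t}"
    have "flow (v m) s \<in> cube" using s v by (intro flow_in_cube) auto
    then show "norm (A (flow (v m) s)) \<le> - A 0" using A_ge A_nonpos by fastforce
  next
    fix s assume s: "s \<in> {0..t}"
    have "(\<lambda>m. A (flow (v m) s)) \<longlonglongrightarrow> A 1"
      by (rule continuous_on_tendsto_compose[OF continuous_on_gen_fun[OF a_summable]])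
         (use s v flow_scaled_tendsto in \<open>auto simp: v_def intro!: always_eventually flow_in_cube\<close>)
    then show "(\<lambda>m. A (flow (v m) s)) \<longlonglongrightarrow> 0" by (simp add: A_one)
  qed (use A_flow_integrable v in auto)
  then have "(\<lambda>m. ennreal (state_gf (v m) t i)) \<longlonglongrightarrow> ennreal 1"
    by (intro tendsto_ennrealI) simp
  then show "1 \<le> rates.weighted_minimal (\<lambda>j. 1) t i"
    using LIMSEQ_le_const2[of "\<lambda>m. ennreal (state_gf (v m) t i)" "ennreal 1"] le by simp
qed

text \<open>\<open>enn2real\<close> would silently turn infinity into \<open>0\<close>; total mass
  \<open>1\<close> excludes this.\<close>

lemma ennreal_p:
  assumes t: "0 \<le> t"
  shows "ennreal (p t i j) = (SUP m. feller_iter q m t i j)"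
proof -
  have "(SUP m. feller_iter q m t i j) \<le> rates.weighted_minimal (\<lambda>j. 1) t i"
    unfolding rates.weighted_minimal_def
    using nn_integral_ge_point[of j UNIV "\<lambda>j. SUP m. feller_iter q m t i j"] by simp
  then have "(SUP m. feller_iter q m t i j) < top"
    unfolding total_mass[OF t] by (rule le_less_trans) simp
  then show ?thesis unfolding feller_minimal_def by (rule ennreal_enn2real)
qed

lemma p_nonneg: "0 \<le> p t i j"
  by (simp add: feller_minimal_def)

lemma p_has_sum:
  assumes t: "0 \<le> t"
  shows "(p t i has_sum 1) UNIV"
  by (rule has_sum_nn_integral_count)
     (use total_mass[OF t, of i] in \<open>simp_all add: rates.weighted_minimal_def ennreal_p[OF t] p_nonneg\<close>)

theorem p_gen_fun:
  assumes u: "u \<in> cube" and u1: "\<And>k. u $ k < 1" and t: "0 \<le> t"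
  shows "((\<lambda>j. p t i j * monomial j u) has_sum state_gf u t i) UNIV"
proof (rule has_sum_nn_integral_count)
  show "(\<integral>\<^sup>+ j. ennreal (p t i j * monomial j u) \<partial>count_space UNIV) = ennreal (state_gf u t i)"
    using weighted_minimal_state_gf[OF u u1 t, of i]
    by (simp add: rates.weighted_minimal_def ennreal_mult p_nonneg monomial_nonneg[OF u] ennreal_p[OF t])
qed (auto simp: p_nonneg monomial_nonneg[OF u] state_gf_nonneg[OF u t])

end

section \<open>Zeros of the branching mechanism and the mean matrix\<close>

text \<open>The line through \<open>u\<close> in direction \<open>k\<close>, with parameter in
  \<open>{0..1}\<close>, stays in the cube. A derivative relative to the cube thus restricts to it,
  one-sidedly on the faces.\<close>

lemma partial_deriv_eq:
  assumes D: "(f has_derivative (\<lambda>h. \<Sum>k\<in>UNIV. h $ k * D k)) (at u within cube)" and u: "u \<in> cube"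
  shows "partial_deriv f k u = D k"
proof -
  define pt :: "real \<Rightarrow> real ^ 'a" where "pt x = (\<chi> l. if l = k then x else u $ l)" for x
  have [simp]: "pt (u $ k) = u" by (auto simp: pt_def vec_eq_iff)
  have pt_eq: "pt = (\<lambda>x. (\<chi> l. if l = k then 0 else u $ l) + x *\<^sub>R axis k 1)"
    by (auto simp: pt_def fun_eq_iff vec_eq_iff axis_def)
  have "(pt has_vector_derivative axis k 1) (at (u $ k) within {0..1})"
    unfolding pt_eq by (auto intro!: derivative_eq_intros)
  moreover have "(f has_derivative (\<lambda>h. \<Sum>k\<in>UNIV. h $ k * D k)) (at (pt (u $ k)) within pt ` {0..1})"
  proof -
    have "pt ` {0..1} \<subseteq> cube" using u by (auto simp: pt_def cube_def)
    then show ?thesis using has_derivative_subset[OF D] by simp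
  qed
  ultimately have "(f \<circ> pt has_vector_derivative (\<Sum>l\<in>UNIV. axis k 1 $ l * D l)) (at (u $ k) within {0..1})"
    by (rule vector_derivative_diff_chain_within)
  moreover have "(\<Sum>l\<in>UNIV. axis k 1 $ l * D l) = D k"
  proof -
    have "(\<Sum>l\<in>UNIV. axis k 1 $ l * D l) = (\<Sum>l\<in>UNIV. if l = k then D k else 0)"
      by (rule sum.cong) (auto simp: axis_def)
    then show ?thesis by simp
  qed
  moreover have "f \<circ> pt = along f k u" by (auto simp: along_def pt_def fun_eq_iff)
  ultimately have "(along f k u has_vector_derivative D k) (at (u $ k) within cbox 0 1)" by simp
  from vector_derivative_within_cbox[OF _ _ this] show ?thesis
    unfolding partial_deriv_def using cubeD[OF u] by simp
qed

lemma monomial_le_component: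
  assumes "u \<in> cube" "0 < j $ k"
  shows "monomial j u \<le> u $ k"
proof -
  have "axis k 1 $ l \<le> j $ l" for l using assms(2) by (auto simp: axis_def)
  then have "j = axis k 1 + (j - axis k 1)" by (simp add: vec_eq_iff)
  then have "monomial j u = u $ k * monomial (j - axis k 1) u"
    by (metis monomial_add monomial_axis)
  then show ?thesis using assms by (simp add: mult_left_le monomial_le_1 cubeD)
qed

lemma monomial_ge_linear:
  assumes u: "u \<in> cube"
  shows "1 - (\<Sum>l\<in>UNIV. real (j $ l) * (1 - u $ l)) \<le> monomial j u"
  using monomial_diff_le[OF one_in_cube u, of j] cubeD[OF u] by simp

text \<open>Split off one variable: \<open>u $ k * (1 - \<sigma>)\<close> exceeds the linear bound
  by \<open>(1 - u $ k) * \<sigma>\<close>, which is positive because degree at least two leaves a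
  further factor below \<open>1\<close>.\<close>

lemma monomial_gt_linear:
  fixes j :: "nat ^ 'n::finite"
  assumes u: "u \<in> cube" "\<And>k. u $ k < 1" and j: "2 \<le> (\<Sum>l\<in>UNIV. j $ l)"
  shows "1 - (\<Sum>l\<in>UNIV. real (j $ l) * (1 - u $ l)) < monomial j u"
proof -
  obtain k where k: "0 < j $ k" using j by (cases "\<exists>k. 0 < j $ k") auto
  define i where "i = j - axis k 1"
  have "axis k 1 $ l \<le> j $ l" for l using k by (auto simp: axis_def)
  then have ji: "j = axis k 1 + i" by (simp add: i_def vec_eq_iff)
  have ax: "(\<Sum>l\<in>UNIV. axis k (1::nat) $ l) = 1" by (simp add: axis_def)
  have "(\<Sum>l\<in>UNIV. j $ l) = 1 + (\<Sum>l\<in>UNIV. i $ l)"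
    unfolding ji by (simp add: sum.distrib ax del: One_nat_def)
  with j obtain m where m: "0 < i $ m" by (cases "\<exists>m. 0 < i $ m") auto
  define \<sigma> where "\<sigma> = (\<Sum>l\<in>UNIV. real (i $ l) * (1 - u $ l))"
  have "0 < \<sigma>"
    unfolding \<sigma>_def using m u by (intro sum_pos2[of _ m]) (auto simp: cube_def)
  have sj: "(\<Sum>l\<in>UNIV. real (j $ l) * (1 - u $ l)) = (1 - u $ k) + \<sigma>"
  proof -
    have "(\<Sum>l\<in>UNIV. real (axis k (1::nat) $ l) * (1 - u $ l)) = (\<Sum>l\<in>UNIV. if l = k then 1 - u $ k else 0)"
      by (rule sum.cong) (auto simp: axis_def)
    then have "(\<Sum>l\<in>UNIV. real (axis k (1::nat) $ l) * (1 - u $ l)) = 1 - u $ k" by simp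
    then show ?thesis unfolding ji \<sigma>_def by (simp add: distrib_right sum.distrib del: One_nat_def)
  qed
  have "1 - \<sigma> \<le> monomial i u" unfolding \<sigma>_def by (rule monomial_ge_linear[OF u(1)])
  then have "u $ k * (1 - \<sigma>) \<le> monomial j u"
    unfolding ji monomial_add monomial_axis using cubeD(1)[OF u(1)] by (rule mult_left_mono)
  moreover have "0 < (1 - u $ k) * \<sigma>" using \<open>0 < \<sigma>\<close> u(2) by simp
  ultimately show ?thesis unfolding sj by (simp add: algebra_simps)
qed

context immigration_branching
begin

text \<open>The Jacobian of \<open>B\<close> at the corner, written as first moments instead of
  one-sided derivatives.\<close>

definition mean :: "real ^ 'n ^ 'n" where
  "mean = (\<chi> i l. \<Sum>\<^sub>\<infinity>j. b i j * real (j $ l))"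

lemma mean_has_sum: "((\<lambda>j. b i j * real (j $ l)) has_sum mean $ i $ l) UNIV"
  unfolding mean_def using b_first_moment by simp

lemma B_has_derivative_one:
  "(gen_fun (b i) has_derivative (\<lambda>h. \<Sum>l\<in>UNIV. h $ l * mean $ i $ l)) (at 1 within cube)"
  using gen_fun_has_derivative[OF b_summable[of i] b_first_moment[of i] one_in_cube]
  by (simp add: gen_partial_def mean_def)

lemma B_matrix_one: "B_matrix b (vec 1) = mean"
  unfolding B_matrix_def
  by (simp add: vec_eq_iff partial_deriv_eq[OF B_has_derivative_one one_in_cube])

lemma metzler_mean: "metzler mean"
  unfolding metzler_def
proof (intro allI impI)
  fix i l :: 'n assume "i \<noteq> l"
  then have "0 \<le> b i j * real (j $ l)" for j
    using b_nonneg[of j i] by (cases "j = axis i 1") (auto simp: axis_def)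
  then show "0 \<le> mean $ i $ l" using has_sum_nonneg[OF mean_has_sum] by blast
qed

lemma irreducible_mean:
  assumes "positively_regular (G_matrix b (vec 1))"
  shows "irreducible_matrix mean"
  unfolding irreducible_matrix_def
proof (intro allI impI)
  fix Z assume "\<forall>i\<in>Z. \<forall>l. l \<notin> Z \<longrightarrow> mean $ i $ l = 0"
  then have "\<forall>i\<in>Z. \<forall>l. l \<notin> Z \<longrightarrow> G_matrix b (vec 1) $ i $ l = 0"
    unfolding G_matrix_def B_matrix_one by auto
  then show "Z = {} \<or> Z = UNIV"
    using positively_regular_irreducible[OF assms] unfolding irreducible_matrix_def by blast
qed

text \<open>The deviation of \<open>B_k\<close> from its linearisation at \<open>1\<close>, as a
  function of \<open>1 - u\<close>.\<close>

definition remainder :: "'n \<Rightarrow> real ^ 'n \<Rightarrow> real" where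
  "remainder k u = gen_fun (b k) u + (\<Sum>l\<in>UNIV. mean $ k $ l * (1 - u $ l))"

lemma remainder_has_sum:
  assumes u: "u \<in> cube"
  shows "((\<lambda>j. b k j * (monomial j u - 1 + (\<Sum>l\<in>UNIV. real (j $ l) * (1 - u $ l)))) has_sum remainder k u) UNIV"
proof -
  have "((\<lambda>j. b k j * monomial j u - b k j + (\<Sum>l\<in>UNIV. b k j * real (j $ l) * (1 - u $ l)))
     has_sum (gen_fun (b k) u - 0 + (\<Sum>l\<in>UNIV. mean $ k $ l * (1 - u $ l)))) UNIV"
    by (intro has_sum_add has_sum_diff_real has_sum_sum has_sum_cmult_left gen_fun_has_sum b_summable
        b_has_sum mean_has_sum u) simp
  then show ?thesis by (simp add: remainder_def algebra_simps sum_distrib_left)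
qed

text \<open>At the one index whose coefficient is negative the bracket vanishes identically, the
  monomial being linear; elsewhere both factors are nonnegative.\<close>

lemma remainder_term_nonneg:
  assumes u: "u \<in> cube"
  shows "0 \<le> b k j * (monomial j u - 1 + (\<Sum>l\<in>UNIV. real (j $ l) * (1 - u $ l)))"
proof (cases "j = axis k 1")
  case True
  have "(\<Sum>l\<in>UNIV. real (axis k (1::nat) $ l) * (1 - u $ l)) = (\<Sum>l\<in>UNIV. if l = k then 1 - u $ k else 0)"
    by (rule sum.cong) (auto simp: axis_def)
  then have "monomial j u - 1 + (\<Sum>l\<in>UNIV. real (j $ l) * (1 - u $ l)) = 0" using True by simp
  then show ?thesis by simp
next
  case False
  then show ?thesis using b_nonneg[of j k] monomial_ge_linear[OF u, of j] by simp
qed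

lemma remainder_nonneg: "u \<in> cube \<Longrightarrow> 0 \<le> remainder k u"
  using has_sum_nonneg[OF remainder_has_sum] remainder_term_nonneg by blast

lemma sum_left_mean:
  assumes v: "v v* mean = r *\<^sub>R v"
  shows "(\<Sum>k\<in>UNIV. v $ k * (\<Sum>l\<in>UNIV. mean $ k $ l * x $ l)) = r * (\<Sum>k\<in>UNIV. v $ k * x $ k)"
proof -
  have "(\<Sum>k\<in>UNIV. v $ k * (\<Sum>l\<in>UNIV. mean $ k $ l * x $ l)) = v \<bullet> (mean *v x)"
    by (simp add: inner_vec_def matrix_vector_mult_def)
  also have "\<dots> = r * (v \<bullet> x)" using dot_lmul_matrix[of v mean x] v by simp
  finally show ?thesis by (simp add: inner_vec_def)
qed

text \<open>
  A second zero \<open>1 - x\<close> of \<open>B\<close> would make the nonlinear remainder vanish along \<open>x\<close>, forcing \<open>B\<close>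
  to be affine; but then \<open>B 0 \<noteq> 0\<close> contradicts \<open>B 1 = 0\<close> and the eigenvalue \<open>0\<close>.
\<close>
lemma zero_unique_if_rho_le:
  assumes reg: "positively_regular (G_matrix b (vec 1))" and B10: "0 < gen_fun (b i1) 0"
    and rho: "rho b (vec 1) \<le> 0" and u: "u \<in> cube" "B u = 0"
  shows "u = 1"
proof (rule ccontr)
  assume "u \<noteq> 1"
  have irr: "irreducible_matrix mean" by (rule irreducible_mean[OF reg])
  obtain v where v: "\<And>i. 0 < v $ i" "v v* mean = rho b (vec 1) *\<^sub>R v"
    using perron_left_vector[OF metzler_mean irr] unfolding rho_def B_matrix_one by blast
  define x where "x = 1 - u"
  have x0: "0 \<le> x $ k" for k using cubeD(2)[OF u(1)] by (simp add: x_def)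
  have Bk: "gen_fun (b k) u = 0" for k using u(2) by (metis B_nth zero_index)
  have rem: "remainder k u = (mean *v x) $ k" for k
    by (simp add: remainder_def Bk x_def matrix_vector_mult_def)
  have "x \<noteq> 0" using \<open>u \<noteq> 1\<close> by (simp add: x_def)
  then obtain k0 where "x $ k0 \<noteq> 0" by (auto simp: vec_eq_iff)
  then have vx: "0 < (\<Sum>k\<in>UNIV. v $ k * x $ k)"
    using v(1) x0 by (intro sum_pos2[of _ k0]) (auto simp: less_le intro!: mult_nonneg_nonneg less_imp_le[OF v(1)])
  \<comment> \<open>At a zero of \<open>B\<close> the remainder equals \<open>mean *v x\<close>, and
    the left eigenvector turns this into \<open>rho\<close> times a positive number. Nonnegativity
    of the left side then forces \<open>rho = 0\<close> and all remainders to vanish.\<close>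
  have eq: "(\<Sum>k\<in>UNIV. v $ k * remainder k u) = rho b (vec 1) * (\<Sum>k\<in>UNIV. v $ k * x $ k)"
    using sum_left_mean[OF v(2), of x] by (simp add: rem matrix_vector_mult_def)
  have ge: "0 \<le> v $ k * remainder k u" for k
    using remainder_nonneg[OF u(1), of k] v(1)[of k] by simp
  have "0 \<le> rho b (vec 1) * (\<Sum>k\<in>UNIV. v $ k * x $ k)" unfolding eq[symmetric] by (rule sum_nonneg[OF ge])
  then have rho0: "rho b (vec 1) = 0" using rho vx by (simp add: zero_le_mult_iff)
  then have "(\<Sum>k\<in>UNIV. v $ k * remainder k u) = 0" using eq by simp
  then have "v $ k * remainder k u = 0" for k using ge by (subst (asm) sum_nonneg_eq_0_iff) auto
  then have rem0: "remainder k u = 0" for k using v(1) by (metis less_irrefl mult_eq_0_iff)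
  then have "mean *v x = 0 *\<^sub>R x" using rem by (simp add: vec_eq_iff)
  then have "0 < x $ k" for k
    by (rule irreducible_null_vector_pos[OF metzler_mean irr x0 \<open>x \<noteq> 0\<close>])
  then have u1: "u $ k < 1" for k by (simp add: x_def)
  \<comment> \<open>With \<open>rho = 0\<close> the linear parts at the origin cancel against
    \<open>v\<close>, so \<open>B_1 (0) > 0\<close> makes some remainder at \<open>0\<close>
    nonzero.\<close>
  have "(\<Sum>k\<in>UNIV. v $ k * remainder k 0) = (\<Sum>k\<in>UNIV. v $ k * gen_fun (b k) 0)"
    using sum_left_mean[OF v(2), of 1] rho0
    by (simp add: remainder_def distrib_left sum.distrib)
  moreover have "0 < (\<Sum>k\<in>UNIV. v $ k * gen_fun (b k) 0)"
    using v(1) B10 by (intro sum_pos2[of _ i1]) (auto intro!: mult_nonneg_nonneg less_imp_le[OF v(1)] B_zero_nonneg)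
  ultimately have "(\<Sum>k\<in>UNIV. v $ k * remainder k 0) \<noteq> 0" by simp
  then obtain k where k: "remainder k 0 \<noteq> 0"
    by (cases "\<exists>k. remainder k 0 \<noteq> 0") auto
  obtain j where j: "b k j * (monomial j 0 - 1 + (\<Sum>l\<in>UNIV. real (j $ l) * (1 - (0 :: real ^ 'n) $ l))) \<noteq> 0"
  proof (rule ccontr)
    assume "\<not> thesis"
    then have "\<And>j. b k j * (monomial j 0 - 1 + (\<Sum>l\<in>UNIV. real (j $ l) * (1 - (0 :: real ^ 'n) $ l))) = 0"
      using that by blast
    then have eqn: "(\<lambda>j. b k j * (monomial j 0 - 1 + (\<Sum>l\<in>UNIV. real (j $ l) * (1 - (0 :: real ^ 'n) $ l)))) = (\<lambda>j. 0)"
      by (rule ext)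
    have "((\<lambda>j :: nat ^ 'n. 0) has_sum remainder k 0) UNIV"
      using remainder_has_sum[OF zero_in_cube, of k] unfolding eqn .
    then show False using k has_sum_unique[OF _ has_sum_0] by blast
  qed
  \<comment> \<open>At the origin the bracket is \<open>0\<close> for degrees zero and one, so a
    nonzero term has degree at least two.\<close>
  have j2: "2 \<le> (\<Sum>l\<in>UNIV. j $ l)"
  proof (rule ccontr)
    assume "\<not> ?thesis"
    moreover have "j = 0 \<longleftrightarrow> (\<Sum>l\<in>UNIV. j $ l) = 0" by (auto simp: vec_eq_iff)
    ultimately have "j = 0 \<or> j \<noteq> 0 \<and> (\<Sum>l\<in>UNIV. j $ l) = 1" by linarith
    then have "monomial j 0 - 1 + real (\<Sum>l\<in>UNIV. j $ l) = 0" by (auto simp: monomial_zero simp del: of_nat_sum)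
    then show False using j by simp
  qed
  have "b k j * (monomial j u - 1 + (\<Sum>l\<in>UNIV. real (j $ l) * (1 - u $ l))) \<le> remainder k u"
    using has_sum_nonneg_le[OF remainder_has_sum[OF u(1), of k], of "{j}"] remainder_term_nonneg[OF u(1)]
    by simp
  then have "b k j * (monomial j u - 1 + (\<Sum>l\<in>UNIV. real (j $ l) * (1 - u $ l))) = 0"
    unfolding rem0 using remainder_term_nonneg[OF u(1), of k j] by (rule order.antisym)
  moreover have "b k j \<noteq> 0" using j by auto
  ultimately show False using monomial_gt_linear[OF u(1) u1 j2] by simp
qed

lemma flow_zero_lt_1: "0 \<le> t \<Longrightarrow> flow 0 t $ k < 1"
proof -
  assume t: "0 \<le> t"
  have "0 < exp (- rate * t) * (1 - (0 :: real ^ 'n) $ k)" by simp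
  also have "\<dots> \<le> 1 - flow 0 t $ k" by (rule flow_le_1[OF zero_in_cube t])
  finally show ?thesis by simp
qed

lemma flow_zero_tendsto_one:
  assumes "positively_regular (G_matrix b (vec 1))" "0 < gen_fun (b i1) 0" "rho b (vec 1) \<le> 0"
  shows "(flow 0 \<longlongrightarrow> 1) at_top"
  using flow_zero_limit zero_unique_if_rho_le[OF assms] by metis

text \<open>For \<open>rho > 0\<close> the weighted distance \<open>y\<close> to the corner
  eventually does not decrease, its derivative being \<open>rho * y\<close> up to a smaller error.
  Being positive at all finite times, it cannot tend to \<open>0\<close>.\<close>

lemma rho_le_if_flow_tendsto_one:
  assumes reg: "positively_regular (G_matrix b (vec 1))" and lim: "(flow 0 \<longlongrightarrow> 1) at_top"
  shows "rho b (vec 1) \<le> 0"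
proof (rule ccontr)
  assume "\<not> ?thesis"
  then have \<rho>: "0 < rho b (vec 1)" by simp
  have irr: "irreducible_matrix mean" by (rule irreducible_mean[OF reg])
  obtain v where v: "\<And>i. 0 < v $ i" "v v* mean = rho b (vec 1) *\<^sub>R v"
    using perron_left_vector[OF metzler_mean irr] unfolding rho_def B_matrix_one by blast
  define vm where "vm = Min (range (\<lambda>k. v $ k))"
  have vm: "0 < vm" "\<And>k. vm \<le> v $ k" using v(1) by (auto simp: vm_def)
  define V where "V = (\<Sum>k\<in>UNIV. v $ k)"
  have V: "0 < V" unfolding V_def using v(1) by (intro sum_pos) auto
  \<comment> \<open>Summed over the coordinates, the linearisation error is at most
    \<open>V * e * norm (flow 0 t - 1)\<close>. This choice makes it
    \<open>rho * vm * norm (flow 0 t - 1)\<close>, which is at most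
    \<open>rho * y t\<close>.\<close>
  define e where "e = rho b (vec 1) * vm / V"
  have e: "0 < e" using \<rho> vm V by (simp add: e_def)
  define y where "y t = (\<Sum>k\<in>UNIV. v $ k * (1 - flow 0 t $ k))" for t
  have y_pos: "0 < y t" if "0 \<le> t" for t
    unfolding y_def using v(1) flow_zero_lt_1[OF that] by (intro sum_pos) auto
  have "\<exists>d>0. \<forall>u\<in>cube. norm (u - 1) < d \<longrightarrow> (\<forall>k. \<bar>gen_fun (b k) u - (\<Sum>l\<in>UNIV. (u - 1) $ l * mean $ k $ l)\<bar> \<le> e * norm (u - 1))"
  proof -
    have "\<exists>d>0. \<forall>u\<in>cube. norm (u - 1) < d \<longrightarrow> norm (gen_fun (b k) u - gen_fun (b k) 1 - (\<Sum>l\<in>UNIV. (u - 1) $ l * mean $ k $ l)) \<le> e * norm (u - 1)" for k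
      using B_has_derivative_one[of k] e unfolding has_derivative_within_alt by meson
    then have "\<forall>k. \<exists>d. d > 0 \<and> (\<forall>u\<in>cube. norm (u - 1) < d \<longrightarrow> norm (gen_fun (b k) u - gen_fun (b k) 1 - (\<Sum>l\<in>UNIV. (u - 1) $ l * mean $ k $ l)) \<le> e * norm (u - 1))"
      by (rule allI)
    from choice[OF this] obtain d where d: "\<forall>k. d k > 0 \<and> (\<forall>u\<in>cube. norm (u - 1) < d k \<longrightarrow> norm (gen_fun (b k) u - gen_fun (b k) 1 - (\<Sum>l\<in>UNIV. (u - 1) $ l * mean $ k $ l)) \<le> e * norm (u - 1))"
      by (rule exE)
    show ?thesis
    proof (intro exI[of _ "Min (range d)"] conjI ballI impI allI)
      show "0 < Min (range d)" using d by simp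
      fix u :: "real ^ 'n" and k :: 'n assume "u \<in> cube" "norm (u - 1) < Min (range d)"
      then show "\<bar>gen_fun (b k) u - (\<Sum>l\<in>UNIV. (u - 1) $ l * mean $ k $ l)\<bar> \<le> e * norm (u - 1)"
        using d by (simp add: gen_fun_b_one)
    qed
  qed
  then obtain d where d: "d > 0" "\<And>u k. u\<in>cube \<Longrightarrow> norm (u - 1) < d \<Longrightarrow> \<bar>gen_fun (b k) u - (\<Sum>l\<in>UNIV. (u - 1) $ l * mean $ k $ l)\<bar> \<le> e * norm (u - 1)"
    by blast
  obtain T where T: "\<And>t. t \<ge> T \<Longrightarrow> norm (flow 0 t - 1) < d"
    using tendstoD[OF lim d(1)] by (auto simp: eventually_at_top_linorder dist_norm)
  define T0 where "T0 = max T 0"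
  have T0: "0 \<le> T0" "\<And>t. t \<ge> T0 \<Longrightarrow> norm (flow 0 t - 1) < d" using T by (auto simp: T0_def)
  have y': "(y has_real_derivative - (\<Sum>k\<in>UNIV. v $ k * gen_fun (b k) (flow 0 t))) (at t within {0..})" if "0 \<le> t" for t
  proof -
    have "((\<lambda>t. flow 0 t $ k) has_real_derivative gen_fun (b k) (flow 0 t)) (at t within {0..})" for k
      using bounded_linear.has_vector_derivative[OF bounded_linear_vec_nth flow_deriv[OF zero_in_cube that], of k]
      by (simp add: has_real_derivative_iff_has_vector_derivative)
    then have "(y has_real_derivative (\<Sum>k\<in>UNIV. v $ k * (0 - gen_fun (b k) (flow 0 t)))) (at t within {0..})"
      unfolding y_def[abs_def] by (intro DERIV_sum DERIV_cmult DERIV_diff DERIV_const)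
    then show ?thesis by (simp add: sum_negf)
  qed
  have y'_nonneg: "0 \<le> - (\<Sum>k\<in>UNIV. v $ k * gen_fun (b k) (flow 0 t))" if t: "T0 \<le> t" for t
  proof -
    let ?F = "flow 0 t"
    have F: "?F \<in> cube" using T0 t by (intro flow_in_cube) auto
    have "norm (?F - 1) \<le> (\<Sum>k\<in>UNIV. \<bar>(?F - 1) $ k\<bar>)" by (rule norm_le_l1_cart)
    also have "\<dots> = (\<Sum>k\<in>UNIV. 1 - ?F $ k)" using cubeD[OF F] by simp
    finally have "vm * norm (?F - 1) \<le> (\<Sum>k\<in>UNIV. vm * (1 - ?F $ k))"
      using vm by (simp add: sum_distrib_left[symmetric])
    also have "\<dots> \<le> y t"
      unfolding y_def using vm(2) cubeD(2)[OF F] by (intro sum_mono mult_right_mono) auto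
    finally have n: "vm * norm (?F - 1) \<le> y t" .
    have "v $ k * gen_fun (b k) ?F \<le> v $ k * (- (\<Sum>l\<in>UNIV. mean $ k $ l * (1 - ?F) $ l) + e * norm (?F - 1))" for k
    proof (rule mult_left_mono)
      have "(\<Sum>l\<in>UNIV. (?F - 1) $ l * mean $ k $ l) = - (\<Sum>l\<in>UNIV. mean $ k $ l * (1 - ?F) $ l)"
        unfolding sum_negf[symmetric] by (rule sum.cong) (auto simp: algebra_simps)
      then show "gen_fun (b k) ?F \<le> - (\<Sum>l\<in>UNIV. mean $ k $ l * (1 - ?F) $ l) + e * norm (?F - 1)"
        using d(2)[OF F T0(2)[OF t], of k] by linarith
    qed (use v(1) less_imp_le in auto)
    moreover have split: "(\<Sum>k\<in>UNIV. v $ k * (- S k + c)) = - (\<Sum>k\<in>UNIV. v $ k * S k) + V * c"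
      for S :: "'n \<Rightarrow> real" and c
      by (simp add: right_diff_distrib sum_subtractf V_def sum_distrib_right)
    ultimately have "(\<Sum>k\<in>UNIV. v $ k * gen_fun (b k) ?F)
      \<le> (\<Sum>k\<in>UNIV. v $ k * (- (\<Sum>l\<in>UNIV. mean $ k $ l * (1 - ?F) $ l) + e * norm (?F - 1)))"
      by (intro sum_mono)
    also have "\<dots> = - (\<Sum>k\<in>UNIV. v $ k * (\<Sum>l\<in>UNIV. mean $ k $ l * (1 - ?F) $ l)) + V * (e * norm (?F - 1))"
      by (rule split)
    also have "\<dots> = - rho b (vec 1) * y t + rho b (vec 1) * (vm * norm (?F - 1))"
      using V unfolding sum_left_mean[OF v(2)] by (simp add: y_def e_def)
    also have "\<dots> \<le> - rho b (vec 1) * y t + rho b (vec 1) * y t"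
      using n \<rho> by (intro add_left_mono mult_left_mono) auto
    finally show ?thesis by simp
  qed
  have "y T0 \<le> y t" if t: "T0 \<le> t" for t
  proof (rule DERIV_nonneg_imp_increasing_open[OF t])
    show "continuous_on {T0..t} y"
      by (rule DERIV_continuous_on[OF DERIV_subset[OF y']]) (use T0 in auto)
    fix s assume s: "T0 < s" "s < t"
    have "at s within {0..} = at s" using s T0 by (intro at_within_interior) auto
    then show "\<exists>d. (y has_real_derivative d) (at s) \<and> 0 \<le> d"
      using y'[of s] y'_nonneg[of s] s T0 by auto
  qed
  moreover have "(y \<longlongrightarrow> (\<Sum>k\<in>UNIV. v $ k * (1 - (1 :: real ^ 'n) $ k))) at_top"
    unfolding y_def by (intro tendsto_intros lim)
  ultimately have "y T0 \<le> 0"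
    by (intro tendsto_lowerbound[of y 0 at_top "y T0"]) (auto simp: eventually_at_top_linorder)
  then show False using y_pos[OF T0(1)] by simp
qed

text \<open>The trajectory stays below its limit \<open>u\<close>, so \<open>A u < 0\<close> would
  give the factor an exponential upper bound in \<open>t\<close>.\<close>

lemma factor_tendsto_imp:
  assumes "\<And>t. 0 \<le> t \<Longrightarrow> \<delta> \<le> immigration_factor 0 t" "0 < \<delta>" and lim: "(flow 0 \<longlongrightarrow> u) at_top" and u: "u \<in> cube"
  shows "A u = 0"
proof (rule ccontr)
  assume "A u \<noteq> 0"
  then have Au: "A u < 0" using A_nonpos[OF u] by simp
  have le: "flow 0 s \<le> u" if "0 \<le> s" for s
    unfolding less_eq_vec_def
  proof
    fix k
    show "flow 0 s $ k \<le> u $ k"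
      by (rule tendsto_lowerbound[OF tendsto_vec_nth[OF lim]])
         (use flow_zero_mono[OF that] in \<open>auto simp: eventually_at_top_linorder less_eq_vec_def intro!: exI[of _ s]\<close>)
  qed
  have "ln \<delta> \<le> t * A u" if t: "0 \<le> t" for t
  proof -
    have "ln \<delta> \<le> ln (immigration_factor 0 t)" using assms(1)[OF t] assms(2) by simp
    also have "\<dots> = integral {0..t} (\<lambda>s. A (flow 0 s))" by (simp add: immigration_factor_def)
    also have "\<dots> \<le> integral {0..t} (\<lambda>s. A u)"
      by (intro integral_le A_flow_integrable) (auto intro!: A_mono flow_in_cube le u)
    finally show ?thesis using t by simp
  qed
  note bound = this
  have "ln \<delta> \<le> 0" using bound[of 0] by simp
  \<comment> \<open>At this time the bound reads
    \<open>ln \<delta> <= ln \<delta> - 1\<close>.\<close>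
  then have "0 \<le> (ln \<delta> - 1) / A u" using Au by (intro divide_nonpos_neg) auto
  from bound[OF this] show False using Au by simp
qed

text \<open>Let \<open>Z\<close> be the set of coordinates where \<open>u\<close> equals
  \<open>1\<close>. \<open>A u = 0\<close> forces every immigrating group to consist of types in
  \<open>Z\<close>, so \<open>Z\<close> is nonempty; \<open>B u = 0\<close> forces parents of type
  in \<open>Z\<close> to have offspring in \<open>Z\<close> only, so \<open>Z\<close> is closed for
  \<open>mean\<close>.\<close>

lemma zero_eq_one_if_A_zero:
  assumes reg: "positively_regular (G_matrix b (vec 1))" and u: "u \<in> cube" and Bu: "B u = 0" and Au: "A u = 0"
  shows "u = 1"
proof -
  have irr: "irreducible_matrix mean" by (rule irreducible_mean[OF reg])
  define Z where "Z = {k. u $ k = 1}"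
  have Bk: "gen_fun (b k) u = 0" for k using Bu by (metis B_nth zero_index)
  have "\<exists>k. k \<in> Z"
  proof -
    have "\<exists>j. j \<noteq> 0 \<and> a j \<noteq> 0"
    proof (rule ccontr)
      assume "\<not> ?thesis"
      then have "(a has_sum 0) (- {0})" by (intro has_sum_0) auto
      then show False using a_sum a_pos has_sum_unique by fastforce
    qed
    then obtain j where j: "j \<noteq> 0" "a j \<noteq> 0" by blast
    have hs: "((\<lambda>j. a j - a j * monomial j u) has_sum (0 - A u)) UNIV"
      by (intro has_sum_diff_real a_has_sum gen_fun_has_sum a_summable u)
    have nn: "0 \<le> a j - a j * monomial j u" for j
      using a_nonneg[of j] monomial_le_1[OF u, of j] by (cases "j = 0") (auto simp: mult_left_le)
    have "a j - a j * monomial j u \<le> 0"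
      using has_sum_nonneg_le[OF hs, of "{j}"] nn Au by simp
    then have "a j * (1 - monomial j u) = 0" using nn[of j] by (simp add: algebra_simps)
    then have m1: "monomial j u = 1" using j by simp
    obtain k where "j $ k \<noteq> 0" using j by (auto simp: vec_eq_iff)
    then have "1 \<le> u $ k" using monomial_le_component[OF u, of j k] m1 by simp
    then show ?thesis using cubeD(2)[OF u, of k] by (auto simp: Z_def)
  qed
  moreover have "mean $ i $ l = 0" if i: "i \<in> Z" and l: "l \<notin> Z" for i l
  proof -
    have hs: "((\<lambda>j. b i j - b i j * monomial j u) has_sum (0 - gen_fun (b i) u)) UNIV"
      by (intro has_sum_diff_real b_has_sum gen_fun_has_sum b_summable u)
    \<comment> \<open>For the negative coefficient, \<open>j = axis i 1\<close>, the term vanishes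
      because \<open>u $ i = 1\<close>.\<close>
    have nn: "0 \<le> b i j - b i j * monomial j u" for j
      using b_nonneg[of j i] monomial_le_1[OF u, of j] i
      by (cases "j = axis i 1") (auto simp: mult_left_le Z_def)
    have "b i j * real (j $ l) = 0" for j
    proof (rule ccontr)
      assume "b i j * real (j $ l) \<noteq> 0"
      then have j: "b i j \<noteq> 0" "0 < j $ l" by auto
      have "b i j - b i j * monomial j u \<le> 0"
        using has_sum_nonneg_le[OF hs, of "{j}"] nn Bk[of i] by simp
      then have "b i j * (1 - monomial j u) = 0" using nn[of j] by (simp add: algebra_simps)
      then have "1 \<le> u $ l" using monomial_le_component[OF u j(2)] j(1) by simp
      then show False using l cubeD(2)[OF u, of l] by (simp add: Z_def)
    qed
    then have eqn: "(\<lambda>j. b i j * real (j $ l)) = (\<lambda>j. 0)" by (rule ext)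
    have "((\<lambda>j :: nat ^ 'n. 0) has_sum mean $ i $ l) UNIV" using mean_has_sum[of i l] unfolding eqn .
    then show ?thesis using has_sum_unique[OF _ has_sum_0] by blast
  qed
  ultimately have "Z = UNIV" using irr unfolding irreducible_matrix_def by blast
  then show ?thesis by (auto simp: Z_def vec_eq_iff)
qed

end

section \<open>Limits and uniqueness of generating functions\<close>

lemma exists_upper_lt_1:
  fixes u :: "real ^ 'n::finite"
  assumes "\<And>k. u $ k < 1"
  obtains r where "0 < r" "r < 1" "\<And>k. u $ k < r"
proof -
  define \<mu> where "\<mu> = Max (insert 0 (range (\<lambda>k. u $ k)))"
  have fin: "finite (insert 0 (range (\<lambda>k. u $ k)))" by simp
  have "\<mu> < 1" unfolding \<mu>_def using assms by (subst Max_less_iff[OF fin]) auto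
  then have \<mu>: "0 \<le> \<mu>" "\<And>k. u $ k \<le> \<mu>" "\<mu> < 1"
    unfolding \<mu>_def using Max_ge[OF fin] by blast+
  show ?thesis
  proof (rule that[of "(\<mu> + 1) / 2"])
    show "u $ k < (\<mu> + 1) / 2" for k by (rule le_less_trans[OF \<mu>(2)]) (use \<mu>(3) in simp)
  qed (use \<mu> in simp_all)
qed

lemma power_times_bounded:
  fixes r :: real
  assumes "0 < r" "r < 1"
  obtains C where "0 < C" "\<And>n. real n * r ^ n \<le> C"
proof -
  have "(\<lambda>n. real n * r ^ n) \<longlonglongrightarrow> 0" using assms by (intro powser_times_n_limit_0) auto
  then have "Bseq (\<lambda>n. real n * r ^ n)" by (rule convergent_imp_Bseq[OF convergentI])
  then obtain K where "0 < K" "\<And>n. norm (real n * r ^ n) \<le> K" by (auto elim: BseqE)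
  then show ?thesis using that[of K] by (metis abs_le_D1 real_norm_def)
qed

lemma monomial_scaleR: "monomial j (c *\<^sub>R u) = c ^ (\<Sum>k\<in>UNIV. j $ k) * monomial j u"
  by (simp add: monomial_def power_mult_distrib prod.distrib power_sum)

text \<open>Rescaling by \<open>r\<close> strictly between the coordinates of \<open>u\<close> and
  \<open>1\<close> replaces \<open>m j\<close> by \<open>m j * r\<close> to the degree. These
  coefficients have finite first moments even if \<open>m\<close> has none.\<close>

lemma gen_fun_has_derivative_interior:
  fixes m :: "nat ^ 'n::finite \<Rightarrow> real"
  assumes m: "m summable_on UNIV" and u: "u \<in> cube" "\<And>k. u $ k < 1"
  shows "\<exists>D. (gen_fun m has_derivative (\<lambda>h. \<Sum>k\<in>UNIV. h $ k * D k)) (at u within cube)"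
proof -
  obtain r where r: "0 < r" "r < 1" "\<And>k. u $ k < r" using exists_upper_lt_1[OF u(2)] by blast
  obtain C where C: "0 < C" "\<And>n. real n * r ^ n \<le> C" using power_times_bounded[OF r(1,2)] by blast
  define c where "c j = m j * r ^ (\<Sum>k\<in>UNIV. j $ k)" for j
  define below where "below = {v :: real ^ 'n. \<forall>k. v $ k < r}"
  have c_sum: "c summable_on UNIV"
    unfolding c_def using r by (intro abs_summable_times_bounded m) (auto simp: power_abs intro!: power_le_one)
  have ck_sum: "(\<lambda>j. c j * real (j $ k)) summable_on UNIV" for k
  proof -
    have "(\<lambda>j. m j * (r ^ (\<Sum>k\<in>UNIV. j $ k) * real (j $ k) / C)) summable_on UNIV"
    proof (rule abs_summable_times_bounded[OF m])
      fix j :: "nat ^ 'n"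
      have "j $ k \<le> (\<Sum>k\<in>UNIV. j $ k)" by (rule member_le_sum) auto
      then have "real (j $ k) * r ^ (\<Sum>k\<in>UNIV. j $ k) \<le> real (\<Sum>k\<in>UNIV. j $ k) * r ^ (\<Sum>k\<in>UNIV. j $ k)"
        using r by (intro mult_right_mono) (auto simp del: of_nat_sum)
      also have "\<dots> \<le> C" by (rule C)
      finally show "\<bar>r ^ (\<Sum>k\<in>UNIV. j $ k) * real (j $ k) / C\<bar> \<le> 1"
        using C(1) r by (simp add: mult.commute)
    qed
    then have "(\<lambda>j. m j * (r ^ (\<Sum>k\<in>UNIV. j $ k) * real (j $ k) / C) * C) summable_on UNIV"
      by (rule summable_on_cmult_left)
    then show ?thesis using C(1) by (simp add: c_def mult.assoc)
  qed
  have eq: "gen_fun m v = gen_fun c ((1 / r) *\<^sub>R v)" for v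
  proof -
    have "m j * monomial j v = c j * monomial j ((1 / r) *\<^sub>R v)" for j
      unfolding c_def monomial_scaleR using r(1) by (simp add: power_one_over)
    then show ?thesis by (simp add: gen_fun_eq)
  qed
  have sub: "(\<lambda>v. (1 / r) *\<^sub>R v) ` (cube \<inter> below) \<subseteq> cube"
    using r(1) by (auto simp: cube_def below_def field_simps less_imp_le)
  have uO: "u \<in> cube \<inter> below" using u r by (simp add: below_def)
  have "(gen_fun c has_derivative (\<lambda>h. \<Sum>k\<in>UNIV. h $ k * gen_partial c k ((1 / r) *\<^sub>R u))) (at ((1 / r) *\<^sub>R u) within (\<lambda>v. (1 / r) *\<^sub>R v) ` (cube \<inter> below))"
    by (rule has_derivative_subset[OF gen_fun_has_derivative[OF c_sum ck_sum] sub]) (use sub uO in auto)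
  moreover have "((\<lambda>v. (1 / r) *\<^sub>R v) has_derivative (\<lambda>h. (1 / r) *\<^sub>R h)) (at u within cube \<inter> below)"
    by (intro derivative_intros)
  ultimately have "(gen_fun m has_derivative (\<lambda>h. \<Sum>k\<in>UNIV. ((1 / r) *\<^sub>R h) $ k * gen_partial c k ((1 / r) *\<^sub>R u))) (at u within cube \<inter> below)"
    unfolding eq[abs_def] by (rule has_derivative_in_compose[rotated])
  moreover have "at u within cube \<inter> below = at u within cube"
  proof (rule at_within_nhd[of u below])
    have "below = (\<Inter>k. {v. v $ k < r})" by (auto simp: below_def)
    moreover have "open {v :: real ^ 'n. v $ k < r}" for k
      by (rule open_Collect_less) (intro continuous_intros)+
    ultimately show "open below" by auto
  qed (use uO in auto)
  ultimately have "(gen_fun m has_derivative (\<lambda>h. \<Sum>k\<in>UNIV. h $ k * (gen_partial c k ((1 / r) *\<^sub>R u) / r))) (at u within cube)"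
    by simp
  then show ?thesis by (intro exI[of _ "\<lambda>k. gen_partial c k ((1 / r) *\<^sub>R u) / r"])
qed

text \<open>Mass may escape to infinity in a coefficientwise limit, hence only
  \<open>infsum m UNIV <= 1\<close>. Below the corner escaping mass is invisible: terms of degree at
  least \<open>N\<close> contribute at most \<open>r ^ N\<close>, uniformly in
  \<open>n\<close>.\<close>

lemma gen_fun_tendsto:
  fixes P :: "nat \<Rightarrow> nat ^ 'n::finite \<Rightarrow> real"
  assumes P: "\<And>n j. 0 \<le> P n j" "\<And>n. (P n has_sum 1) UNIV" and lim: "\<And>j. (\<lambda>n. P n j) \<longlonglongrightarrow> m j"
    and u: "u \<in> cube" "\<And>k. u $ k < 1"
  shows "m summable_on UNIV" "infsum m UNIV \<le> 1" "(\<lambda>n. gen_fun (P n) u) \<longlonglongrightarrow> gen_fun m u"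
proof -
  have m0: "0 \<le> m j" for j using LIMSEQ_le_const[OF lim] P(1) by blast
  have fin: "sum m F \<le> 1" if "finite F" for F
  proof (rule LIMSEQ_le_const2)
    show "(\<lambda>n. sum (P n) F) \<longlonglongrightarrow> sum m F" by (intro tendsto_sum lim)
    show "\<exists>N. \<forall>n\<ge>N. sum (P n) F \<le> 1"
      using has_sum_mono2[OF has_sum_finite[OF that] P(2)] P(1) by auto
  qed
  show ms: "m summable_on UNIV"
    by (rule nonneg_bdd_above_summable_on) (use m0 fin in \<open>auto intro!: bdd_aboveI2\<close>)
  show m1: "infsum m UNIV \<le> 1" by (rule infsum_le_finite_sums[OF ms]) (use fin in auto)
  obtain r where r: "0 < r" "r < 1" "\<And>k. u $ k < r" using exists_upper_lt_1[OF u(2)] by blast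
  have tail: "\<bar>gen_fun c u - (\<Sum>j | (\<Sum>k\<in>UNIV. j $ k) < N. c j * monomial j u)\<bar> \<le> r ^ N"
    if c: "\<And>j. 0 \<le> c j" "c summable_on UNIV" "infsum c UNIV \<le> 1" for c N
  proof -
    let ?F = "{j :: nat ^ 'n. (\<Sum>k\<in>UNIV. j $ k) < N}"
    have "((\<lambda>j. c j * monomial j u) has_sum (gen_fun c u - (\<Sum>j\<in>?F. c j * monomial j u))) (UNIV - ?F)"
      by (intro has_sum_Diff gen_fun_has_sum c u has_sum_finite finite_bounded_degree) auto
    moreover have "(c has_sum infsum c (UNIV - ?F)) (UNIV - ?F)"
      using summable_on_subset_banach[OF c(2), of "UNIV - ?F"] by simp
    then have "((\<lambda>j. c j * r ^ N) has_sum infsum c (UNIV - ?F) * r ^ N) (UNIV - ?F)"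
      by (rule has_sum_cmult_left)
    moreover have "c j * monomial j u \<le> c j * r ^ N" if "j \<in> UNIV - ?F" for j
    proof (rule mult_left_mono[OF _ c(1)])
      have "monomial j u \<le> r ^ (\<Sum>k\<in>UNIV. j $ k)" using u r by (intro monomial_le_power) (auto intro: less_imp_le)
      also have "\<dots> \<le> r ^ N" using that r by (intro power_decreasing) auto
      finally show "monomial j u \<le> r ^ N" .
    qed
    ultimately have "gen_fun c u - (\<Sum>j\<in>?F. c j * monomial j u) \<le> infsum c (UNIV - ?F) * r ^ N"
      by (rule has_sum_mono)
    also have "\<dots> \<le> 1 * r ^ N"
    proof (rule mult_right_mono)
      have "infsum c (UNIV - ?F) \<le> infsum c UNIV"
        by (rule infsum_mono2) (use c summable_on_subset_banach[OF c(2)] in auto)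
      then show "infsum c (UNIV - ?F) \<le> 1" using c(3) by simp
    qed (use r in auto)
    finally have up: "gen_fun c u - (\<Sum>j\<in>?F. c j * monomial j u) \<le> r ^ N" by simp
    have "(\<Sum>j\<in>?F. c j * monomial j u) \<le> gen_fun c u"
      by (rule has_sum_mono2[OF has_sum_finite[OF finite_bounded_degree] gen_fun_has_sum[OF c(2) u(1)]])
         (use c monomial_nonneg[OF u(1)] in auto)
    with up show ?thesis by simp
  qed
  show "(\<lambda>n. gen_fun (P n) u) \<longlonglongrightarrow> gen_fun m u"
  proof (rule LIMSEQ_I)
    fix e :: real assume e: "0 < e"
    obtain N where N: "r ^ N < e / 3" using real_arch_pow_inv[of "e / 3" r] r e by auto
    let ?F = "{j :: nat ^ 'n. (\<Sum>k\<in>UNIV. j $ k) < N}"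
    have "(\<lambda>n. \<Sum>j\<in>?F. P n j * monomial j u) \<longlonglongrightarrow> (\<Sum>j\<in>?F. m j * monomial j u)"
      by (intro tendsto_sum tendsto_mult_right lim)
    from LIMSEQ_D[OF this, of "e / 3"] e obtain n0 where
      n0: "\<And>n. n \<ge> n0 \<Longrightarrow> norm ((\<Sum>j\<in>?F. P n j * monomial j u) - (\<Sum>j\<in>?F. m j * monomial j u)) < e / 3" by auto
    show "\<exists>n0. \<forall>n\<ge>n0. norm (gen_fun (P n) u - gen_fun m u) < e"
    proof (intro exI allI impI)
      fix n assume "n \<ge> n0"
      have "P n summable_on UNIV" "infsum (P n) UNIV = 1" using P(2)[of n] by (auto simp: has_sum_iff)
      then have "\<bar>gen_fun (P n) u - (\<Sum>j\<in>?F. P n j * monomial j u)\<bar> \<le> r ^ N" using P(1) by (intro tail) auto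
      moreover have "\<bar>gen_fun m u - (\<Sum>j\<in>?F. m j * monomial j u)\<bar> \<le> r ^ N" by (rule tail[OF m0 ms m1])
      ultimately show "norm (gen_fun (P n) u - gen_fun m u) < e" using n0[OF \<open>n \<ge> n0\<close>] N
        unfolding real_norm_def by linarith
    qed
  qed
qed

text \<open>Divide by the power belonging to the lowest nonzero coefficient and let \<open>x\<close>
  decrease to \<open>0\<close>; values at nonnegative arguments suffice.\<close>

lemma power_series_zero_imp:
  fixes d :: "nat \<Rightarrow> real"
  assumes "\<And>x. 0 \<le> x \<Longrightarrow> x < 1 \<Longrightarrow> ((\<lambda>n. d n * x ^ n) has_sum 0) UNIV"
  shows "d n = 0"
proof (rule ccontr)
  assume "d n \<noteq> 0"
  have sums: "(\<lambda>n. d n * x ^ n) sums 0" if "0 \<le> x" "x < 1" for x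
    by (rule has_sum_imp_sums[OF assms[OF that]])
  define f where "f x = suminf (\<lambda>n. d n * x ^ n)" for x
  have smm: "summable (\<lambda>n. d n * (1/2) ^ n)" using sums[of "1/2"] by (simp add: sums_iff)
  have fs: "(\<lambda>n. d n * x ^ n) sums f x" if "norm x < 1/2" for x
    unfolding f_def by (rule summable_sums[OF powser_inside[OF smm]]) (use that in simp)
  obtain N where N: "d N \<noteq> 0" "\<And>i. i < N \<Longrightarrow> d i = 0"
    using \<open>d n \<noteq> 0\<close> exists_least_iff[of "\<lambda>n. d n \<noteq> 0"] by blast
  define g where "g x = suminf (\<lambda>n. d (n + N) * x ^ n)" for x
  have smg: "summable (\<lambda>n. d (n + N) * (1/2) ^ n)"
  proof -
    have "summable (\<lambda>n. d (n + N) * (1/2) ^ (n + N))" using smm by (rule summable_ignore_initial_segment)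
    then have "summable (\<lambda>n. d (n + N) * (1/2) ^ (n + N) * 2 ^ N)" by (rule summable_mult2)
    then show ?thesis by (simp add: power_add mult.assoc power_one_over)
  qed
  have "isCont g 0" unfolding g_def by (rule isCont_powser[OF smg]) simp
  then have "(g \<longlongrightarrow> g 0) (at_right 0)" by (simp add: isCont_def filterlim_at_split)
  moreover have "g 0 = d N" by (simp add: g_def powser_zero)
  moreover have "\<forall>\<^sub>F x in at_right 0. g x = 0"
    unfolding eventually_at_right_field
  proof (intro exI[of _ "1/2"] conjI allI impI)
    fix x :: real assume x: "0 < x" "x < 1/2"
    have "(\<lambda>n. d n * x ^ n) sums 0" using sums[of x] x by simp
    then have "(\<lambda>n. d (n + N) * x ^ (n + N)) sums 0"
      using sums_iff_shift[of "\<lambda>n. d n * x ^ n" N 0] N(2) by simp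
    then have "(\<lambda>n. d (n + N) * x ^ (n + N) / x ^ N) sums (0 / x ^ N)" by (rule sums_divide)
    then have "(\<lambda>n. d (n + N) * x ^ n) sums 0" using x by (simp add: power_add)
    then show "g x = 0" by (simp add: g_def sums_iff)
  qed simp
  ultimately have "((\<lambda>x::real. 0::real) \<longlongrightarrow> d N) (at_right 0)"
    using Lim_transform_eventually by force
  then have "d N = 0" using tendsto_unique[OF _ _ tendsto_const] trivial_limit_at_right_real by blast
  then show False using N by simp
qed

text \<open>Several variables are reduced to one: coordinates enter \<open>S\<close> one at a time,
  and each step freezes the exponent of the new coordinate \<open>l\<close> by one-variable
  uniqueness in \<open>u $ l\<close>.\<close>

lemma partial_series_zero:
  fixes c :: "nat ^ 'n::finite \<Rightarrow> real"
  assumes c: "c summable_on UNIV" and zero: "\<And>u. u \<in> cube \<Longrightarrow> (\<And>k. u $ k < 1) \<Longrightarrow> gen_fun c u = 0"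
    and S: "finite S" and u: "u \<in> cube" "\<And>k. u $ k < 1"
  shows "((\<lambda>j. c j * (\<Prod>k\<in>-S. u $ k ^ (j $ k))) has_sum 0) {j. \<forall>k\<in>S. j $ k = i $ k}"
  using S u
proof (induction S arbitrary: u rule: finite_induct)
  case empty
  then show ?case using gen_fun_has_sum[OF c, of u] zero[of u] by (simp add: monomial_def)
next
  case (insert l S)
  let ?T = "{j. \<forall>k\<in>S. j $ k = i $ k}"
  define d where "d n = (\<Sum>\<^sub>\<infinity>j | j \<in> ?T \<and> j $ l = n. c j * (\<Prod>k\<in>-insert l S. u $ k ^ (j $ k)))" for n
  have summ: "(\<lambda>j. c j * (\<Prod>k\<in>-insert l S. u $ k ^ (j $ k))) summable_on X" for X
  proof -
    have "\<bar>\<Prod>k\<in>-insert l S. u $ k ^ (j $ k)\<bar> \<le> 1" for j :: "nat ^ 'n"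
      unfolding abs_prod using cubeD[OF insert.prems(1)] by (intro prod_le_1) (auto simp: power_abs intro!: power_le_one)
    from abs_summable_times_bounded[OF c this] show ?thesis
      by (rule summable_on_subset_banach) simp
  qed
  have dz: "d n = 0" for n
  proof (rule power_series_zero_imp)
    fix x :: real assume x: "0 \<le> x" "x < 1"
    define v where "v = (\<chi> k. if k = l then x else u $ k)"
    have v: "v \<in> cube" "\<And>k. v $ k < 1" using x insert.prems by (auto simp: v_def cube_def)
    have split: "(\<Prod>k\<in>-S. v $ k ^ (j $ k)) = x ^ (j $ l) * (\<Prod>k\<in>-insert l S. u $ k ^ (j $ k))" for j :: "nat ^ 'n"
    proof -
      have "(\<Prod>k\<in>-S. v $ k ^ (j $ k)) = v $ l ^ (j $ l) * (\<Prod>k\<in>-S - {l}. v $ k ^ (j $ k))"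
        using insert.hyps by (intro prod.remove) auto
      also have "- S - {l} = - insert l S" by auto
      also have "(\<Prod>k\<in>-insert l S. v $ k ^ (j $ k)) = (\<Prod>k\<in>-insert l S. u $ k ^ (j $ k))"
        by (rule prod.cong) (auto simp: v_def)
      finally show ?thesis by (simp add: v_def)
    qed
    have hs: "((\<lambda>j. c j * (x ^ (j $ l) * (\<Prod>k\<in>-insert l S. u $ k ^ (j $ k)))) has_sum 0) ?T"
      using insert.IH[OF v] by (simp add: split)
    \<comment> \<open>The multi-indices are regrouped by their exponent \<open>n\<close> at
      \<open>l\<close>, which exhibits the sum as a power series in \<open>x\<close> with
      coefficients \<open>d n\<close>.\<close>
    have bij: "bij_betw snd (SIGMA n:UNIV. {j. j \<in> ?T \<and> j $ l = n}) ?T"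
      by (rule bij_betwI[of _ _ _ "\<lambda>j. (j $ l, j)"]) auto
    have hs2: "((\<lambda>(n, j). c j * (x ^ (j $ l) * (\<Prod>k\<in>-insert l S. u $ k ^ (j $ k)))) has_sum 0)
       (SIGMA n:UNIV. {j. j \<in> ?T \<and> j $ l = n})"
      using has_sum_reindex_bij_betw[OF bij, of "\<lambda>j. c j * (x ^ (j $ l) * (\<Prod>k\<in>-insert l S. u $ k ^ (j $ k)))" 0] hs
      by (simp add: case_prod_beta')
    show "((\<lambda>n. d n * x ^ n) has_sum 0) UNIV"
    proof (rule has_sum_SigmaD[OF hs2])
      fix n
      have "((\<lambda>j. c j * (\<Prod>k\<in>-insert l S. u $ k ^ (j $ k)) * x ^ n) has_sum d n * x ^ n) {j. j \<in> ?T \<and> j $ l = n}"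
        unfolding d_def by (intro has_sum_cmult_left has_sum_infsum summ)
      also have "?this \<longleftrightarrow> ((\<lambda>j. c j * (x ^ (j $ l) * (\<Prod>k\<in>-insert l S. u $ k ^ (j $ k)))) has_sum d n * x ^ n)
          {j. j \<in> ?T \<and> j $ l = n}"
        by (rule has_sum_cong) auto
      finally show "((\<lambda>y. case (n, y) of (n, j) \<Rightarrow> c j * (x ^ (j $ l) * (\<Prod>k\<in>-insert l S. u $ k ^ (j $ k))))
          has_sum d n * x ^ n) {j. j \<in> ?T \<and> j $ l = n}" by simp
    qed
  qed
  have eqs: "{j. j \<in> ?T \<and> j $ l = i $ l} = {j. \<forall>k\<in>insert l S. j $ k = i $ k}" by auto
  have "((\<lambda>j. c j * (\<Prod>k\<in>-insert l S. u $ k ^ (j $ k))) has_sum d (i $ l)) {j. j \<in> ?T \<and> j $ l = i $ l}"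
    unfolding d_def by (rule has_sum_infsum[OF summ])
  then show ?case unfolding dz eqs .
qed

lemma gen_fun_coefficients_zero:
  fixes c :: "nat ^ 'n::finite \<Rightarrow> real"
  assumes "c summable_on UNIV" "\<And>u. u \<in> cube \<Longrightarrow> (\<And>k. u $ k < 1) \<Longrightarrow> gen_fun c u = 0"
  shows "c i = 0"
proof -
  have "((\<lambda>j. c j * (\<Prod>k\<in>-UNIV. (0 :: real ^ 'n) $ k ^ (j $ k))) has_sum 0) {j. \<forall>k\<in>UNIV. j $ k = i $ k}"
    by (rule partial_series_zero[OF assms]) auto
  moreover have "{j. \<forall>k\<in>UNIV. j $ k = i $ k} = {i}" by (auto simp: vec_eq_iff)
  ultimately show ?thesis by (simp add: has_sum_finite_iff)
qed

section \<open>Stationary distributions\<close>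

context immigration_branching
begin

lemma p_le_1: "0 \<le> t \<Longrightarrow> p t i j \<le> 1"
  using has_sum_nonneg_le[OF p_has_sum[of t i], of "{j}"] p_nonneg by simp

text \<open>Tonelli for the law at time \<open>t\<close> started from \<open>m\<close>, tested
  against a weight: \<open>w = 1\<close> yields its mass, a monomial its generating
  function.\<close>

lemma mixture_has_sum:
  assumes m: "\<And>i. 0 \<le> m i" "(m has_sum 1) UNIV" and t: "0 \<le> t"
    and w: "\<And>j. 0 \<le> w j" "\<And>j. w j \<le> 1" and S: "\<And>i. ((\<lambda>j. p t i j * w j) has_sum S i) UNIV"
  shows "((\<lambda>j. (\<Sum>\<^sub>\<infinity>i. m i * p t i j) * w j) has_sum (\<Sum>\<^sub>\<infinity>i. m i * S i)) UNIV"
proof -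
  have ms: "m summable_on UNIV" using m(2) by (rule has_sum_imp_summable)
  have S0: "0 \<le> S i" for i by (rule has_sum_nonneg[OF S]) (simp add: p_nonneg w)
  have S1: "S i \<le> 1" for i
    by (rule has_sum_mono[OF S p_has_sum[OF t, of i]]) (simp add: mult_left_le w p_nonneg)
  have mS: "((\<lambda>i. m i * S i) has_sum (\<Sum>\<^sub>\<infinity>i. m i * S i)) UNIV"
    using S0 S1 by (intro has_sum_infsum abs_summable_times_bounded ms) (simp add: abs_le_iff order.trans[of _ 0])
  have mp: "((\<lambda>i. m i * p t i j) has_sum (\<Sum>\<^sub>\<infinity>i. m i * p t i j)) UNIV" for j
    using p_le_1[OF t] p_nonneg by (intro has_sum_infsum abs_summable_times_bounded ms) simp
  have mp0: "0 \<le> (\<Sum>\<^sub>\<infinity>i. m i * p t i j)" for j by (rule infsum_nonneg) (simp add: m p_nonneg)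
  show ?thesis
  proof (rule has_sum_nn_integral_count)
    have "(\<integral>\<^sup>+ j. ennreal ((\<Sum>\<^sub>\<infinity>i. m i * p t i j) * w j) \<partial>count_space UNIV)
      = (\<integral>\<^sup>+ j. (\<integral>\<^sup>+ i. ennreal (m i * (p t i j * w j)) \<partial>count_space UNIV) \<partial>count_space UNIV)"
    proof (rule nn_integral_cong)
      fix j
      have "((\<lambda>i. m i * p t i j * w j) has_sum (\<Sum>\<^sub>\<infinity>i. m i * p t i j) * w j) UNIV"
        by (rule has_sum_cmult_left[OF mp])
      from nn_integral_count_has_sum[OF this] show "ennreal ((\<Sum>\<^sub>\<infinity>i. m i * p t i j) * w j)
        = (\<integral>\<^sup>+ i. ennreal (m i * (p t i j * w j)) \<partial>count_space UNIV)"
        by (simp add: m p_nonneg w mult.assoc)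
    qed
    also have "\<dots> = (\<integral>\<^sup>+ i. (\<integral>\<^sup>+ j. ennreal (m i * (p t i j * w j)) \<partial>count_space UNIV) \<partial>count_space UNIV)"
      by (intro nn_integral_count_swap sigma_finite_measure_count_space_countable) auto
    also have "\<dots> = (\<integral>\<^sup>+ i. ennreal (m i * S i) \<partial>count_space UNIV)"
    proof (rule nn_integral_cong)
      fix i
      from nn_integral_count_has_sum[OF has_sum_cmult_right[OF S, of "m i" i]]
      show "(\<integral>\<^sup>+ j. ennreal (m i * (p t i j * w j)) \<partial>count_space UNIV) = ennreal (m i * S i)"
        by (simp add: m p_nonneg w)
    qed
    also have "\<dots> = ennreal (\<Sum>\<^sub>\<infinity>i. m i * S i)"
      using nn_integral_count_has_sum[OF mS] by (simp add: m S0)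
    finally show "(\<integral>\<^sup>+ j. ennreal ((\<Sum>\<^sub>\<infinity>i. m i * p t i j) * w j) \<partial>count_space UNIV)
      = ennreal (\<Sum>\<^sub>\<infinity>i. m i * S i)" .
    show "0 \<le> (\<Sum>\<^sub>\<infinity>i. m i * S i)" by (rule infsum_nonneg) (simp add: m S0)
    show "0 \<le> (\<Sum>\<^sub>\<infinity>i. m i * p t i j) * w j" for j by (simp add: mp0 w)
  qed
qed

text \<open>The process is honest, so the normalisation in the definition is by \<open>1\<close>.\<close>
lemma quasi_stationary_iff_stationary:
  "quasi_stationary p m \<longleftrightarrow> (\<forall>i. 0 \<le> m i) \<and> (m has_sum 1) UNIV \<and>
     (\<forall>t>0. \<forall>j. (\<Sum>\<^sub>\<infinity>i. m i * p t i j) = m j)"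
proof -
  have "(\<Sum>\<^sub>\<infinity>j. \<Sum>\<^sub>\<infinity>i. m i * p t i j) = 1"
    if "\<forall>i. 0 \<le> m i" "(m has_sum 1) UNIV" "0 < t" for t
    using mixture_has_sum[of m t "\<lambda>_. 1" "\<lambda>_. 1"] that p_has_sum by (simp add: infsumI)
  then show ?thesis unfolding quasi_stationary_def Let_def by auto
qed

lemma stationary_gen_fun:
  assumes m: "quasi_stationary p m" and u: "u \<in> cube" "\<And>k. u $ k < 1" and t: "0 \<le> t"
  shows "gen_fun m u = gen_fun m (flow u t) * immigration_factor u t"
proof (cases "t = 0")
  case False
  have m': "\<And>i. 0 \<le> m i" "(m has_sum 1) UNIV" "\<And>j. (\<Sum>\<^sub>\<infinity>i. m i * p t i j) = m j"
    using m t False unfolding quasi_stationary_iff_stationary by auto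
  have "((\<lambda>j. (\<Sum>\<^sub>\<infinity>i. m i * p t i j) * monomial j u) has_sum (\<Sum>\<^sub>\<infinity>i. m i * state_gf u t i)) UNIV"
    by (rule mixture_has_sum[OF m'(1,2) t monomial_nonneg[OF u(1)] monomial_le_1[OF u(1)] p_gen_fun[OF u t]])
  then have "gen_fun m u = (\<Sum>\<^sub>\<infinity>i. m i * state_gf u t i)"
    unfolding m'(3) gen_fun_eq by (simp add: infsumI)
  also have "\<dots> = (\<Sum>\<^sub>\<infinity>i. m i * monomial i (flow u t) * immigration_factor u t)"
    by (simp add: state_gf_def mult.assoc)
  also have "\<dots> = gen_fun m (flow u t) * immigration_factor u t"
    unfolding gen_fun_eq by (rule infsum_cmult_left')
  finally show ?thesis .
qed (use u in simp)

lemma stationary_pde: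
  assumes m: "quasi_stationary p m" and u: "u \<in> cube" "\<And>k. u $ k < 1"
  shows "(\<Sum>i\<in>UNIV. gen_fun (b i) u * partial_deriv (gen_fun m) i u) + A u * gen_fun m u = 0"
proof -
  have "m summable_on UNIV"
    using m unfolding quasi_stationary_iff_stationary by (auto intro: has_sum_imp_summable)
  then obtain D where D: "(gen_fun m has_derivative (\<lambda>h. \<Sum>k\<in>UNIV. h $ k * D k)) (at u within cube)"
    using gen_fun_has_derivative_interior[OF _ u] by blast
  have "(gen_fun m has_derivative (\<lambda>h. \<Sum>k\<in>UNIV. h $ k * D k)) (at (flow u 0) within flow u ` {0..})"
    using has_derivative_subset[OF D, of "flow u ` {0..}"] u flow_in_cube by auto
  from vector_derivative_diff_chain_within[OF flow_deriv[OF u(1) order_refl] this]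
  have "((\<lambda>t. gen_fun m (flow u t)) has_real_derivative (\<Sum>k\<in>UNIV. gen_fun (b k) u * D k)) (at 0 within {0..})"
    using u by (simp add: has_real_derivative_iff_has_vector_derivative o_def)
  from DERIV_mult[OF this immigration_factor_deriv[OF u(1) order_refl]]
  have "((\<lambda>t. gen_fun m (flow u t) * immigration_factor u t) has_real_derivative
      (\<Sum>k\<in>UNIV. gen_fun (b k) u * D k) + A u * gen_fun m u) (at 0 within {0..})"
    using u by simp
  then have "((\<lambda>t. gen_fun m u) has_real_derivative
      (\<Sum>k\<in>UNIV. gen_fun (b k) u * D k) + A u * gen_fun m u) (at 0 within {0..})"
    by (rule has_field_derivative_transform_within[OF _ zero_less_one]) (use stationary_gen_fun[OF m u] in auto)
  then have "((\<lambda>t. gen_fun m u) has_real_derivative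
      (\<Sum>k\<in>UNIV. gen_fun (b k) u * D k) + A u * gen_fun m u) (at 0 within {0..1})"
    by (rule DERIV_subset) auto
  \<comment> \<open>One-sided derivatives at \<open>0\<close> are unique, so the derivative of the
    constant \<open>gen_fun m u\<close> must be \<open>0\<close>.\<close>
  moreover have "at (0::real) within {0..1} \<noteq> bot" by (simp add: at_within_Icc_at_right)
  ultimately have "(\<Sum>k\<in>UNIV. gen_fun (b k) u * D k) + A u * gen_fun m u = 0"
    unfolding has_real_derivative_iff_has_vector_derivative
    using vector_derivative_unique_within has_vector_derivative_const by blast
  then show ?thesis by (simp add: partial_deriv_eq[OF D u(1)])
qed

lemma p_to_zero:
  assumes t: "0 \<le> t"
  shows "p t i 0 = state_gf 0 t i"
proof -
  have "((\<lambda>j. p t i j * monomial j 0) has_sum state_gf 0 t i) UNIV"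
    by (rule p_gen_fun) (use t in auto)
  moreover have "((\<lambda>j. p t i j * monomial j 0) has_sum p t i 0) UNIV"
    by (rule has_sum_finite_neutralI[of "{0}"]) (auto simp: monomial_zero)
  ultimately show ?thesis using has_sum_unique by blast
qed

lemma stationary_zero_pos:
  assumes m: "quasi_stationary p m" and comm: "communicating p"
  shows "0 < m 0"
proof -
  have m': "\<And>i. 0 \<le> m i" "(m has_sum 1) UNIV" "\<And>t j. 0 < t \<Longrightarrow> (\<Sum>\<^sub>\<infinity>i. m i * p t i j) = m j"
    using m unfolding quasi_stationary_iff_stationary by auto
  have "\<exists>i. m i \<noteq> 0"
  proof (rule ccontr)
    assume "\<not> ?thesis"
    then have "(m has_sum 0) UNIV" by (intro has_sum_0) auto
    then show False using m'(2) has_sum_unique by fastforce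
  qed
  then obtain i where i: "0 < m i" using m'(1) by (auto simp: less_le)
  obtain t where t: "0 \<le> t" "0 < p t i 0" using comm unfolding communicating_def by blast
  show ?thesis
  proof (cases "t = 0")
    \<comment> \<open>\<open>communicating\<close> admits \<open>t = 0\<close>. There
      \<open>p\<close> is the identity, so \<open>i\<close> is already the empty state.\<close>
    case True
    then have "0 < monomial i 0" using t p_to_zero[of 0 i] by (simp add: state_gf_0)
    then show ?thesis using i by (simp add: monomial_zero split: if_splits)
  next
    case False
    have "((\<lambda>i. m i * p t i 0) has_sum (\<Sum>\<^sub>\<infinity>i. m i * p t i 0)) UNIV"
      using p_le_1[OF t(1)] p_nonneg
      by (intro has_sum_infsum abs_summable_times_bounded has_sum_imp_summable[OF m'(2)]) simp
    then have "m i * p t i 0 \<le> (\<Sum>\<^sub>\<infinity>i. m i * p t i 0)"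
      using has_sum_nonneg_le[of "\<lambda>i. m i * p t i 0" _ "{i}"] m'(1) p_nonneg by simp
    moreover have "0 < m i * p t i 0" using i t by simp
    ultimately show ?thesis using m'(3)[of t 0] t False by simp
  qed
qed

text \<open>Evaluated at the origin, invariance reads
  \<open>m 0 = gen_fun m (flow 0 t) * immigration_factor 0 t\<close>, and a generating function is
  at most \<open>1\<close>.\<close>

lemma stationary_factor_ge:
  assumes m: "quasi_stationary p m" and t: "0 \<le> t"
  shows "m 0 \<le> immigration_factor 0 t"
proof -
  have m': "\<And>i. 0 \<le> m i" "(m has_sum 1) UNIV"
    using m unfolding quasi_stationary_iff_stationary by auto
  have ms: "m summable_on UNIV" using m'(2) by (rule has_sum_imp_summable)
  have "((\<lambda>j. m j * monomial j 0) has_sum m 0) UNIV"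
    by (rule has_sum_finite_neutralI[of "{0}"]) (auto simp: monomial_zero)
  then have "m 0 = gen_fun m 0" using has_sum_unique[OF _ gen_fun_has_sum[OF ms zero_in_cube]] by blast
  also have "\<dots> = gen_fun m (flow 0 t) * immigration_factor 0 t"
    by (rule stationary_gen_fun[OF m _ _ t]) auto
  also have "\<dots> \<le> 1 * immigration_factor 0 t"
  proof (rule mult_right_mono)
    have F: "flow 0 t \<in> cube" using t by (intro flow_in_cube) auto
    show "gen_fun m (flow 0 t) \<le> 1"
      by (rule has_sum_mono[OF gen_fun_has_sum[OF ms F] m'(2)])
         (simp add: mult_left_le monomial_le_1[OF F] m'(1))
  qed (rule less_imp_le[OF immigration_factor_pos])
  finally show ?thesis by simp
qed

lemma stationary_flow_tendsto_one:
  assumes reg: "positively_regular (G_matrix b (vec 1))"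
    and m: "quasi_stationary p m" and comm: "communicating p"
  shows "(flow 0 \<longlongrightarrow> 1) at_top"
proof -
  obtain u where u: "u \<in> cube" "(flow 0 \<longlongrightarrow> u) at_top" "B u = 0" by (rule flow_zero_limit)
  have "A u = 0"
    by (rule factor_tendsto_imp[OF stationary_factor_ge[OF m] stationary_zero_pos[OF m comm] u(2,1)])
  then show ?thesis using zero_eq_one_if_A_zero[OF reg u(1,3)] u(2) by simp
qed

text \<open>\<open>p t 0 0\<close> decays subexponentially, because \<open>A\<close> tends to \<open>0\<close> along the flow.\<close>
lemma decay_parameter_zero:
  assumes lim: "(flow 0 \<longlongrightarrow> 1) at_top" and decay: "is_decay_parameter p lam"
  shows "lam = 0"
proof (rule ccontr)
  assume "lam \<noteq> 0"
  then have lam: "0 < lam" "((\<lambda>t. 1 / t * ln (p t 0 0)) \<longlongrightarrow> - lam) at_top"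
    using decay by (auto simp: is_decay_parameter_def)
  have ev_cube: "\<forall>\<^sub>F t in at_top. flow 0 t \<in> cube"
    using eventually_ge_at_top[of 0] by eventually_elim (simp add: flow_in_cube)
  have "((\<lambda>t. A (flow 0 t)) \<longlongrightarrow> A 1) at_top"
    by (rule continuous_on_tendsto_compose[OF continuous_on_gen_fun[OF a_summable] lim _ ev_cube]) simp
  then have "\<forall>\<^sub>F t in at_top. - lam / 4 < A (flow 0 t)"
    using order_tendstoD(1)[of _ "A 1" at_top "- lam / 4"] lam(1) by (simp add: A_one)
  then obtain s where s: "\<And>t. t \<ge> s \<Longrightarrow> - lam / 4 < A (flow 0 t)" by (auto simp: eventually_at_top_linorder)
  define s0 where "s0 = max s 0"
  \<comment> \<open>Up to \<open>s0\<close> the crude bound \<open>A 0\<close> costs a constant,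
    which division by \<open>t\<close> removes; after \<open>s0\<close> the exponential rate of loss
    is at most \<open>lam / 4\<close>, too slow for decay at rate \<open>lam\<close>.\<close>
  have bound: "ln (p t 0 0) \<ge> s0 * A 0 - lam / 4 * t" if t: "t \<ge> s0" for t
  proof -
    have t0: "0 \<le> s0" "0 \<le> t" using t by (auto simp: s0_def)
    have "ln (p t 0 0) = integral {0..t} (\<lambda>s. A (flow 0 s))"
      using p_to_zero[OF t0(2), of 0] by (simp add: state_gf_def immigration_factor_def)
    also have "\<dots> = integral {0..s0} (\<lambda>s. A (flow 0 s)) + integral {s0..t} (\<lambda>s. A (flow 0 s))"
      using t t0 by (intro Henstock_Kurzweil_Integration.integral_combine[symmetric] A_flow_integrable) auto
    also have "integral {0..s0} (\<lambda>s. A (flow 0 s)) \<ge> integral {0..s0} (\<lambda>s. A 0)"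
      by (intro integral_le A_flow_integrable) (auto intro!: A_ge flow_in_cube)
    then have "integral {0..s0} (\<lambda>s. A (flow 0 s)) \<ge> s0 * A 0" using t0 by simp
    moreover have "integral {s0..t} (\<lambda>s. A (flow 0 s)) \<ge> integral {s0..t} (\<lambda>s. - lam / 4)"
      using s t0 by (intro integral_le A_flow_integrable) (auto simp: s0_def intro!: less_imp_le)
    then have "integral {s0..t} (\<lambda>s. A (flow 0 s)) \<ge> - lam / 4 * (t - s0)" using t by (simp add: mult.commute)
    moreover have "- lam / 4 * (t - s0) \<ge> - lam / 4 * t"
      using lam(1) t0 by (simp add: algebra_simps)
    ultimately show ?thesis by linarith
  qed
  have "((\<lambda>t. s0 * A 0 / t - lam / 4) \<longlongrightarrow> 0 - lam / 4) at_top"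
    by (intro tendsto_diff tendsto_const tendsto_divide_0[OF tendsto_const] filterlim_at_top_imp_at_infinity filterlim_ident)
  moreover have "\<forall>\<^sub>F t in at_top. s0 * A 0 / t - lam / 4 \<le> 1 / t * ln (p t 0 0)"
    using eventually_ge_at_top[of s0] eventually_gt_at_top[of 0]
  proof eventually_elim
    case (elim t)
    then have "(s0 * A 0 - lam / 4 * t) / t \<le> ln (p t 0 0) / t" by (intro divide_right_mono bound) auto
    then show ?case using elim by (simp add: diff_divide_distrib)
  qed
  ultimately have "0 - lam / 4 \<le> - lam"
    by (intro tendsto_le[OF _ lam(2)]) auto
  then show False using lam(1) by simp
qed

section \<open>Long-time limits of the immigration factor and of the transition
  probabilities\<close>

lemma immigration_factor_add:
  assumes u: "u \<in> cube" and s: "0 \<le> s" "0 \<le> t"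
  shows "immigration_factor u (s + t) = immigration_factor u s * immigration_factor (flow u s) t"
proof -
  have "integral {0..s+t} (\<lambda>r. A (flow u r)) = integral {0..s} (\<lambda>r. A (flow u r)) + integral {s..s+t} (\<lambda>r. A (flow u r))"
    using s by (intro Henstock_Kurzweil_Integration.integral_combine[symmetric] A_flow_integrable u) auto
  also have "integral {s..s+t} (\<lambda>r. A (flow u r)) = integral {0..t} (\<lambda>r. A (flow u (s + r)))"
    using integral_shift_Icc_real[of 0 t "\<lambda>r. A (flow u r)" s] by (simp add: o_def add.commute)
  also have "\<dots> = integral {0..t} (\<lambda>r. A (flow (flow u s) r))"
    by (rule integral_cong) (use flow_add[OF u s(1)] in \<open>auto simp: add.commute\<close>)
  finally show ?thesis by (simp add: immigration_factor_def exp_add)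
qed

lemma immigration_factor_antimono:
  assumes u: "u \<in> cube" and s: "0 \<le> s" "s \<le> t"
  shows "immigration_factor u t \<le> immigration_factor u s"
  using immigration_factor_add[OF u s(1), of "t - s"] s
    immigration_factor_le_1[OF flow_in_cube[OF u s(1)]] immigration_factor_pos
  by (simp add: mult_left_le less_imp_le)

lemma immigration_factor_tendsto:
  assumes u: "u \<in> cube"
  obtains l where "(immigration_factor u \<longlongrightarrow> l) at_top"
proof
  define l where "l = (INF t\<in>{0..}. immigration_factor u t)"
  have bdd: "bdd_below (immigration_factor u ` {0..})"
    using immigration_factor_pos by (intro bdd_belowI[of _ 0]) (auto intro: less_imp_le)
  show "(immigration_factor u \<longlongrightarrow> l) at_top"
  proof (rule decreasing_tendsto)
    show "\<forall>\<^sub>F t in at_top. l \<le> immigration_factor u t"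
      using eventually_ge_at_top[of 0] by eventually_elim (auto simp: l_def intro: cINF_lower bdd)
    fix x assume "l < x"
    then obtain s where s: "0 \<le> s" "immigration_factor u s < x"
      using bdd by (auto simp: l_def cINF_less_iff)
    show "\<forall>\<^sub>F t in at_top. immigration_factor u t < x"
      using eventually_ge_at_top[of s]
      by eventually_elim (use s immigration_factor_antimono[OF u] in \<open>auto intro: le_less_trans\<close>)
  qed
qed

text \<open>Tychonoff for \<open>[0,1]\<close> indexed by states; as there are countably many
  states, compactness yields a convergent subsequence.\<close>

lemma p_subsequence_limit:
  obtains r m where "strict_mono (r :: nat \<Rightarrow> nat)" "\<And>j. (\<lambda>n. p (real (r n)) 0 j) \<longlonglongrightarrow> m j"
proof -
  have "compact (PiE UNIV (\<lambda>_ :: nat ^ 'n. {0..1 :: real}))"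
    using compactin_PiE[of "\<lambda>_ :: nat ^ 'n. euclideanreal" UNIV "\<lambda>_. {0..1}"]
    by (simp add: euclidean_product_topology)
  then have sc: "seq_compact (PiE UNIV (\<lambda>_ :: nat ^ 'n. {0..1 :: real}))" by (rule compact_imp_seq_compact)
  have "\<forall>n. (\<lambda>j. p (real n) 0 j) \<in> PiE UNIV (\<lambda>_. {0..1})" using p_nonneg p_le_1 by auto
  then obtain m r where mr: "strict_mono (r :: nat \<Rightarrow> nat)" "((\<lambda>n j. p (real n) 0 j) \<circ> r) \<longlonglongrightarrow> m"
    by (rule seq_compactE[OF sc])
  then have "(\<lambda>n. p (real (r n)) 0 j) \<longlonglongrightarrow> m j" for j
    using continuous_on_tendsto_compose[OF continuous_on_product_coordinates[of j] mr(2)] by (simp add: o_def)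
  then show ?thesis using that mr(1) by blast
qed

text \<open>
  An invariant law arises as a subsequential limit of \<open>p t 0\<close>: its generating function is
  \<open>exp (\<integral>\<^sub>0\<^sup>\<infinity> A (flow u s) ds)\<close>, and invariance is the semigroup property of the flow.
\<close>
lemma quasi_stationary_exists:
  assumes lim: "(flow 0 \<longlongrightarrow> 1) at_top" and \<delta>: "0 < \<delta>" "\<And>t. 0 \<le> t \<Longrightarrow> \<delta> \<le> immigration_factor 0 t"
  shows "\<exists>m. quasi_stationary p m"
proof -
  obtain r m where r: "strict_mono (r :: nat \<Rightarrow> nat)" and m: "\<And>j. (\<lambda>n. p (real (r n)) 0 j) \<longlonglongrightarrow> m j"
    using p_subsequence_limit by blast
  have r_top: "filterlim (\<lambda>n. real (r n)) at_top sequentially"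
    by (rule filterlim_compose[OF filterlim_real_sequentially filterlim_subseq[OF r]])
  note gft = gen_fun_tendsto[where P = "\<lambda>n. p (real (r n)) 0", OF p_nonneg p_has_sum m, simplified]
  have m0: "0 \<le> m j" for j using LIMSEQ_le_const[OF m] p_nonneg by blast
  have ms: "m summable_on UNIV" "infsum m UNIV \<le> 1"
    using gft(1,2)[of 0] by auto
  \<comment> \<open>The factor has a limit along all times by monotonicity, so the subsequence does
    not influence the generating function of \<open>m\<close>.\<close>
  have gf: "(immigration_factor u \<longlongrightarrow> gen_fun m u) at_top" if u: "u \<in> cube" "\<And>k. u $ k < 1" for u
  proof -
    have "gen_fun (p (real (r n)) 0) u = immigration_factor u (real (r n))" for n
      using infsumI[OF p_gen_fun[OF u, of "real (r n)" 0]] by (simp add: gen_fun_eq state_gf_def)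
    then have "(\<lambda>n. immigration_factor u (real (r n))) \<longlonglongrightarrow> gen_fun m u" using gft(3)[OF u] by simp
    moreover obtain l where l: "(immigration_factor u \<longlongrightarrow> l) at_top" by (rule immigration_factor_tendsto[OF u(1)])
    then have "(\<lambda>n. immigration_factor u (real (r n))) \<longlonglongrightarrow> l" by (rule filterlim_compose[OF _ r_top])
    ultimately show ?thesis using l LIMSEQ_unique by blast
  qed
  have shift: "gen_fun m u = immigration_factor u t * gen_fun m (flow u t)"
    if u: "u \<in> cube" "\<And>k. u $ k < 1" and t: "0 \<le> t" for u t
  proof -
    have F: "flow u t \<in> cube" "\<And>k. flow u t $ k < 1"
    proof -
      show "flow u t \<in> cube" by (rule flow_in_cube[OF u(1) t])
      fix k
      have "0 < exp (- rate * t) * (1 - u $ k)" using u(2) by simp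
      also have "\<dots> \<le> 1 - flow u t $ k" by (rule flow_le_1[OF u(1) t])
      finally show "flow u t $ k < 1" by simp
    qed
    have "((\<lambda>s. immigration_factor u t * immigration_factor (flow u t) s) \<longlongrightarrow> immigration_factor u t * gen_fun m (flow u t)) at_top"
      by (intro tendsto_mult_left gf F)
    moreover have "((\<lambda>s. immigration_factor u (t + s)) \<longlongrightarrow> gen_fun m u) at_top"
      by (rule filterlim_compose[OF gf[OF u] filterlim_tendsto_add_at_top[OF tendsto_const filterlim_ident]])
    then have "((\<lambda>s. immigration_factor u t * immigration_factor (flow u t) s) \<longlongrightarrow> gen_fun m u) at_top"
    proof (rule Lim_transform_eventually)
      show "\<forall>\<^sub>F s in at_top. immigration_factor u (t + s) = immigration_factor u t * immigration_factor (flow u t) s"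
        using eventually_ge_at_top[of 0] by eventually_elim (rule immigration_factor_add[OF u(1) t])
    qed
    ultimately show ?thesis using tendsto_unique trivial_limit_at_top_linorder by blast
  qed
  have F: "flow 0 t \<in> cube" "\<And>k. flow 0 t $ k < 1" if "0 \<le> t" for t
    using that flow_in_cube flow_zero_lt_1 by auto
  have m0_ge: "\<delta> \<le> gen_fun m 0"
    by (rule tendsto_lowerbound[OF gf]) (use \<delta> in \<open>auto simp: eventually_at_top_linorder\<close>)
  \<comment> \<open>No mass is lost: invariance at the origin bounds \<open>gen_fun m 0\<close> by
    the factor times the mass of \<open>m\<close>. In the limit the factor becomes
    \<open>gen_fun m 0\<close>, which is at least \<open>\<delta> > 0\<close> and can be
    cancelled.\<close>
  have m_sum: "(m has_sum 1) UNIV"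
  proof -
    have "((\<lambda>t. immigration_factor 0 t * infsum m UNIV) \<longlongrightarrow> gen_fun m 0 * infsum m UNIV) at_top"
      by (intro tendsto_mult_right gf) auto
    moreover have "gen_fun m 0 \<le> immigration_factor 0 t * infsum m UNIV" if "0 \<le> t" for t
    proof -
      have "gen_fun m (flow 0 t) \<le> infsum m UNIV"
        by (rule has_sum_mono[OF gen_fun_has_sum[OF ms(1) F(1)[OF that]] has_sum_infsum[OF ms(1)]])
           (simp add: mult_left_le monomial_le_1[OF F(1)[OF that]] m0)
      then have "immigration_factor 0 t * gen_fun m (flow 0 t) \<le> immigration_factor 0 t * infsum m UNIV"
        by (intro mult_left_mono less_imp_le[OF immigration_factor_pos])
      then show ?thesis using shift[of 0 t] that by simp
    qed
    ultimately have "gen_fun m 0 \<le> gen_fun m 0 * infsum m UNIV"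
      by (intro tendsto_lowerbound) (auto simp: eventually_at_top_linorder intro!: exI[of _ 0])
    then have "1 \<le> infsum m UNIV" using m0_ge \<delta>(1) by (simp add: mult_le_cancel_left1)
    then show ?thesis using ms by (simp add: has_sum_iff)
  qed
  have "(\<Sum>\<^sub>\<infinity>i. m i * p t i j) = m j" if t: "0 < t" for t j
  proof -
    define m' where "m' j = (\<Sum>\<^sub>\<infinity>i. m i * p t i j)" for j
    have t0: "0 \<le> t" using t by simp
    have mix: "((\<lambda>j. m' j * w j) has_sum (\<Sum>\<^sub>\<infinity>i. m i * S i)) UNIV"
      if "\<And>j. 0 \<le> w j" "\<And>j. w j \<le> 1" "\<And>i. ((\<lambda>j. p t i j * w j) has_sum S i) UNIV" for w S
      unfolding m'_def by (rule mixture_has_sum[OF m0 m_sum t0 that])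
    have m's: "(m' has_sum 1) UNIV"
      using mix[of "\<lambda>_. 1" "\<lambda>_. 1"] p_has_sum[OF t0] m_sum by (simp add: infsumI)
    have "((\<lambda>j. m' j - m j) has_sum 0) UNIV" using has_sum_diff_real[OF m's m_sum] by simp
    \<comment> \<open>Invariance holds for generating functions below the corner, hence for
      coefficients.\<close>
    then have "m' j - m j = 0"
    proof (rule gen_fun_coefficients_zero[OF has_sum_imp_summable])
      fix u :: "real ^ 'n" assume u: "u \<in> cube" "\<And>k. u $ k < 1"
      have "((\<lambda>j. m' j * monomial j u) has_sum (\<Sum>\<^sub>\<infinity>i. m i * state_gf u t i)) UNIV"
        by (rule mix[OF monomial_nonneg[OF u(1)] monomial_le_1[OF u(1)] p_gen_fun[OF u t0]])
      also have "(\<Sum>\<^sub>\<infinity>i. m i * state_gf u t i) = (\<Sum>\<^sub>\<infinity>i. m i * monomial i (flow u t) * immigration_factor u t)"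
        by (simp add: state_gf_def mult.assoc)
      also have "\<dots> = gen_fun m (flow u t) * immigration_factor u t"
        unfolding gen_fun_eq by (rule infsum_cmult_left')
      also have "\<dots> = gen_fun m u" using shift[OF u t0] by simp
      finally have "((\<lambda>j. m' j * monomial j u - m j * monomial j u) has_sum (gen_fun m u - gen_fun m u)) UNIV"
        by (intro has_sum_diff_real gen_fun_has_sum ms u)
      then show "gen_fun (\<lambda>j. m' j - m j) u = 0"
        unfolding gen_fun_eq[of "\<lambda>j. m' j - m j"] by (simp add: left_diff_distrib infsumI)
    qed
    then show ?thesis by (simp add: m'_def)
  qed
  then show ?thesis using m0 m_sum unfolding quasi_stationary_iff_stationary by blast
qed

end

section \<open>The characteristic curve\<close>

lemma has_vector_derivative_vec_iff:
  fixes f :: "real \<Rightarrow> real ^ 'n::finite"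
  shows "(f has_vector_derivative f') (at t within S) \<longleftrightarrow>
    (\<forall>k. ((\<lambda>t. f t $ k) has_real_derivative f' $ k) (at t within S))"
  unfolding has_real_derivative_iff_has_vector_derivative has_vector_derivative_def
  by (subst has_derivative_componentwise_within) (auto simp: Basis_vec_def cart_eq_inner_axis)

lemma has_real_derivative_within_Un:
  fixes f :: "real \<Rightarrow> real"
  assumes "(f has_real_derivative d) (at x within S)" "(f has_real_derivative d) (at x within T)"
  shows "(f has_real_derivative d) (at x within S \<union> T)"
  using assms unfolding has_field_derivative_iff by (subst at_within_union) (rule filterlim_sup)

locale recurrent_branching = immigration_branching a b
  for a :: "nat ^ 'n::finite \<Rightarrow> real" and b +
  fixes i1 :: 'n
  assumes B1_0: "0 < gen_fun (b i1) 0" and flow_tendsto_one: "(flow 0 \<longlongrightarrow> 1) at_top"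
begin

text \<open>
  The coordinate \<open>i1\<close> of the trajectory from \<open>0\<close> serves as the new parameter \<open>u\<close>; the linear
  continuation to negative times makes its inverse two-sided differentiable at \<open>0\<close>.
\<close>
definition clock :: "real \<Rightarrow> real" where
  "clock t = (if 0 \<le> t then flow 0 t $ i1 else t * gen_fun (b i1) 0)"

definition clock' :: "real \<Rightarrow> real" where
  "clock' t = gen_fun (b i1) (flow 0 (max 0 t))"

lemma clock'_pos: "0 < clock' t"
proof -
  have "0 < exp (- rate * max 0 t) * gen_fun (b i1) 0" using B1_0 by simp
  also have "\<dots> \<le> clock' t" using B_flow_zero_ge[of "max 0 t" i1] by (simp add: clock'_def)
  finally show ?thesis .
qed

lemma flow_zero_component_deriv:
  "0 \<le> t \<Longrightarrow> ((\<lambda>t. flow 0 t $ k) has_real_derivative gen_fun (b k) (flow 0 t)) (at t within {0..})"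
  using flow_deriv[OF zero_in_cube, of t] unfolding has_vector_derivative_vec_iff by simp

lemma clock_deriv: "(clock has_real_derivative clock' t) (at t)"
proof (cases "t \<ge> 0")
  case True
  have right: "(clock has_real_derivative clock' t) (at t within {0..})"
    by (rule has_field_derivative_transform_within[OF flow_zero_component_deriv[OF True, of i1, THEN DERIV_cong] zero_less_one])
       (use True in \<open>auto simp: clock_def clock'_def\<close>)
  show ?thesis
  proof (cases "t = 0")
    case True
    have "((\<lambda>t. t * gen_fun (b i1) 0) has_real_derivative clock' t) (at t within {..0})"
      using True by (auto intro!: derivative_eq_intros simp: clock'_def)
    then have "(clock has_real_derivative clock' t) (at t within {..0})"
      by (rule has_field_derivative_transform_within[OF _ zero_less_one]) (use True in \<open>auto simp: clock_def\<close>)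
    from has_real_derivative_within_Un[OF right this]
    have "(clock has_real_derivative clock' t) (at t within UNIV)"
      by (rule DERIV_subset) auto
    then show ?thesis by simp
  next
    case False
    then have "at t within {0..} = at t" using True by (intro at_within_interior) auto
    then show ?thesis using right by simp
  qed
next
  case False
  have "((\<lambda>t. t * gen_fun (b i1) 0) has_real_derivative clock' t) (at t)"
    using False by (auto intro!: derivative_eq_intros simp: clock'_def)
  then show ?thesis
    by (rule has_field_derivative_transform_within_open[of _ _ _ "{..<0}"]) (use False in \<open>auto simp: clock_def\<close>)
qed

lemma clock_strict_mono: "strict_mono clock"
proof (rule strict_monoI)
  fix s t :: real assume "s < t"
  then show "clock s < clock t"
    by (rule DERIV_pos_imp_increasing) (rule exI, rule conjI, rule clock_deriv, rule clock'_pos)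
qed

lemma clock_cont: "isCont clock t"
  using clock_deriv by (rule DERIV_isCont)

lemma clock_0 [simp]: "clock 0 = 0"
  by (simp add: clock_def)

lemma clock_lt_1: "clock t < 1"
proof (cases "0 \<le> t")
  case False
  then have "t * gen_fun (b i1) 0 \<le> 0" using B1_0 by (intro mult_nonpos_nonneg) auto
  then show ?thesis using False by (simp add: clock_def)
qed (simp add: clock_def flow_zero_lt_1)

lemma clock_nonneg: "0 \<le> t \<Longrightarrow> 0 \<le> clock t"
  using strict_mono_less_eq[OF clock_strict_mono, of 0 t] by simp

lemma clock_surj:
  assumes "u < 1"
  shows "\<exists>t. clock t = u"
proof (cases "0 \<le> u")
  case True
  have "\<forall>\<^sub>F t in at_top. u < flow 0 t $ i1"
    using order_tendstoD(1)[OF tendsto_vec_nth[OF flow_tendsto_one, of i1], of u] assms by simp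
  then obtain T where T: "\<And>t. t \<ge> T \<Longrightarrow> u < flow 0 t $ i1" by (auto simp: eventually_at_top_linorder)
  have "u \<le> clock (max T 0)" using T[of "max T 0"] by (simp add: clock_def)
  then have "\<exists>t\<ge>0. t \<le> max T 0 \<and> clock t = u"
    using True clock_cont by (intro IVT) auto
  then show ?thesis by blast
next
  case False
  then have "u / gen_fun (b i1) 0 < 0" using B1_0 by (simp add: divide_neg_pos)
  then have "clock (u / gen_fun (b i1) 0) = u" using B1_0 by (simp add: clock_def)
  then show ?thesis by blast
qed

definition clock_inv :: "real \<Rightarrow> real" where "clock_inv = inv clock"

lemma clock_inv_clock [simp]: "clock_inv (clock t) = t"
  unfolding clock_inv_def by (rule inv_f_f[OF strict_mono_imp_inj_on[OF clock_strict_mono]])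

lemma clock_clock_inv: "u < 1 \<Longrightarrow> clock (clock_inv u) = u"
  using clock_surj clock_inv_clock by metis

lemma clock_inv_nonneg: "0 \<le> u \<Longrightarrow> u < 1 \<Longrightarrow> 0 \<le> clock_inv u"
  using strict_mono_less_eq[OF clock_strict_mono, of 0 "clock_inv u"] by (simp add: clock_clock_inv)

lemma clock_inv_deriv:
  assumes u: "u < 1"
  shows "(clock_inv has_real_derivative inverse (clock' (clock_inv u))) (at u)"
proof (rule DERIV_inverse_function)
  show "(clock has_real_derivative clock' (clock_inv u)) (at (clock_inv u))" by (rule clock_deriv)
  show "clock' (clock_inv u) \<noteq> 0" using clock'_pos by (simp add: less_imp_neq[symmetric])
  show "u - 1 < u" "u < 1" using u by auto
  show "clock (clock_inv y) = y" if "u - 1 < y" "y < 1" for y by (rule clock_clock_inv[OF that(2)])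
  have "isCont clock_inv (clock (clock_inv u))"
    by (rule isCont_inverse_function[of 1]) (auto intro: clock_cont)
  then show "isCont clock_inv u" by (simp add: clock_clock_inv[OF u])
qed

section \<open>The reparametrised trajectory as a characteristic curve\<close>

definition curve :: "real \<Rightarrow> real ^ 'n" where
  "curve u = (if u < 1 then flow 0 (clock_inv u) else 1)"

lemma curve_clock: "curve (clock t) = flow 0 t"
  by (simp add: curve_def clock_lt_1)

lemma curve_deriv:
  assumes u: "0 \<le> u" "u < 1"
  shows "(curve has_vector_derivative inverse (gen_fun (b i1) (curve u)) *\<^sub>R B (curve u)) (at u within {0..1})"
proof -
  have "(clock_inv has_vector_derivative inverse (clock' (clock_inv u))) (at u within {0..<1})"
    using DERIV_subset[OF clock_inv_deriv[OF u(2)]] by (auto simp: has_real_derivative_iff_has_vector_derivative)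
  moreover have "(flow 0 has_vector_derivative B (flow 0 (clock_inv u))) (at (clock_inv u) within clock_inv ` {0..<1})"
    by (rule has_vector_derivative_within_subset[OF flow_deriv]) (use u clock_inv_nonneg in auto)
  ultimately have "(flow 0 \<circ> clock_inv has_vector_derivative inverse (clock' (clock_inv u)) *\<^sub>R B (flow 0 (clock_inv u))) (at u within {0..<1})"
    by (rule vector_diff_chain_within)
  then have "(curve has_vector_derivative inverse (clock' (clock_inv u)) *\<^sub>R B (flow 0 (clock_inv u))) (at u within {0..<1})"
    by (rule has_vector_derivative_transform[rotated 2]) (use u in \<open>auto simp: curve_def\<close>)
  moreover have "clock' (clock_inv u) = gen_fun (b i1) (curve u)"
    using u clock_inv_nonneg[OF u] by (simp add: clock'_def curve_def)
  moreover have "at u within {0..<1} = at u within {0..1}"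
    by (rule at_within_nhd[of u "{..<1}"]) (use u in auto)
  ultimately show ?thesis using u by (simp add: curve_def)
qed

lemma curve_tendsto_one: "(curve \<longlongrightarrow> 1) (at 1 within {0..1})"
proof (rule tendstoI)
  fix e :: real assume "0 < e"
  then obtain T where T: "\<And>t. t \<ge> T \<Longrightarrow> dist (flow 0 t) 1 < e"
    using tendstoD[OF flow_tendsto_one] by (auto simp: eventually_at_top_linorder)
  show "\<forall>\<^sub>F u in at 1 within {0..1}. dist (curve u) 1 < e"
    unfolding eventually_at
  proof (intro exI[of _ "1 - clock T"] conjI ballI impI)
    show "0 < 1 - clock T" using clock_lt_1[of T] by simp
    fix u :: real assume "u \<in> {0..1}" "u \<noteq> 1 \<and> dist u 1 < 1 - clock T"
    then have u: "u < 1" "clock T < u" by (auto simp: dist_real_def)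
    then have "clock T < clock (clock_inv u)" by (simp add: clock_clock_inv)
    then have "T < clock_inv u" using strict_mono_less[OF clock_strict_mono] by blast
    then show "dist (curve u) 1 < e" using T[of "clock_inv u"] u by (simp add: curve_def)
  qed
qed

lemma characteristic_curve_curve: "characteristic_curve i1 b curve"
  unfolding characteristic_curve_def
proof (intro conjI ballI allI impI)
  show "continuous_on {0..1} curve"
    unfolding continuous_on_eq_continuous_within
  proof
    fix u :: real assume u: "u \<in> {0..1}"
    show "continuous (at u within {0..1}) curve"
    proof (cases "u = 1")
      case True
      have "curve 1 = 1" by (simp add: curve_def)
      then show ?thesis using curve_tendsto_one True by (simp add: continuous_within)
    next
      case False
      then show ?thesis using u by (intro has_vector_derivative_continuous[OF curve_deriv]) auto
    qed
  qed
  show "curve u $ i1 = u" if "u \<in> {0..1}" for u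
  proof (cases "u < 1")
    case True
    then have "flow 0 (clock_inv u) $ i1 = clock (clock_inv u)"
      using that clock_inv_nonneg by (simp add: clock_def)
    then show ?thesis using True by (simp add: curve_def clock_clock_inv)
  qed (use that in \<open>simp add: curve_def\<close>)
  show "curve u $ k \<in> {0..1}" if "u \<in> {0..1}" for u k
    using that cubeD[OF flow_in_cube[OF zero_in_cube clock_inv_nonneg], of u k] by (auto simp: curve_def)
  show "curve 0 $ k = 0" for k using curve_clock[of 0] by simp
  show "curve 1 $ k = 1" for k by (simp add: curve_def)
  show "((\<lambda>v. curve v $ k) has_real_derivative gen_fun (b k) (curve u) / gen_fun (b i1) (curve u))
      (at u within {0..1})" if "u \<in> {0..<1}" for u k
    using curve_deriv[of u] that unfolding has_vector_derivative_vec_iff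
    by (simp add: divide_inverse mult.commute)
qed

lemma B_bounded: obtains K where "0 < K" "\<And>u. u \<in> cube \<Longrightarrow> norm (B u) \<le> K"
  using compact_imp_bounded[OF compact_continuous_image[OF continuous_on_B compact_cube]]
  by (auto simp: bounded_pos)

text \<open>
  The reparametrised curve solves \<open>y' = (B_1 (x) / B_1 (y)) B (y)\<close>, with \<open>x\<close> the trajectory from \<open>0\<close>.
  The right-hand side is Lipschitz only where \<open>B_1 (y)\<close> is bounded away from \<open>0\<close>, so uniqueness is
  propagated from the first time at which \<open>y\<close> and \<open>x\<close> separate.
\<close>
lemma characteristic_curve_unique:
  assumes w: "characteristic_curve i1 b w" and t0: "0 \<le> t0"
  shows "w (clock t0) = flow 0 t0"
proof (rule ccontr)
  define y where "y t = w (clock t)" for t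
  assume "\<not> ?thesis"
  then have ne: "y t0 \<noteq> flow 0 t0" by (simp add: y_def)
  have w_cont: "continuous_on {0..1} w" and w_i1: "\<And>u. u \<in> {0..1} \<Longrightarrow> w u $ i1 = u"
    and w_cube: "\<And>u. u \<in> {0..1} \<Longrightarrow> w u \<in> cube" and w_0: "\<And>k. k \<noteq> i1 \<Longrightarrow> w 0 $ k = 0"
    and w_deriv: "\<And>k u. k \<noteq> i1 \<Longrightarrow> u \<in> {0..<1} \<Longrightarrow> ((\<lambda>v. w v $ k) has_real_derivative
            gen_fun (b k) (w u) / gen_fun (b i1) (w u)) (at u within {0..1})"
    using w unfolding characteristic_curve_def by (auto simp: cube_def)
  have clock_01: "clock t \<in> {0..<1}" if "0 \<le> t" for t using clock_nonneg[OF that] clock_lt_1 by simp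
  have clock_sub: "clock ` {0..} \<subseteq> {0..1}"
  proof (rule image_subsetI)
    fix t :: real assume "t \<in> {0..}"
    then show "clock t \<in> {0..1}" using clock_01[of t] by simp
  qed
  have y_i1: "y t $ i1 = clock t" if "0 \<le> t" for t
    using w_i1[of "clock t"] clock_01[OF that] by (simp add: y_def)
  have y_cube: "y t \<in> cube" if "0 \<le> t" for t
    unfolding y_def using clock_01[OF that] by (intro w_cube) auto
  have y_cont: "continuous_on {0..} y"
    unfolding y_def
  proof (rule continuous_on_compose2[OF w_cont])
    show "continuous_on {0..} clock" by (rule continuous_at_imp_continuous_on) (simp add: clock_cont)
  qed (rule clock_sub)
  have y_0: "y 0 = flow 0 0" using w_0 w_i1[of 0] by (auto simp: y_def vec_eq_iff) (metis)
  have y_deriv: "(y has_vector_derivative (clock' t / gen_fun (b i1) (y t)) *\<^sub>R B (y t)) (at t within {0..})"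
    if t: "0 \<le> t" and nz: "gen_fun (b i1) (y t) \<noteq> 0" for t
    unfolding has_vector_derivative_vec_iff
  proof
    fix k
    have cl: "(clock has_real_derivative clock' t) (at t within {0..})" using clock_deriv by (rule has_field_derivative_at_within)
    show "((\<lambda>t. y t $ k) has_real_derivative ((clock' t / gen_fun (b i1) (y t)) *\<^sub>R B (y t)) $ k) (at t within {0..})"
    proof (cases "k = i1")
      case True
      have "(clock has_real_derivative ((clock' t / gen_fun (b i1) (y t)) *\<^sub>R B (y t)) $ k) (at t within {0..})"
        using cl nz True by simp
      then show ?thesis
        by (rule has_field_derivative_transform_within[OF _ zero_less_one])
           (use t True y_i1 in auto)
    next
      case False
      have "((\<lambda>v. w v $ k) has_real_derivative gen_fun (b k) (y t) / gen_fun (b i1) (y t)) (at (clock t) within clock ` {0..})"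
        unfolding y_def
        by (rule DERIV_subset[OF w_deriv[OF False clock_01[OF t]] clock_sub])
      from DERIV_image_chain[OF this cl] show ?thesis by (simp add: y_def o_def mult.commute)
    qed
  qed
  define X where "X = {t \<in> {0..t0}. y t \<noteq> flow 0 t}"
  define \<tau> where "\<tau> = Inf X"
  have X: "X \<noteq> {}" "bdd_below X" using ne t0 by (auto simp: X_def bdd_below_def)
  have \<tau>: "0 \<le> \<tau>" "\<tau> \<le> t0"
    unfolding \<tau>_def using X ne t0 by (auto simp: X_def intro!: cInf_greatest cInf_lower)
  have before: "y t = flow 0 t" if "0 \<le> t" "t < \<tau>" for t
    using that \<tau> cInf_lower[OF _ X(2), of t] by (auto simp: X_def \<tau>_def not_le)
  have at_\<tau>: "y \<tau> = flow 0 \<tau>"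
  proof (cases "\<tau> = 0")
    case False
    have "y \<tau> - flow 0 \<tau> = 0"
    proof (rule continuous_constant_on_closure[of "{0..<\<tau>}" "\<lambda>t. y t - flow 0 t"])
      show "continuous_on (closure {0..<\<tau>}) (\<lambda>t. y t - flow 0 t)"
        using False \<tau> by (intro continuous_intros continuous_on_subset[OF y_cont]
            continuous_on_subset[OF continuous_on_flow[OF zero_in_cube]]) auto
    qed (use before False \<tau> in auto)
    then show ?thesis by simp
  qed (use y_0 in simp)
  \<comment> \<open>At \<open>\<tau>\<close> the two curves still agree, so the denominator is
    positive there; by continuity it exceeds half its value on a short interval to the
    right.\<close>
  define c where "c = gen_fun (b i1) (y \<tau>) / 2"
  have c_pos: "0 < c" using clock'_pos[of \<tau>] \<tau> at_\<tau> by (simp add: c_def clock'_def)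
  have "continuous_on {0..} (\<lambda>t. gen_fun (b i1) (y t))"
    by (rule continuous_on_compose2[OF continuous_on_gen_fun[OF b_summable] y_cont]) (use y_cube in auto)
  then have "((\<lambda>t. gen_fun (b i1) (y t)) \<longlongrightarrow> gen_fun (b i1) (y \<tau>)) (at \<tau> within {0..})"
    using \<tau> by (simp add: continuous_on_def)
  then have "\<forall>\<^sub>F t in at \<tau> within {0..}. c < gen_fun (b i1) (y t)"
    by (rule order_tendstoD(1)) (use c_pos in \<open>simp add: c_def\<close>)
  then obtain \<delta> where \<delta>: "0 < \<delta>"
    "\<And>t. t \<in> {0..} \<Longrightarrow> t \<noteq> \<tau> \<Longrightarrow> dist t \<tau> < \<delta> \<Longrightarrow> c < gen_fun (b i1) (y t)"
    unfolding eventually_at by blast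
  have c_lt: "c < gen_fun (b i1) (y t)" if "t \<in> {\<tau>..\<tau> + \<delta> / 2}" for t
  proof (cases "t = \<tau>")
    case True
    then show ?thesis using c_pos by (simp add: c_def)
  qed (use that \<delta> \<tau> in \<open>auto simp: dist_real_def\<close>)
  obtain K where K: "0 < K" "\<And>u. u \<in> cube \<Longrightarrow> norm (B u) \<le> K" by (rule B_bounded) blast
  have same: "y s = flow 0 s" if s: "s \<in> {\<tau>..\<tau> + \<delta> / 2}" for s
  proof -
    have "norm (y s - flow 0 s) \<le> exp ((Lip * K / c + Lip) * (s - \<tau>)) * norm (y \<tau> - flow 0 \<tau>)"
    proof (rule gronwall_difference[where y' = "\<lambda>t. (clock' t / gen_fun (b i1) (y t)) *\<^sub>R B (y t)" and z' = "\<lambda>t. B (flow 0 t)"])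
      fix t assume t: "t \<in> {\<tau>..s}"
      then have t': "0 \<le> t" and cl: "c < gen_fun (b i1) (y t)" using \<tau> s c_lt by auto
      show "(y has_vector_derivative (clock' t / gen_fun (b i1) (y t)) *\<^sub>R B (y t)) (at t within {\<tau>..s})"
        by (rule has_vector_derivative_within_subset[OF y_deriv[OF t']]) (use cl c_pos \<tau> in auto)
      show "(flow 0 has_vector_derivative B (flow 0 t)) (at t within {\<tau>..s})"
        by (rule has_vector_derivative_within_subset[OF flow_deriv[OF zero_in_cube t']]) (use \<tau> in auto)
      have yc: "y t \<in> cube" and Fc: "flow 0 t \<in> cube" using y_cube t' flow_in_cube by auto
      have lip: "norm (B (flow 0 t) - B (y t)) \<le> Lip * norm (y t - flow 0 t)"
        using Lip(2)[OF Fc yc] by (simp add: norm_minus_commute)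
      let ?g = "gen_fun (b i1) (y t)"
      have g: "0 < ?g" using cl c_pos by simp
      have "\<bar>clock' t - ?g\<bar> = \<bar>(B (flow 0 t) - B (y t)) $ i1\<bar>" using t' by (simp add: clock'_def)
      also have "\<dots> \<le> norm (B (flow 0 t) - B (y t))" by (rule component_le_norm_cart)
      finally have g1: "\<bar>clock' t - ?g\<bar> \<le> Lip * norm (y t - flow 0 t)" using lip by linarith
      \<comment> \<open>Since \<open>clock' t\<close> is \<open>B_1\<close> along the trajectory,
        the factor \<open>clock' t / ?g\<close> differs from \<open>1\<close> by a Lipschitz error
        over \<open>c\<close>. With \<open>K\<close> bounding \<open>B\<close>, this accounts for
        the constant \<open>Lip * K / c + Lip\<close>.\<close>
      have "(clock' t / ?g) *\<^sub>R B (y t) - B (flow 0 t)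
          = ((clock' t - ?g) / ?g) *\<^sub>R B (y t) - (B (flow 0 t) - B (y t))"
        using g by (simp add: diff_divide_distrib scaleR_diff_left)
      also have "norm \<dots> \<le> norm (((clock' t - ?g) / ?g) *\<^sub>R B (y t)) + norm (B (flow 0 t) - B (y t))"
        by (rule norm_triangle_ineq4)
      also have "norm (((clock' t - ?g) / ?g) *\<^sub>R B (y t)) = \<bar>clock' t - ?g\<bar> / ?g * norm (B (y t))"
        using g by simp
      also have "\<dots> \<le> (Lip * norm (y t - flow 0 t)) / c * K"
        using g1 cl c_pos K(2)[OF yc] by (intro mult_mono frac_le) auto
      finally show "norm ((clock' t / ?g) *\<^sub>R B (y t) - B (flow 0 t)) \<le> (Lip * K / c + Lip) * norm (y t - flow 0 t)"
        using lip by (simp add: algebra_simps)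
    qed (use s in auto)
    then show ?thesis using at_\<tau> by simp
  qed
  obtain t where t: "t \<in> X" "t < \<tau> + \<delta> / 2"
    using cInf_lessD[OF X(1), of "\<tau> + \<delta> / 2"] \<delta>(1) by (auto simp: \<tau>_def)
  have "\<tau> \<le> t" unfolding \<tau>_def by (rule cInf_lower[OF t(1) X(2)])
  then show False using same[of t] t by (auto simp: X_def)
qed

text \<open>Under the substitution \<open>u = clock t\<close> the derivative of \<open>clock\<close>
  cancels the denominator. It is carried out on \<open>{0..clock T}\<close> for finite
  \<open>T\<close>, because the denominator vanishes at the end point \<open>1\<close>.\<close>

lemma curve_integral:
  assumes w: "continuous_on {0..1} w" "\<And>u. u \<in> {0..1} \<Longrightarrow> w u \<in> cube"
    "\<And>t. 0 \<le> t \<Longrightarrow> w (clock t) = flow 0 t" and T: "0 \<le> T"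
  shows "(\<lambda>u. ennreal (- (A (w u) / gen_fun (b i1) (w u))) * indicator {0..clock T} u) \<in> borel_measurable lborel"
    and "(\<integral>\<^sup>+ u. ennreal (- (A (w u) / gen_fun (b i1) (w u))) * indicator {0..clock T} u \<partial>lborel)
      = ennreal (- integral {0..T} (\<lambda>t. A (flow 0 t)))"
proof -
  define h where "h u = - (A (w u) / gen_fun (b i1) (w u))" for u
  have sub: "{0..clock T} \<subseteq> {0..1}" using clock_lt_1[of T] by auto
  have w_sub: "continuous_on {0..clock T} w" by (rule continuous_on_subset[OF w(1) sub])
  have nz: "gen_fun (b i1) (w u) \<noteq> 0" if "u \<in> {0..clock T}" for u
  proof -
    have u: "0 \<le> u" "u < 1" using that clock_lt_1[of T] by auto
    have "w u = flow 0 (clock_inv u)" using w(3)[OF clock_inv_nonneg[OF u]] by (simp add: clock_clock_inv[OF u(2)])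
    then show ?thesis using clock'_pos[of "clock_inv u"] clock_inv_nonneg[OF u] by (simp add: clock'_def)
  qed
  have cA: "continuous_on {0..clock T} (\<lambda>u. A (w u))"
    by (rule continuous_on_compose2[OF continuous_on_gen_fun[OF a_summable] w_sub]) (use w(2) sub in auto)
  have cB: "continuous_on {0..clock T} (\<lambda>u. gen_fun (b i1) (w u))"
    by (rule continuous_on_compose2[OF continuous_on_gen_fun[OF b_summable] w_sub]) (use w(2) sub in auto)
  have ch: "continuous_on {0..clock T} h"
    unfolding h_def using nz by (intro continuous_on_minus continuous_on_divide cA cB) auto
  have hm: "set_borel_measurable borel {0..clock T} h"
    using borel_measurable_continuous_on_indicator[OF _ ch] by (simp add: set_borel_measurable_def)
  have eq: "ennreal (h u) * indicator {0..clock T} u = ennreal (h u * indicator {0..clock T} u)" for u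
    by (simp split: split_indicator)
  have "(\<lambda>u. h u * indicator {0..clock T} u) \<in> borel_measurable borel"
    using hm by (simp add: set_borel_measurable_def mult.commute)
  then show "(\<lambda>u. ennreal (- (A (w u) / gen_fun (b i1) (w u))) * indicator {0..clock T} u) \<in> borel_measurable lborel"
    unfolding h_def[symmetric] eq by measurable
  have c_cont: "continuous_on {0..T} clock'"
    unfolding clock'_def
    by (rule continuous_on_compose2[OF continuous_on_gen_fun[OF b_summable]
        continuous_on_compose2[OF continuous_on_flow[OF zero_in_cube]]]) (auto intro!: continuous_intros flow_in_cube)
  have "(\<integral>\<^sup>+ u. ennreal (h u) * indicator {0..clock T} u \<partial>lborel)
      = (\<integral>\<^sup>+ u. ennreal (h u * indicator {clock 0..clock T} u) \<partial>lborel)"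
    by (simp add: eq)
  also have "\<dots> = (\<integral>\<^sup>+ t. ennreal (h (clock t) * clock' t * indicator {0..T} t) \<partial>lborel)"
    by (rule nn_integral_substitution) (use hm c_cont clock'_pos less_imp_le clock_deriv T in auto)
  also have "\<dots> = (\<integral>\<^sup>+ t. ennreal (- A (flow 0 t)) * indicator {0..T} t \<partial>lborel)"
  proof (rule nn_integral_cong)
    fix t
    show "ennreal (h (clock t) * clock' t * indicator {0..T} t) = ennreal (- A (flow 0 t)) * indicator {0..T} t"
    proof (cases "t \<in> {0..T}")
      case True
      then have "h (clock t) * clock' t = - A (flow 0 t)"
        using w(3)[of t] clock'_pos[of t] by (simp add: h_def clock'_def)
      then show ?thesis using True by simp
    qed simp
  qed
  also have "\<dots> = ennreal (- integral {0..T} (\<lambda>t. A (flow 0 t)))"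
  proof (rule nn_integral_has_integral_lebesgue')
    show "0 \<le> - A (flow 0 t)" if "t \<in> {0..T}" for t using that by (auto intro!: A_nonpos flow_in_cube)
    show "((\<lambda>t. - A (flow 0 t)) has_integral - integral {0..T} (\<lambda>t. A (flow 0 t))) {0..T}"
      by (intro has_integral_neg integrable_integral A_flow_integrable) auto
  qed
  finally show "(\<integral>\<^sup>+ u. ennreal (- (A (w u) / gen_fun (b i1) (w u))) * indicator {0..clock T} u \<partial>lborel)
      = ennreal (- integral {0..T} (\<lambda>t. A (flow 0 t)))" by (simp add: h_def)
qed

lemma extended_integral_gt_iff:
  assumes w: "characteristic_curve i1 b w"
  shows "extended_integral (lebesgue_on {0..1}) (\<lambda>u. A (w u) / gen_fun (b i1) (w u)) > - \<infinity> \<longleftrightarrow>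
    (\<exists>\<delta>>0. \<forall>t\<ge>0. \<delta> \<le> immigration_factor 0 t)"
proof -
  define h where "h u = - (A (w u) / gen_fun (b i1) (w u))" for u
  have w': "continuous_on {0..1} w" "\<And>u. u \<in> {0..1} \<Longrightarrow> w u \<in> cube"
    "\<And>t. 0 \<le> t \<Longrightarrow> w (clock t) = flow 0 t"
    using w characteristic_curve_unique[OF w] unfolding characteristic_curve_def by (auto simp: cube_def)
  define neg where "neg = (\<integral>\<^sup>+ u. ennreal (h u) * indicator {0..1} u \<partial>lborel)"
  have neg: "neg = (\<integral>\<^sup>+ u. ennreal (- (A (w u) / gen_fun (b i1) (w u))) \<partial>lebesgue_on {0..1})"
    by (simp add: neg_def h_def nn_integral_restrict_space nn_integral_completion)
  \<comment> \<open>When the negative part is finite, the extended integral cannot be minus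
    infinity, whatever the positive part is.\<close>
  have "extended_integral (lebesgue_on {0..1}) (\<lambda>u. A (w u) / gen_fun (b i1) (w u)) > - \<infinity> \<longleftrightarrow> neg \<noteq> \<infinity>"
    unfolding extended_integral_def Let_def neg[symmetric]
    by (cases neg; cases "\<integral>\<^sup>+ u. ennreal (A (w u) / gen_fun (b i1) (w u)) \<partial>lebesgue_on {0..1}")
       (auto simp: enn2ereal_ennreal)
  moreover have "(\<exists>\<delta>>0. \<forall>t\<ge>0. \<delta> \<le> immigration_factor 0 t)" if "neg \<noteq> \<infinity>"
  proof -
    obtain N where N: "neg = ennreal N" "0 \<le> N" using \<open>neg \<noteq> \<infinity>\<close> by (cases neg) auto
    have "exp (- N) \<le> immigration_factor 0 t" if t: "0 \<le> t" for t
    proof -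
      have "ennreal (- integral {0..t} (\<lambda>t. A (flow 0 t)))
          = (\<integral>\<^sup>+ u. ennreal (h u) * indicator {0..clock t} u \<partial>lborel)"
        unfolding h_def by (rule curve_integral(2)[OF w' t, symmetric])
      also have "\<dots> \<le> neg"
        unfolding neg_def using clock_lt_1[of t] by (intro nn_integral_mono) (auto split: split_indicator)
      finally have "- integral {0..t} (\<lambda>t. A (flow 0 t)) \<le> N" using N by (auto simp: ennreal_le_iff2)
      then show ?thesis by (simp add: immigration_factor_def)
    qed
    then show ?thesis by (intro exI[of _ "exp (- N)"]) simp
  qed
  moreover have "neg \<noteq> \<infinity>" if ex: "\<exists>\<delta>>0. \<forall>t\<ge>0. \<delta> \<le> immigration_factor 0 t"
  proof -
    obtain \<delta> where \<delta>: "0 < \<delta>" "\<And>t. 0 \<le> t \<Longrightarrow> \<delta> \<le> immigration_factor 0 t" using ex by auto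
    have w1: "w 1 = 1"
    proof -
      have "w 1 $ k = 1" for k using w by (cases "k = i1") (auto simp: characteristic_curve_def)
      then show ?thesis by (simp add: vec_eq_iff)
    qed
    \<comment> \<open>The intervals \<open>{0..clock n}\<close> exhaust \<open>[0,1)\<close>. The
      missing point \<open>1\<close> contributes nothing: both \<open>A\<close> and
      \<open>B_1\<close> vanish there, and division by zero yields \<open>0\<close>.\<close>
    have sup: "ennreal (h u) * indicator {0..1} u = (SUP n. ennreal (h u) * indicator {0..clock (real n)} u)" for u
    proof (cases "0 \<le> u \<and> u < 1")
      case True
      obtain n where n: "clock_inv u \<le> real n" using real_arch_simple by blast
      have "clock (clock_inv u) \<le> clock (real n)" using n strict_mono_less_eq[OF clock_strict_mono] by blast
      then have "u \<le> clock (real n)" using True by (simp add: clock_clock_inv)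
      then have "ennreal (h u) \<le> (SUP n. ennreal (h u) * indicator {0..clock (real n)} u)"
        using True by (intro SUP_upper2[of n]) auto
      moreover have "(SUP n. ennreal (h u) * indicator {0..clock (real n)} u) \<le> ennreal (h u)"
        by (intro SUP_least) (auto split: split_indicator)
      ultimately show ?thesis using True by (simp add: order.antisym)
    next
      case False
      have "h 1 = 0" by (simp add: h_def w1 gen_fun_b_one)
      then have z1: "ennreal (h u) * indicator {0..1} u = 0" using False by (auto split: split_indicator)
      have z2: "ennreal (h u) * indicator {0..clock (real n)} u = 0" for n
        using False clock_lt_1[of "real n"] by (auto split: split_indicator)
      show ?thesis unfolding z1 z2 by simp
    qed
    have "neg = (SUP n. \<integral>\<^sup>+ u. ennreal (h u) * indicator {0..clock (real n)} u \<partial>lborel)"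
      unfolding neg_def sup
    proof (rule nn_integral_monotone_convergence_SUP)
      show "incseq (\<lambda>n u. ennreal (h u) * indicator {0..clock (real n)} u)"
      proof (intro incseq_SucI le_funI mult_left_mono)
        fix n u
        have "clock (real n) \<le> clock (real (Suc n))" using strict_mono_less_eq[OF clock_strict_mono] by simp
        then show "(indicator {0..clock (real n)} u :: ennreal) \<le> indicator {0..clock (real (Suc n))} u"
          by (auto split: split_indicator)
      qed simp
      show "(\<lambda>u. ennreal (h u) * indicator {0..clock (real n)} u) \<in> borel_measurable lborel" for n
        unfolding h_def by (rule curve_integral(1)[OF w']) simp_all
    qed
    also have "\<dots> = (SUP n. ennreal (- integral {0..real n} (\<lambda>t. A (flow 0 t))))"
      unfolding h_def by (intro SUP_cong refl curve_integral(2)[OF w']) simp_all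
    also have "\<dots> \<le> ennreal (- ln \<delta>)"
    proof (intro SUP_least ennreal_leI)
      fix n :: nat
      have "ln \<delta> \<le> ln (immigration_factor 0 (real n))" using \<delta>(2)[of "real n"] \<delta>(1) by simp
      then show "- integral {0..real n} (\<lambda>t. A (flow 0 t)) \<le> - ln \<delta>" by (simp add: immigration_factor_def)
    qed
    finally show "neg \<noteq> \<infinity>" by (auto simp: top_unique)
  qed
  ultimately show ?thesis by blast
qed

end

theorem theorem6p5:
  fixes a :: "nat ^ 'n::finite \<Rightarrow> real"
    and b :: "'n \<Rightarrow> nat ^ 'n \<Rightarrow> real"
    and i1 :: 'n
    and P :: "real \<Rightarrow> nat ^ 'n \<Rightarrow> nat ^ 'n \<Rightarrow> real"
    and lam :: real
  assumes a_nonneg: "\<And>j. j \<noteq> 0 \<Longrightarrow> 0 \<le> a j"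
    and a_sum: "(a has_sum (- a 0)) (- {0})" "0 < - a 0"
    and b_nonneg: "\<And>k j. j \<noteq> axis k 1 \<Longrightarrow> 0 \<le> b k j"
    and b_sum: "\<And>k. (b k has_sum (- b k (axis k 1))) (- {axis k 1})" "\<And>k. 0 < - b k (axis k 1)"
    and conservative: "conservative (q_matrix a b)"
    and P: "P = feller_minimal (q_matrix a b)"
    and communicating: "communicating P"
    and regular: "positively_regular (G_matrix b (vec 1))"
    and nonsingular: "nonsingular_family b"
    and finite_deriv: "\<And>i j. partially_differentiable (gen_fun (b i)) j (vec 1)"
    and B1_0: "0 < gen_fun (b i1) 0"
    and decay: "is_decay_parameter P lam"
  shows "((\<exists>m. quasi_stationary P m) \<longleftrightarrow>
            rho b (vec 1) \<le> 0 \<and>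
            (\<exists>w. characteristic_curve i1 b w \<and>
               extended_integral (lebesgue_on {0..1})
                 (\<lambda>u. (lam + gen_fun a (w u)) / gen_fun (b i1) (w u)) > - \<infinity>)) \<and>
         (\<forall>m. quasi_stationary P m \<longrightarrow>
            (\<forall>u. (\<forall>k. 0 \<le> u $ k \<and> u $ k < 1) \<longrightarrow>
               (\<Sum>i\<in>UNIV. gen_fun (b i) u * partial_deriv (gen_fun m) i u)
               + (lam + gen_fun a u) * gen_fun m u = 0))"
proof -
  interpret immigration_branching a b
    by unfold_locales (use a_nonneg a_sum b_nonneg b_sum finite_deriv in auto)
  note P [simp]
  have lim: "(flow 0 \<longlongrightarrow> 1) at_top" if "quasi_stationary P m" for m
    using stationary_flow_tendsto_one[OF regular] that communicating by simp
  \<comment> \<open>So far the integral criterion and the differential equation have been derived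
    without \<open>lam\<close>; this inserts it into both.\<close>
  have lam: "lam = 0" if "(flow 0 \<longlongrightarrow> 1) at_top"
    using decay_parameter_zero[OF that] decay by simp
  have curve: "recurrent_branching a b i1" if "(flow 0 \<longlongrightarrow> 1) at_top"
    by unfold_locales (use B1_0 that in auto)
  have "rho b (vec 1) \<le> 0 \<and> (\<exists>w. characteristic_curve i1 b w \<and>
      extended_integral (lebesgue_on {0..1}) (\<lambda>u. (lam + gen_fun a (w u)) / gen_fun (b i1) (w u)) > - \<infinity>)"
    if m: "quasi_stationary P m" for m
  proof
    show "rho b (vec 1) \<le> 0" by (rule rho_le_if_flow_tendsto_one[OF regular lim[OF m]])
    interpret recurrent_branching a b i1 by (rule curve[OF lim[OF m]])
    have "\<exists>\<delta>>0. \<forall>t\<ge>0. \<delta> \<le> immigration_factor 0 t"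
      using stationary_factor_ge stationary_zero_pos m communicating by auto
    then show "\<exists>w. characteristic_curve i1 b w \<and>
      extended_integral (lebesgue_on {0..1}) (\<lambda>u. (lam + gen_fun a (w u)) / gen_fun (b i1) (w u)) > - \<infinity>"
      using characteristic_curve_curve extended_integral_gt_iff lam[OF lim[OF m]] by auto
  qed
  moreover have "\<exists>m. quasi_stationary P m"
    if rho: "rho b (vec 1) \<le> 0" and w: "characteristic_curve i1 b w"
      "extended_integral (lebesgue_on {0..1}) (\<lambda>u. (lam + gen_fun a (w u)) / gen_fun (b i1) (w u)) > - \<infinity>" for w
  proof -
    \<comment> \<open>Convergence comes from the condition on \<open>rho\<close> alone. Only then is
      \<open>lam\<close> known to vanish, which turns the assumed integral bound into one on the
      immigration factor.\<close>
    have lim1: "(flow 0 \<longlongrightarrow> 1) at_top" by (rule flow_zero_tendsto_one[OF regular B1_0 rho])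
    interpret recurrent_branching a b i1 by (rule curve[OF lim1])
    show ?thesis
      using quasi_stationary_exists[OF lim1] extended_integral_gt_iff[OF w(1)] w(2) lam[OF lim1] by auto
  qed
  moreover have "(\<Sum>i\<in>UNIV. gen_fun (b i) u * partial_deriv (gen_fun m) i u) + (lam + gen_fun a u) * gen_fun m u = 0"
    if m: "quasi_stationary P m" and u: "\<forall>k. 0 \<le> u $ k \<and> u $ k < 1" for m u
    using stationary_pde[of m u] lam[OF lim[OF m]] m u by (auto simp: cube_def less_imp_le)
  ultimately show ?thesis by blast
qed

end
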